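(* Let $E\subset\mathbb{H}^3$ be a compact set containing $p=(0,0,1)$. Then there exists $R'=R'(E)>0$ (uniform over all normalized almost-Fuchsian groups isomorphic to $\pi_1(\Sigma)$) with the following property. Let $\Gamma$ be a normalized almost-Fuchsian group with almost-Fuchsian disk $\widetilde{\Sigma}$ and data $(g,\alpha)$, and let $\{p_i\}\subset E\cap\widetilde{\Sigma}$ be any set of points with $\|\alpha\|_g(p_i)=0$ for each $i$. Then \[\bigcup_i B_{\mathbb{S}^2}\big(\mathcal{G}^{+}_{\widetilde{\Sigma}}(p_i),R'\big)\subset\Omega(\Gamma)\quad\text{and}\quad\bigcup_i B_{\mathbb{S}^2}\big(\mathcal{G}^{-}_{\widetilde{\Sigma}}(p_i),R'\big)\subset\Omega(\Gamma),\] where $B_{\mathbb{S}^2}(x,R')$ denotes the ball of radius $R'$ in the spherical metric on $\mathbb{C}\cup\{\infty\}$.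
   Context: Upper half-space model $\mathbb{H}^3=\{(z,t):z\in\mathbb{C},t>0\}$, $\partial_\infty\mathbb{H}^3=\mathbb{C}\cup\{\infty\}$ with the spherical metric $\frac{|dz|^2}{(1+|z|^2)^2}$. $\Lambda(\Gamma)$ is the limit set and $\Omega(\Gamma)=\partial_\infty\mathbb{H}^3\setminus\Lambda(\Gamma)$ the domain of discontinuity. A quasi-Fuchsian group $\Gamma\cong\pi_1(\Sigma)$ ($\Sigma$ closed oriented, genus $\ge2$) is almost-Fuchsian if $\mathbb{H}^3/\Gamma$ contains a closed minimal surface with principal curvatures $\pm\lambda$, $\lambda^2<1$; its lift is the unique $\Gamma$-invariant embedded minimal disk $\widetilde{\Sigma}$, with induced metric $g$ and Hopf differential $\alpha=(B_{11}-iB_{12})dz^2$ (real part = second fundamental form, $\|\alpha\|_g=|\lambda|$). $\widetilde{\Sigma}$ (and $\Gamma$) is normalized if $p=(0,0,1)\in\widetilde{\Sigma}$, the oriented unit normal $N$ at $p$ is $(0,0,-1)$, and $\alpha(p)=0$. The hyperbolic Gauss maps $\mathcal{G}^{\pm}_{\widetilde{\Sigma}}(q)$ give the endpoint at infinity of the geodesic ray from $q$ with initial velocity $\pm N(q)$. *)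

theory Defs
  imports "HOL-Analysis.Analysis"
begin

text \<open>Points of the upper half-space model: (z,t) with z complex, t > 0.
  Points of the sphere at infinity: Some z (z in C) or None (the point infinity).
  Elements of SL(2,C) are quadruples (a,b,c,d) standing for [[a,b],[c,d]].\<close>

type_synonym pt = "complex \<times> real"
type_synonym bdry = "complex option"
type_synonym mat2 = "complex \<times> complex \<times> complex \<times> complex"

definition H3 :: "pt set" where "H3 = {q. snd q > 0}"
definition H2 :: "pt set" where "H2 = {q. fst q \<in> \<real> \<and> snd q > 0}"
definition p0 :: pt where "p0 = (0, 1)"

definition mmul :: "mat2 \<Rightarrow> mat2 \<Rightarrow> mat2" where
  "mmul M N = (case M of (a,b,c,d) \<Rightarrow> case N of (a',b',c',d') \<Rightarrow>
     (a*a' + b*c', a*b' + b*d', c*a' + d*c', c*b' + d*d'))"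
definition mdet :: "mat2 \<Rightarrow> complex" where
  "mdet M = (case M of (a,b,c,d) \<Rightarrow> a*d - b*c)"
definition mneg :: "mat2 \<Rightarrow> mat2" where
  "mneg M = (case M of (a,b,c,d) \<Rightarrow> (-a,-b,-c,-d))"
definition madj :: "mat2 \<Rightarrow> mat2" where
  "madj M = (case M of (a,b,c,d) \<Rightarrow> (d,-b,-c,a))"
definition mid :: mat2 where "mid = (1,0,0,1)"
definition mreal :: "mat2 \<Rightarrow> bool" where
  "mreal M = (case M of (a,b,c,d) \<Rightarrow> a \<in> \<real> \<and> b \<in> \<real> \<and> c \<in> \<real> \<and> d \<in> \<real>)"

definition psl :: "mat2 \<Rightarrow> mat2 set" where "psl M = {M, mneg M}"
definition PSL :: "mat2 set set" where "PSL = {psl M | M. mdet M = 1}"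
definition rep :: "mat2 set \<Rightarrow> mat2" where "rep A = (SOME M. M \<in> A)"
definition pmul :: "mat2 set \<Rightarrow> mat2 set \<Rightarrow> mat2 set" where
  "pmul A B = psl (mmul (rep A) (rep B))"
definition pinv :: "mat2 set \<Rightarrow> mat2 set" where "pinv A = psl (madj (rep A))"
definition pone :: "mat2 set" where "pone = psl mid"
definition ppow :: "mat2 set \<Rightarrow> nat \<Rightarrow> mat2 set" where
  "ppow A n = (pmul A ^^ n) pone"

definition psl_subgroup :: "mat2 set set \<Rightarrow> bool" where
  "psl_subgroup G \<longleftrightarrow> G \<subseteq> PSL \<and> pone \<in> G \<and> (\<forall>A\<in>G. \<forall>B\<in>G. pmul A B \<in> G)
     \<and> (\<forall>A\<in>G. pinv A \<in> G)"

definition grp_isomorphic :: "mat2 set set \<Rightarrow> mat2 set set \<Rightarrow> bool" where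
  "grp_isomorphic G G' \<longleftrightarrow> (\<exists>\<phi>. bij_betw \<phi> G G' \<and>
     (\<forall>A\<in>G. \<forall>B\<in>G. \<phi> (pmul A B) = pmul (\<phi> A) (\<phi> B)))"

definition discrete_grp :: "mat2 set set \<Rightarrow> bool" where
  "discrete_grp G \<longleftrightarrow> (\<forall>M\<in>\<Union>G. \<exists>e>0. \<forall>N\<in>\<Union>G. dist N M < e \<longrightarrow> N = M)"

definition torsion_free :: "mat2 set set \<Rightarrow> bool" where
  "torsion_free G \<longleftrightarrow> (\<forall>A\<in>G. \<forall>n::nat. n > 0 \<and> ppow A n = pone \<longrightarrow> A = pone)"

definition kleinian :: "mat2 set set \<Rightarrow> bool" where
  "kleinian G \<longleftrightarrow> psl_subgroup G \<and> discrete_grp G"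

section \<open>Actions on the sphere at infinity and on H^3 (Poincare extension)\<close>

definition mob_bdry :: "mat2 \<Rightarrow> bdry \<Rightarrow> bdry" where
  "mob_bdry M \<xi> = (case M of (a,b,c,d) \<Rightarrow>
     (case \<xi> of None \<Rightarrow> (if c = 0 then None else Some (a / c))
      | Some z \<Rightarrow> (if c*z + d = 0 then None else Some ((a*z + b) / (c*z + d)))))"

definition mob_H :: "mat2 \<Rightarrow> pt \<Rightarrow> pt" where
  "mob_H M q = (case M of (a,b,c,d) \<Rightarrow> case q of (z,t) \<Rightarrow>
     (let D = (cmod (c*z + d))\<^sup>2 + (cmod c)\<^sup>2 * t\<^sup>2 in
       (((a*z + b) * cnj (c*z + d) + a * cnj c * complex_of_real (t\<^sup>2)) / complex_of_real D,
        t / D)))"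

definition act_bdry :: "mat2 set \<Rightarrow> bdry \<Rightarrow> bdry" where "act_bdry A = mob_bdry (rep A)"
definition act_H :: "mat2 set \<Rightarrow> pt \<Rightarrow> pt" where "act_H A = mob_H (rep A)"

definition tends_bdry :: "('b \<Rightarrow> pt) \<Rightarrow> bdry \<Rightarrow> 'b filter \<Rightarrow> bool" where
  "tends_bdry f \<xi> F = (case \<xi> of
      Some w \<Rightarrow> ((\<lambda>x. fst (f x)) \<longlongrightarrow> w) F \<and> ((\<lambda>x. snd (f x)) \<longlongrightarrow> 0) F
    | None \<Rightarrow> filterlim (\<lambda>x. norm (f x)) at_top F)"

definition limit_set :: "mat2 set set \<Rightarrow> bdry set" where
  "limit_set G = {\<xi>. \<exists>\<gamma>. (\<forall>n. \<gamma> n \<in> G) \<and> tends_bdry (\<lambda>n. act_H (\<gamma> n) p0) \<xi> sequentially}"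

definition Omega :: "mat2 set set \<Rightarrow> bdry set" where "Omega G = UNIV - limit_set G"

section \<open>Spherical metric |dz|/(1+|z|^2) on C \<union> {\<infinity>}\<close>

definition sph_dist :: "bdry \<Rightarrow> bdry \<Rightarrow> real" where
  "sph_dist \<xi> \<eta> = (case (\<xi>, \<eta>) of
      (Some z, Some w) \<Rightarrow> arcsin (cmod (z - w) / sqrt ((1 + (cmod z)\<^sup>2) * (1 + (cmod w)\<^sup>2)))
    | (Some z, None) \<Rightarrow> arcsin (1 / sqrt (1 + (cmod z)\<^sup>2))
    | (None, Some w) \<Rightarrow> arcsin (1 / sqrt (1 + (cmod w)\<^sup>2))
    | (None, None) \<Rightarrow> 0)"

definition sph_ball :: "bdry \<Rightarrow> real \<Rightarrow> bdry set" where
  "sph_ball x r = {y. sph_dist x y < r}"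

definition sph_continuous_on :: "real set \<Rightarrow> (real \<Rightarrow> bdry) \<Rightarrow> bool" where
  "sph_continuous_on S c \<longleftrightarrow> (\<forall>s\<in>S. \<forall>e>0. \<exists>d>0. \<forall>s'\<in>S. \<bar>s' - s\<bar> < d \<longrightarrow> sph_dist (c s') (c s) < e)"

definition jordan_curve :: "bdry set \<Rightarrow> bool" where
  "jordan_curve L \<longleftrightarrow> (\<exists>c. sph_continuous_on {0..1} c \<and> c 0 = c 1 \<and> inj_on c {0..<1} \<and> c ` {0..1} = L)"

definition sph_path_in :: "bdry set \<Rightarrow> bdry \<Rightarrow> bdry \<Rightarrow> bool" where
  "sph_path_in U \<xi> \<eta> \<longleftrightarrow> (\<exists>c. sph_continuous_on {0..1} c \<and> c 0 = \<xi> \<and> c 1 = \<eta> \<and> c ` {0..1} \<subseteq> U)"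

text \<open>pi_1 of a closed oriented surface of genus >= 2 is represented (uniformization) by a
  torsion-free, discrete, cocompact Fuchsian group G0 (real matrices, acting on the
  vertical hyperbolic plane H2).\<close>
definition surface_group_model :: "mat2 set set \<Rightarrow> bool" where
  "surface_group_model G0 \<longleftrightarrow> kleinian G0 \<and> torsion_free G0 \<and> (\<forall>A\<in>G0. \<exists>M\<in>A. mreal M) \<and>
     (\<exists>K. compact K \<and> K \<subseteq> H2 \<and> H2 = (\<Union>A\<in>G0. act_H A ` K))"

definition quasi_fuchsian :: "mat2 set set \<Rightarrow> mat2 set set \<Rightarrow> bool" where
  "quasi_fuchsian G0 G \<longleftrightarrow> kleinian G \<and> grp_isomorphic G0 G \<and> jordan_curve (limit_set G) \<and>
     (\<forall>A\<in>G. \<forall>\<xi>\<in>Omega G. sph_path_in (Omega G) \<xi> (act_bdry A \<xi>))"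

definition cross' :: "pt \<Rightarrow> pt \<Rightarrow> pt" where
  "cross' u v = (case u of (z, s) \<Rightarrow> case v of (w, r) \<Rightarrow>
     (Complex (Im z * r - s * Im w) (s * Re w - Re z * r), Re z * Im w - Im z * Re w))"

definition D1 :: "(complex \<Rightarrow> pt) \<Rightarrow> complex \<Rightarrow> complex \<Rightarrow> pt" where
  "D1 F z u = frechet_derivative F (at z) u"
definition D2 :: "(complex \<Rightarrow> pt) \<Rightarrow> complex \<Rightarrow> complex \<Rightarrow> complex \<Rightarrow> pt" where
  "D2 F z u v = frechet_derivative (\<lambda>w. frechet_derivative F (at w) u) (at z) v"

definition C2_map :: "(complex \<Rightarrow> pt) \<Rightarrow> bool" where
  "C2_map F \<longleftrightarrow> (\<forall>z. F differentiable (at z)) \<and>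
     (\<forall>u z. (\<lambda>w. frechet_derivative F (at w) u) differentiable (at z)) \<and>
     (\<forall>u v. continuous_on UNIV (\<lambda>w. D2 F w u v))"

definition immersion :: "(complex \<Rightarrow> pt) \<Rightarrow> bool" where
  "immersion F \<longleftrightarrow> (\<forall>z. cross' (D1 F z 1) (D1 F z \<i>) \<noteq> 0)"

definition nE :: "(complex \<Rightarrow> pt) \<Rightarrow> complex \<Rightarrow> pt" where
  "nE F z = (let c = cross' (D1 F z 1) (D1 F z \<i>) in (1 / norm c) *\<^sub>R c)"
definition NH :: "(complex \<Rightarrow> pt) \<Rightarrow> complex \<Rightarrow> pt" where
  "NH F z = snd (F z) *\<^sub>R nE F z"

text \<open>First and second fundamental forms for the hyperbolic metric |dx|^2/t^2;
  the second one uses the Levi-Civita connection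
  nabla_X Y = D_X Y - (X_3 Y + Y_3 X)/t + <X,Y> e_3 / t.\<close>
definition gH :: "(complex \<Rightarrow> pt) \<Rightarrow> complex \<Rightarrow> complex \<Rightarrow> complex \<Rightarrow> real" where
  "gH F z u v = (D1 F z u \<bullet> D1 F z v) / (snd (F z))\<^sup>2"
definition hH :: "(complex \<Rightarrow> pt) \<Rightarrow> complex \<Rightarrow> complex \<Rightarrow> complex \<Rightarrow> real" where
  "hH F z u v = (let t = snd (F z); X = D1 F z u; Y = D1 F z v; N = NH F z in
     ((D2 F z u v - (snd X / t) *\<^sub>R Y - (snd Y / t) *\<^sub>R X + ((X \<bullet> Y) / t) *\<^sub>R (0, 1)) \<bullet> N) / t\<^sup>2)"

definition trS :: "(complex \<Rightarrow> pt) \<Rightarrow> complex \<Rightarrow> real" where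
  "trS F z = (gH F z \<i> \<i> * hH F z 1 1 - 2 * gH F z 1 \<i> * hH F z 1 \<i> + gH F z 1 1 * hH F z \<i> \<i>)
             / (gH F z 1 1 * gH F z \<i> \<i> - (gH F z 1 \<i>)\<^sup>2)"
definition detS :: "(complex \<Rightarrow> pt) \<Rightarrow> complex \<Rightarrow> real" where
  "detS F z = (hH F z 1 1 * hH F z \<i> \<i> - (hH F z 1 \<i>)\<^sup>2)
             / (gH F z 1 1 * gH F z \<i> \<i> - (gH F z 1 \<i>)\<^sup>2)"
definition kappa1 :: "(complex \<Rightarrow> pt) \<Rightarrow> complex \<Rightarrow> real" where
  "kappa1 F z = trS F z / 2 + sqrt ((trS F z)\<^sup>2 / 4 - detS F z)"
definition kappa2 :: "(complex \<Rightarrow> pt) \<Rightarrow> complex \<Rightarrow> real" where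
  "kappa2 F z = trS F z / 2 - sqrt ((trS F z)\<^sup>2 / 4 - detS F z)"

text \<open>Norm of the Hopf differential: ||alpha||_g = |lambda|, principal curvatures \<plusminus>lambda.\<close>
definition hopf_norm :: "(complex \<Rightarrow> pt) \<Rightarrow> complex \<Rightarrow> real" where
  "hopf_norm F z = \<bar>kappa1 F z\<bar>"

text \<open>F parametrizes a properly embedded Gamma-invariant minimal disk with principal curvatures
  \<plusminus>lambda, lambda^2 < 1, on which Gamma acts cocompactly (the lift of the closed minimal
  surface in H^3/Gamma).\<close>
definition AF_disk :: "mat2 set set \<Rightarrow> (complex \<Rightarrow> pt) \<Rightarrow> bool" where
  "AF_disk G F \<longleftrightarrow> C2_map F \<and> immersion F \<and> inj F \<and> range F \<subseteq> H3 \<and>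
     (\<forall>K. compact K \<and> K \<subseteq> H3 \<longrightarrow> compact (F -` K)) \<and>
     (\<forall>A\<in>G. act_H A ` range F = range F) \<and>
     (\<exists>K. compact K \<and> range F = (\<Union>A\<in>G. act_H A ` F ` K)) \<and>
     (\<forall>z. kappa1 F z = - kappa2 F z) \<and> (\<forall>z. (kappa1 F z)\<^sup>2 < 1)"

definition almost_fuchsian :: "mat2 set set \<Rightarrow> mat2 set set \<Rightarrow> (complex \<Rightarrow> pt) \<Rightarrow> bool" where
  "almost_fuchsian G0 G F \<longleftrightarrow> quasi_fuchsian G0 G \<and> AF_disk G F"

definition normalized :: "(complex \<Rightarrow> pt) \<Rightarrow> bool" where
  "normalized F \<longleftrightarrow> (\<exists>z0. F z0 = p0 \<and> NH F z0 = (0, -1) \<and> hopf_norm F z0 = 0)"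

definition hyp_geodesic :: "(real \<Rightarrow> pt) \<Rightarrow> bool" where
  "hyp_geodesic c \<longleftrightarrow> (\<exists>c1 c2. \<forall>s. snd (c s) > 0 \<and> (c has_vector_derivative c1 s) (at s) \<and>
      (c1 has_vector_derivative c2 s) (at s) \<and>
      c2 s - (2 * snd (c1 s) / snd (c s)) *\<^sub>R c1 s + ((c1 s \<bullet> c1 s) / snd (c s)) *\<^sub>R (0, 1) = 0)"

definition geod_endpoint :: "pt \<Rightarrow> pt \<Rightarrow> bdry" where
  "geod_endpoint q v = (THE \<xi>. \<exists>c. hyp_geodesic c \<and> c 0 = q \<and> (c has_vector_derivative v) (at 0)
                          \<and> tends_bdry c \<xi> at_top)"

definition gauss_plus :: "(complex \<Rightarrow> pt) \<Rightarrow> complex \<Rightarrow> bdry" where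
  "gauss_plus F z = geod_endpoint (F z) (NH F z)"
definition gauss_minus :: "(complex \<Rightarrow> pt) \<Rightarrow> complex \<Rightarrow> bdry" where
  "gauss_minus F z = geod_endpoint (F z) (- NH F z)"

end

theory Submission
  imports Defs
begin

text \<open>
  Put the disk into Minkowski space by \<open>X\<close>, with unit normal \<open>N\<close>. Since the principal curvatures are
  smaller than 1, every critical point on the disk of the distance to a point of \<open>H\<^sup>3\<close> is a nondegenerate
  minimum; the disk being proper, the mountain pass argument shows that there is exactly one. Hence the disk
  avoids all balls, and in the limit all horoballs, tangent to it, and horoballs tangent from opposite sides
  are disjoint. This two-sided horoball condition makes the disk a graph of uniform size with Lipschitz
  normal over each of its tangent planes.

  Near a point with vanishing Hopf differential, minimality says that the tangential part of the normal
  solves the Cauchy-Riemann equations up to a quadratic error. It vanishes to first order, so a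
  Cauchy-Pompeiu estimate makes it small compared with the distance. The hyperbolic Gauss map is then
  uniformly close to that of the tangent plane, and by Brouwer's theorem it covers a ball of uniform size.
  The points covered are centres of tangent horoballs of uniform size that miss the disk, so no sequence in the
  disk, in particular no orbit of the group, converges to a point of this ball.
\<close>

section \<open>Critical points of proper functions\<close>

text \<open>The obstacle is uniformity in the group. The parametrization is merely C^2, so no
  derivative of the curvature is controlled and a Taylor expansion of the normal at an umbilic point
  has no uniform remainder. All estimates are therefore explicit. The two-sided horoball condition
  gives \<open>norm (nu z) \<le> norm (proj z)\<close>, the shape operator gives a d-bar derivative
  of size at most 48 r^2, and on a disc of radius R these combine with the vanishing to first order
  into the bound 144 R^3 + 2 r^2 / R. It is small compared with r as soon as R is small and r is
  much smaller than R: R = 1/160 and r = R/16 = 1/2560 make it at most r/4, which leaves the disc of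
  radius r/2 = 1/5120 to Brouwer. The set E enters through M, the maximum over E of cosh of the
  distance to \<open>p0\<close>. It measures the distortion between the frame at an umbilic point
  and the sphere at infinity seen from \<open>p0\<close>, whence the radius 1 / (40960 M). The group
  enters through one orbit: normalization puts \<open>p0\<close> on the invariant disk, and the
  limit set is made of accumulation points of the orbit of \<open>p0\<close>.\<close>

lemma sublevel_locally_connected_at_regular_point:
  fixes h :: "'a::euclidean_space \<Rightarrow> real"
  assumes der: "\<And>x. (h has_derivative h' x) (at x)"
    and cont: "\<And>v. continuous_on UNIV (\<lambda>x. h' x v)"
    and reg: "h' p v \<noteq> 0"
  obtains w d where "d > 0"
    "\<And>x. dist x p < d \<Longrightarrow> h x \<le> h p \<Longrightarrow> x \<in> closure (connected_component_set {x. h x < h p} w)"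
    "\<And>x. dist x p < d \<Longrightarrow> h x < h p \<Longrightarrow> connected_component {x. h x < h p} w x"
proof -
  have lin: "linear (h' x)" for x
    using der has_derivative_linear by blast
  obtain u where u: "h' p u < 0"
  proof (cases "h' p v < 0")
    case False
    then have "h' p (-v) < 0"
      using reg linear_neg[OF lin] by (metis neg_less_0_iff_less linorder_neqE_linordered_idom)
    then show ?thesis using that by blast
  qed (use that in blast)
  have conth: "continuous_on UNIV h"
    using der by (meson continuous_at_imp_continuous_on has_derivative_continuous)
  have "open {x. h' x u < 0}"
    by (rule open_Collect_less[OF cont continuous_on_const])
  then obtain e where e: "e > 0" "\<And>x. dist x p < e \<Longrightarrow> h' x u < 0"
    using u by (metis (mono_tags, lifting) mem_Collect_eq open_dist)
  have u0: "u \<noteq> 0" using u linear_0[OF lin] by auto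
  define s where "s = e / (4 * norm u)"
  have s: "s > 0" "s * norm u = e / 4" using e u0 by (auto simp: s_def)
  \<comment> \<open>A uniform descent: since s |u| = e/4, pushing a point of the ball of radius e/2
    by at most s along u stays where the derivative in direction u is negative.\<close>
  have dec: "h (x + r *\<^sub>R u) < h x" if x: "dist x p < e/2" and r: "0 < r" "r \<le> s" for x r
  proof -
    have ru: "norm (t *\<^sub>R u) \<le> e/4" if "0 \<le> t" "t \<le> r" for t
      using that r s by (metis abs_of_nonneg mult_right_mono norm_ge_zero norm_scaleR order_trans)
    have "\<exists>t. 0 < t \<and> t < r \<and> h (x + r *\<^sub>R u) - h (x + 0 *\<^sub>R u) = (r - 0) * h' (x + t *\<^sub>R u) u"
    proof (rule MVT2[OF r(1)])
      fix t assume "0 \<le> t" "t \<le> r"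
      have "((\<lambda>t. h (x + t *\<^sub>R u)) has_derivative (\<lambda>y. h' (x + t *\<^sub>R u) (y *\<^sub>R u))) (at t)"
        by (rule has_derivative_compose[OF _ der]) (auto intro!: derivative_eq_intros)
      then show "((\<lambda>t. h (x + t *\<^sub>R u)) has_real_derivative h' (x + t *\<^sub>R u) u) (at t)"
        unfolding has_field_derivative_def by (simp add: linear_cmul[OF lin] mult.commute[of _ "h' _ _"] ext)
    qed
    then obtain t where t: "0 < t" "t < r" "h (x + r *\<^sub>R u) - h x = r * h' (x + t *\<^sub>R u) u" by auto
    have "dist (x + t *\<^sub>R u) p \<le> dist x p + norm (t *\<^sub>R u)"
      by (metis add.commute add_diff_cancel_left' dist_norm dist_triangle2 dist_commute)
    also have "\<dots> < e" using x ru[of t] t e(1) by linarith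
    finally show ?thesis using e(2) t r(1) by (smt (verit) mult_pos_neg)
  qed
  have "h (p + s *\<^sub>R u) < h p" using dec[of p s] e s by simp
  moreover have "open {x. h x < h p}" by (rule open_Collect_less[OF conth continuous_on_const])
  ultimately obtain d0 where d0: "d0 > 0" "\<And>x. dist x (p + s *\<^sub>R u) < d0 \<Longrightarrow> h x < h p"
    by (metis (mono_tags, lifting) mem_Collect_eq open_dist)
  define d where "d = min d0 (e/2)"
  let ?w = "p + s *\<^sub>R u" and ?U = "{x. h x < h p}"
  \<comment> \<open>Slide along u up to x + s u, staying below the level of p, then move inside the
    ball about p + s u, which contains the translate of the d-ball about p. Starting at r = 0
    requires x itself to lie below the level.\<close>
  have *: "connected_component ?U ?w (x + r *\<^sub>R u)"
    if x: "dist x p < d" "h x \<le> h p" and r: "0 \<le> r" "r \<le> s" "r = 0 \<Longrightarrow> h x < h p" for x r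
  proof -
    have a: "h (x + t *\<^sub>R u) < h p" if "r \<le> t" "t \<le> s" for t
      using dec[of x t] x r that d_def by (cases "t = 0") (auto intro: less_le_trans)
    have "closed_segment (x + s *\<^sub>R u) (x + r *\<^sub>R u) \<subseteq> ?U"
    proof
      fix y assume "y \<in> closed_segment (x + s *\<^sub>R u) (x + r *\<^sub>R u)"
      then obtain l where l: "0 \<le> l" "l \<le> 1" "y = (1-l) *\<^sub>R (x + s *\<^sub>R u) + l *\<^sub>R (x + r *\<^sub>R u)"
        by (auto simp: in_segment)
      have y: "y = x + (s + l * (r - s)) *\<^sub>R u" unfolding l by (simp add: algebra_simps)
      have "r \<le> s + l * (r - s)" "s + l * (r - s) \<le> s"
        using l r mult_right_mono[of l 1 "s - r"] mult_nonneg_nonpos[of l "r - s"] by (auto simp: algebra_simps)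
      then show "y \<in> ?U" using a y by simp
    qed
    then have 1: "connected_component ?U (x + s *\<^sub>R u) (x + r *\<^sub>R u)"
      by (meson connected_component_def convex_closed_segment convex_connected ends_in_segment)
    have "ball ?w d0 \<subseteq> ?U" using d0(2) by (auto simp: dist_commute)
    moreover have "x + s *\<^sub>R u \<in> ball ?w d0" using x d_def by (simp add: dist_commute)
    ultimately have "connected_component ?U ?w (x + s *\<^sub>R u)"
      by (meson connected_component_def connected_ball d0(1) centre_in_ball)
    then show ?thesis using 1 connected_component_trans by blast
  qed
  show ?thesis
  proof (rule that[of d ?w])
    show "d > 0" using d0 e by (simp add: d_def)
    fix x assume x: "dist x p < d"
    { assume "h x < h p" then show "connected_component ?U ?w x" using *[of x 0] x s by simp }
    assume hx: "h x \<le> h p"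
    have l: "((\<lambda>n. x + (s / Suc n) *\<^sub>R u) \<longlongrightarrow> x + 0 *\<^sub>R u) sequentially"
      by (intro tendsto_intros LIMSEQ_Suc[OF lim_const_over_n])
    show "x \<in> closure (connected_component_set ?U ?w)"
      unfolding closure_sequential
    proof (intro exI conjI allI)
      show "x + (s / Suc n) *\<^sub>R u \<in> connected_component_set ?U ?w" for n
        using *[OF x hx, of "s / Suc n"] s by (simp add: field_simps)
    qed (use l in simp)
  qed
qed

text \<open>A mountain pass argument in which connectedness replaces the usual gradient flow. If y
  were no higher than x0, let c be the infimum of the levels at which x0 and y are connected. A
  critical point at level c that is a limit of lower points cannot be a strict local minimum, and a
  regular point at level c cannot separate the component of x0 in {h < c} from the rest, so y would
  already be joined to x0 below c.\<close>

theorem proper_critical_point_unique: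
  fixes h :: "'a::euclidean_space \<Rightarrow> real"
  assumes der: "\<And>x. (h has_derivative h' x) (at x)"
    and cont: "\<And>v. continuous_on UNIV (\<lambda>x. h' x v)"
    and cpt: "\<And>c. compact {x. h x \<le> c}"
    and strict: "\<And>x. (\<And>v. h' x v = 0) \<Longrightarrow> \<exists>e>0. \<forall>y. y \<noteq> x \<and> dist y x < e \<longrightarrow> h x < h y"
    and crit: "\<And>v. h' x0 v = 0"
    and "y \<noteq> x0"
  shows "h x0 < h y"
proof (rule ccontr)
  assume "\<not> h x0 < h y"
  then have hy: "h y \<le> h x0" by simp
  have conth: "continuous_on A h" for A
    using der by (meson continuous_at_imp_continuous_on has_derivative_continuous)
  obtain e where e: "e > 0" "\<And>y. y \<noteq> x0 \<Longrightarrow> dist y x0 < e \<Longrightarrow> h x0 < h y"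
    using strict[OF crit] by blast
  have "sphere x0 (e/2) \<noteq> {}" using e(1) by simp
  then obtain b where b: "b \<in> sphere x0 (e/2)" "\<And>x. x \<in> sphere x0 (e/2) \<Longrightarrow> h b \<le> h x"
    using continuous_attains_inf[OF compact_sphere _ conth] by blast
  have hb: "h x0 < h b" using b(1) e by (auto intro!: e(2) simp: dist_commute)
  define S where "S = {c. connected_component {x. h x \<le> c} x0 y}"
  \<comment> \<open>A connected set from x0 to y must cross the sphere of radius e/2 about x0, where
    h is at least h b > h x0.\<close>
  have low: "h b \<le> c" if "c \<in> S" for c
  proof -
    have "connected_component {x. h x \<le> c} x0 y" using that by (simp add: S_def)
    then obtain T where T: "connected T" "T \<subseteq> {x. h x \<le> c}" "x0 \<in> T" "y \<in> T"
      unfolding connected_component_def by blast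
    have "y \<notin> ball x0 e" using hy e(2)[of y] assms(6) by (auto simp: dist_commute)
    then have "T \<inter> frontier (ball x0 (e/2)) \<noteq> {}"
      using T e(1) by (intro connected_Int_frontier) auto
    moreover have "frontier (ball x0 (e/2)) = sphere x0 (e/2)" using e(1) by simp
    ultimately obtain x where "x \<in> T" "x \<in> sphere x0 (e/2)" by blast
    then show ?thesis using b(2) T(2) by force
  qed
  have Sne: "S \<noteq> {}"
  proof -
    obtain m where m: "m \<in> closed_segment x0 y" "\<And>x. x \<in> closed_segment x0 y \<Longrightarrow> h x \<le> h m"
      using continuous_attains_sup[OF compact_segment _ conth] by blast
    have "h m \<in> S" unfolding S_def connected_component_def
      using m by (auto intro!: exI[of _ "closed_segment x0 y"])
    then show ?thesis by blast
  qed
  define c where "c = Inf S"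
  have bdd: "bdd_below S" using low by (auto simp: bdd_below_def)
  have cb: "h b \<le> c" unfolding c_def using Sne low by (rule cInf_greatest)
  have up: "connected_component {x. h x \<le> c'} x0 y" if c': "c < c'" for c'
  proof -
    obtain c'' where "c'' \<in> S" "c'' < c'" using c' cInf_less_iff[OF Sne bdd] c_def by auto
    then show ?thesis unfolding S_def
      by (auto intro: connected_component_of_subset)
  qed
  \<comment> \<open>The intersection of these nested compact connected sets is a continuum through
    x0 and y at level at most c, so the infimum is attained by a connected set, though perhaps not
    by a path.\<close>
  define K where "K n = connected_component_set {x. h x \<le> c + 1 / Suc n} x0" for n
  have "connected (\<Inter> (range K))"
  proof (rule connected_nest)
    show "compact (K n)" for n
    proof -
      let ?S = "{x. h x \<le> c + 1 / Suc n}"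
      have "?S \<inter> K n = K n" unfolding K_def using connected_component_subset by blast
      moreover have "closed (K n)" unfolding K_def
        by (rule closed_connected_component[OF compact_imp_closed[OF cpt]])
      ultimately show ?thesis using compact_Int_closed[OF cpt] by metis
    qed
    show "connected (K n)" for n unfolding K_def by simp
    show "K n \<subseteq> K m" if "m \<le> n" for m n unfolding K_def
    proof (rule connected_component_mono)
      have "1 / real (Suc n) \<le> 1 / real (Suc m)" using that by (simp add: frac_le)
      then show "{x. h x \<le> c + 1 / real (Suc n)} \<subseteq> {x. h x \<le> c + 1 / real (Suc m)}" by auto
    qed
  qed
  define C where "C = \<Inter> (range K)"
  have C: "connected C" "x0 \<in> C" "y \<in> C"
    using \<open>connected (\<Inter> (range K))\<close> up hb cb by (auto simp: C_def K_def add_increasing2)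
  have Cle: "h x \<le> c" if "x \<in> C" for x
  proof (rule LIMSEQ_le_const)
    show "(\<lambda>n. c + 1 / Suc n) \<longlonglongrightarrow> c"
      using tendsto_add[OF tendsto_const LIMSEQ_Suc[OF lim_const_over_n], of c 1] by simp
    have "h x \<le> c + 1 / Suc n" for n
      using that connected_component_subset[of "{x. h x \<le> c + 1 / Suc n}" x0] unfolding C_def K_def by blast
    then show "\<exists>N. \<forall>n\<ge>N. h x \<le> c + 1 / Suc n" by blast
  qed
  let ?U = "{x. h x < c}"
  define U1 where "U1 = connected_component_set ?U x0"
  have oU: "open ?U" by (rule open_Collect_less[OF conth continuous_on_const])
  have oU1: "open U1" unfolding U1_def by (rule open_connected_component[OF oU])
  have x0U1: "x0 \<in> U1" using hb cb by (simp add: U1_def)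
  have clU: "x \<in> U1" if "x \<in> closure U1" "h x < c" for x
  proof -
    let ?W = "connected_component_set ?U x"
    have "open ?W" "x \<in> ?W" using open_connected_component[OF oU] that by auto
    then have "?W \<inter> U1 \<noteq> {}" using that(1) open_Int_closure_eq_empty by blast
    then show ?thesis unfolding U1_def
      by (metis connected_component_eq_eq connected_component_nonoverlap mem_Collect_eq inf_commute that(2))
  qed
  have yU1: "y \<notin> U1"
  proof
    assume "y \<in> U1"
    have "path_connected U1" using oU1 connected_open_path_connected U1_def by auto
    then obtain g where g: "path g" "path_image g \<subseteq> U1" "pathstart g = x0" "pathfinish g = y"
      using \<open>y \<in> U1\<close> x0U1 unfolding path_connected_def by blast
    obtain m where m: "m \<in> path_image g" "\<And>x. x \<in> path_image g \<Longrightarrow> h x \<le> h m"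
      using continuous_attains_sup[OF compact_path_image[OF g(1)] path_image_nonempty conth] by blast
    have "h m \<in> S" unfolding S_def connected_component_def
      using m(2) g connected_path_image[OF g(1)] pathstart_in_path_image[of g] pathfinish_in_path_image[of g]
      by (auto intro!: exI[of _ "path_image g"])
    moreover have "h m < c" using m(1) g(2) connected_component_subset[of ?U x0] unfolding U1_def by auto
    ultimately show False using cInf_lower[OF _ bdd] c_def by fastforce
  qed
  \<comment> \<open>The closure of \<open>U1\<close> is shown to be relatively open in C. It is also
    relatively closed and contains x0, so by connectedness it contains y.\<close>
  have op: "\<exists>d>0. \<forall>x\<in>C. dist x p < d \<longrightarrow> x \<in> closure U1" if p: "p \<in> C" "p \<in> closure U1" for p
  proof (cases "h p < c")
    case True
    then have "p \<in> U1" using clU p by blast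
    then obtain d where "d > 0" "\<And>x. dist x p < d \<Longrightarrow> x \<in> U1" using oU1 by (meson open_dist)
    then show ?thesis using closure_subset by blast
  next
    case False
    then have hp: "h p = c" using Cle p by force
    show ?thesis
    proof (cases "\<forall>v. h' p v = 0")
      case True
      then obtain d where d: "d > 0" "\<And>y. y \<noteq> p \<Longrightarrow> dist y p < d \<Longrightarrow> h p < h y" using strict by blast
      obtain x where "x \<in> U1" "dist x p < d" using p(2) d(1) closure_approachable by blast
      moreover have "h x < c" using \<open>x \<in> U1\<close> connected_component_subset[of ?U x0] unfolding U1_def by auto
      ultimately show ?thesis using d(2)[of x] hp by fastforce
    next
      case False
      then obtain v where "h' p v \<noteq> 0" by blast
      then obtain w d where d: "d > 0"
        "\<And>x. dist x p < d \<Longrightarrow> h x \<le> c \<Longrightarrow> x \<in> closure (connected_component_set ?U w)"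
        "\<And>x. dist x p < d \<Longrightarrow> h x < c \<Longrightarrow> connected_component ?U w x"
        using sublevel_locally_connected_at_regular_point[OF der cont] hp by metis
      obtain x where x: "x \<in> U1" "dist x p < d" using p(2) d(1) closure_approachable by blast
      moreover have "h x < c" using \<open>x \<in> U1\<close> connected_component_subset[of ?U x0] unfolding U1_def by auto
      ultimately have "connected_component ?U w x" using d(3) by blast
      moreover have "connected_component ?U x0 x" using x unfolding U1_def by simp
      ultimately have eq: "connected_component_set ?U w = U1" unfolding U1_def
        using connected_component_eq_eq connected_component_sym connected_component_trans by (metis (no_types, lifting) Collect_cong)
      show ?thesis using d(1,2) Cle unfolding eq by auto
    qed
  qed
  have "openin (top_of_set C) (C \<inter> closure U1)"
    unfolding openin_euclidean_subtopology_iff using op by auto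
  moreover have "closedin (top_of_set C) (C \<inter> closure U1)" by (simp add: closedin_closed_Int)
  ultimately have "C \<inter> closure U1 = C"
    using C(1,2) x0U1 closure_subset unfolding connected_clopen by blast
  then have "y \<in> closure U1" using C(3) by blast
  then show False using clU yU1 hy hb cb by force
qed

lemma nondegenerate_critical_point_strict_min:
  fixes h :: "'a::euclidean_space \<Rightarrow> real"
  assumes der: "\<And>x. (h has_derivative h' x) (at x)"
    and der2: "\<And>v. ((\<lambda>x. h' x v) has_derivative h2 v) (at x)"
    and crit: "\<And>v. h' x v = 0"
    and pos: "\<And>v. v \<noteq> 0 \<Longrightarrow> h2 v v > 0"
  shows "\<exists>e>0. \<forall>y. y \<noteq> x \<and> dist y x < e \<longrightarrow> h x < h y"
proof -
  have lin: "linear (h' x)" for x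
    using der has_derivative_linear by blast
  have lin2: "linear (h2 v)" for v
    using der2 has_derivative_linear by blast
  \<comment> \<open>Linearity of \<open>h2\<close> in its first argument is not assumed; it follows
    from linearity of \<open>h' x\<close> by uniqueness of derivatives. It makes the quadratic form
    continuous, so that it has a positive minimum on the unit sphere.\<close>
  have h2sum: "h2 v w = (\<Sum>b\<in>Basis. (v \<bullet> b) * h2 b w)" for v w
  proof -
    have "((\<lambda>x. \<Sum>b\<in>Basis. (v \<bullet> b) * h' x b) has_derivative (\<lambda>w. \<Sum>b\<in>Basis. (v \<bullet> b) * h2 b w)) (at x)"
      by (intro has_derivative_sum has_derivative_mult_right der2)
    moreover have "(\<lambda>x. \<Sum>b\<in>Basis. (v \<bullet> b) * h' x b) = (\<lambda>x. h' x v)"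
    proof
      fix x
      have "h' x v = h' x (\<Sum>b\<in>Basis. (v \<bullet> b) *\<^sub>R b)" by (simp add: euclidean_representation)
      also have "\<dots> = (\<Sum>b\<in>Basis. (v \<bullet> b) * h' x b)"
        by (simp add: linear_sum[OF lin] linear_cmul[OF lin])
      finally show "(\<Sum>b\<in>Basis. (v \<bullet> b) * h' x b) = h' x v" by simp
    qed
    ultimately have "h2 v = (\<lambda>w. \<Sum>b\<in>Basis. (v \<bullet> b) * h2 b w)"
      using has_derivative_unique[OF der2[of v]] by simp
    then show ?thesis by metis
  qed
  have "continuous_on (sphere 0 1) (\<lambda>v. \<Sum>b\<in>Basis. (v \<bullet> b) * h2 b v)"
    using linear_continuous_on[of "h2 _"] lin2 linear_conv_bounded_linear
    by (intro continuous_on_sum continuous_on_mult continuous_on_inner continuous_on_id continuous_on_const) blast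
  moreover have "(\<lambda>v. h2 v v) = (\<lambda>v. \<Sum>b\<in>Basis. (v \<bullet> b) * h2 b v)" by (rule ext, rule h2sum)
  ultimately have c2: "continuous_on (sphere 0 1) (\<lambda>v. h2 v v)" by metis
  have ne: "sphere (0::'a) 1 \<noteq> {}" by simp
  obtain u where u: "u \<in> sphere 0 (1::real)" "\<And>v. v \<in> sphere 0 1 \<Longrightarrow> h2 u u \<le> h2 v v"
    using continuous_attains_inf[OF compact_sphere ne c2] by blast
  define m where "m = h2 u u"
  have "u \<noteq> 0" using u(1) by auto
  then have m0: "m > 0" using pos m_def by blast
  have hm: "m * (norm v)\<^sup>2 \<le> h2 v v" for v
  proof (cases "v = 0")
    case False
    let ?w = "(1 / norm v) *\<^sub>R v"
    have v: "v = norm v *\<^sub>R ?w" using False by simp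
    have sc: "h2 (r *\<^sub>R w) (r *\<^sub>R w) = r\<^sup>2 * h2 w w" for r w
      unfolding h2sum[of "r *\<^sub>R w"] h2sum[of w]
      by (simp add: linear_cmul[OF lin2] sum_distrib_left power2_eq_square mult_ac)
    have "?w \<in> sphere 0 1" using False by simp
    then have "m \<le> h2 ?w ?w" using u(2) m_def by blast
    then have "(norm v)\<^sup>2 * m \<le> (norm v)\<^sup>2 * h2 ?w ?w" by (rule mult_left_mono) simp
    then have "m * (norm v)\<^sup>2 \<le> (norm v)\<^sup>2 * h2 ?w ?w" by (simp only: mult.commute)
    also have "\<dots> = h2 v v" using sc[of "norm v" ?w] v by metis
    finally show ?thesis .
  qed (simp add: linear_0[OF lin2])
  let ?n = "real DIM('a)"
  \<comment> \<open>Chosen so that the errors in the basis directions add up to at most half of the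
    lower bound m |w|^2 of the quadratic form.\<close>
  define k where "k = m / (2 * ?n)"
  have k0: "k > 0" using m0 by (simp add: k_def)
  have ev: "\<exists>e>0. \<forall>y. norm (y - x) < e \<longrightarrow> \<bar>h' y b - h2 b (y - x)\<bar> \<le> k * norm (y - x)" for b
    using der2[of b] k0 unfolding has_derivative_at_alt crit by auto
  have "\<exists>e>0. \<forall>b\<in>Basis. \<forall>y. norm (y - x) < e \<longrightarrow> \<bar>h' y b - h2 b (y - x)\<bar> \<le> k * norm (y - x)"
  proof -
    obtain e where e: "\<And>b. e b > 0" "\<And>b y. norm (y - x) < e b \<Longrightarrow> \<bar>h' y b - h2 b (y - x)\<bar> \<le> k * norm (y - x)"
      using ev by metis
    show ?thesis
      using e by (intro exI[of _ "Min (e ` Basis)"]) (auto simp: Min_gr_iff)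
  qed
  then obtain e where e: "e > 0"
    "\<And>b y. b \<in> Basis \<Longrightarrow> norm (y - x) < e \<Longrightarrow> \<bar>h' y b - h2 b (y - x)\<bar> \<le> k * norm (y - x)" by metis
  have grow: "h' (x + w) w > 0" if w: "w \<noteq> 0" "norm w < e" for w
  proof -
    have "h' (x + w) w = h' (x + w) (\<Sum>b\<in>Basis. (w \<bullet> b) *\<^sub>R b)" by (simp add: euclidean_representation)
    also have "\<dots> = (\<Sum>b\<in>Basis. (w \<bullet> b) * h' (x + w) b)"
      by (simp add: linear_sum[OF lin] linear_cmul[OF lin])
    finally have "h2 w w - h' (x + w) w = (\<Sum>b\<in>Basis. (w \<bullet> b) * (h2 b w - h' (x + w) b))"
      by (simp add: h2sum[of w] sum_subtractf algebra_simps)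
    also have "\<dots> \<le> (\<Sum>b\<in>(Basis::'a set). norm w * (k * norm w))"
    proof (rule sum_mono)
      fix b :: 'a assume b: "b \<in> Basis"
      have "\<bar>(w \<bullet> b) * (h2 b w - h' (x + w) b)\<bar> \<le> norm w * (k * norm w)"
        unfolding abs_mult using e(2)[OF b, of "x + w"] w Basis_le_norm[OF b, of w]
        by (intro mult_mono) (auto simp: abs_minus_commute)
      then show "(w \<bullet> b) * (h2 b w - h' (x + w) b) \<le> norm w * (k * norm w)" by linarith
    qed
    also have "\<dots> = m / 2 * (norm w)\<^sup>2" by (simp add: k_def power2_eq_square)
    finally have "h' (x + w) w \<ge> m / 2 * (norm w)\<^sup>2" using hm[of w] by linarith
    moreover have "m / 2 * (norm w)\<^sup>2 > 0" using m0 w by simp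
    ultimately show ?thesis by linarith
  qed
  show ?thesis
  proof (intro exI conjI allI impI)
    fix y assume y: "y \<noteq> x \<and> dist y x < e"
    define w where "w = y - x"
    have w: "w \<noteq> 0" "norm w < e" using y by (auto simp: w_def dist_norm)
    have "\<exists>t. 0 < t \<and> t < 1 \<and> h (x + 1 *\<^sub>R w) - h (x + 0 *\<^sub>R w) = (1 - 0) * h' (x + t *\<^sub>R w) w"
    proof (rule MVT2)
      fix t :: real
      have "((\<lambda>t. h (x + t *\<^sub>R w)) has_derivative (\<lambda>y. h' (x + t *\<^sub>R w) (y *\<^sub>R w))) (at t)"
        by (rule has_derivative_compose[OF _ der]) (auto intro!: derivative_eq_intros)
      then show "((\<lambda>t. h (x + t *\<^sub>R w)) has_real_derivative h' (x + t *\<^sub>R w) w) (at t)"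
        unfolding has_field_derivative_def by (simp add: linear_cmul[OF lin] mult.commute[of _ "h' _ _"] ext)
    qed simp
    then obtain t where t: "0 < t" "t < 1" "h y - h x = h' (x + t *\<^sub>R w) w" by (auto simp: w_def)
    have "norm (t *\<^sub>R w) < e"
      using t w by (smt (verit) mult_left_le_one_le norm_ge_zero norm_scaleR)
    then have "0 < h' (x + t *\<^sub>R w) (t *\<^sub>R w)" using t w by (intro grow) auto
    then have "0 < h' (x + t *\<^sub>R w) w" using t by (simp add: linear_cmul[OF lin] zero_less_mult_iff)
    then show "h x < h y" using t by simp
  qed (rule e)
qed

section \<open>A Cauchy-Pompeiu estimate\<close>

locale C1_disc =
  fixes f :: "complex \<Rightarrow> complex" and f' :: "complex \<Rightarrow> complex \<Rightarrow> complex" and R :: real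
  assumes R: "0 < R"
    and der: "\<And>z. z \<in> cball 0 R \<Longrightarrow> (f has_derivative f' z) (at z)"
    and cont': "\<And>v. continuous_on (cball 0 R) (\<lambda>z. f' z v)"
begin

text \<open>\<open>P\<close> and \<open>Q\<close> are the Wirtinger derivatives of f with respect to
  z and to its conjugate; \<open>Q\<close> is the Cauchy-Riemann defect.\<close>

definition P where "P z = (f' z 1 - \<i> * f' z \<i>) / 2"
definition Q where "Q z = (f' z 1 + \<i> * f' z \<i>) / 2"
definition c :: "real \<Rightarrow> complex" where "c \<theta> = of_real R * cis \<theta>"

lemma f'_eq: "f' z v = P z * v + Q z * cnj v" if "z \<in> cball 0 R"
proof -
  have lin: "linear (f' z)" using der[OF that] has_derivative_linear by blast
  have "f' z v = f' z (Re v *\<^sub>R 1 + Im v *\<^sub>R \<i>)" by (rule arg_cong[of _ _ "f' z"]) (simp add: complex_eq_iff)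
  also have "\<dots> = Re v *\<^sub>R f' z 1 + Im v *\<^sub>R f' z \<i>"
    by (simp only: linear_add[OF lin] linear_cmul[OF lin])
  also have "\<dots> = P z * v + Q z * cnj v"
    by (simp add: P_def Q_def complex_eq_iff field_simps)
  finally show ?thesis .
qed

lemma f_chain:
  assumes "(p has_vector_derivative v) (at s within S)" and m: "p s \<in> cball 0 R"
  shows "((\<lambda>s. f (p s)) has_vector_derivative P (p s) * v + Q (p s) * cnj v) (at s within S)"
proof -
  have "((\<lambda>s. f (p s)) has_derivative (\<lambda>y. f' (p s) (y *\<^sub>R v))) (at s within S)"
    using has_derivative_compose[OF assms(1)[unfolded has_vector_derivative_def] der[OF m]] .
  then show ?thesis unfolding has_vector_derivative_def
    using linear_cmul[OF has_derivative_linear[OF der[OF m]]] f'_eq[OF m] by simp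
qed

lemma continuous_on_f: "continuous_on (cball 0 R) f"
  using der by (meson continuous_at_imp_continuous_on has_derivative_continuous)

lemma continuous_on_P: "continuous_on (cball 0 R) P"
  unfolding P_def by (intro continuous_intros cont') auto

lemma continuous_on_Q: "continuous_on (cball 0 R) Q"
  unfolding Q_def by (intro continuous_intros cont') auto

lemma norm_c: "norm (c \<theta>) = R"
  using R by (simp add: c_def norm_mult)

lemma c_nz: "c \<theta> \<noteq> 0" using norm_c[of \<theta>] R by auto

lemma continuous_on_c [continuous_intros]: "continuous_on A g \<Longrightarrow> continuous_on A (\<lambda>x. c (g x))"
  unfolding c_def by (auto intro!: continuous_intros)

lemma c_deriv: "(c has_vector_derivative \<i> * c \<theta>) (at \<theta> within A)"
proof -
  have "((\<lambda>\<theta>. of_real R * cis \<theta>) has_vector_derivative of_real R * (\<i> * cis \<theta>)) (at \<theta> within A)"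
    by (intro has_vector_derivative_mult_right) (auto simp: has_vector_derivative_def intro!: derivative_eq_intros)
  then show ?thesis by (simp add: c_def[abs_def] mult_ac)
qed

lemma mem: "(1 - t) *\<^sub>R z0 + t *\<^sub>R c \<theta> \<in> cball 0 R" if "norm z0 \<le> R" "0 \<le> t" "t \<le> 1"
proof -
  have "convex (cball (0::complex) R)" "z0 \<in> cball 0 R" "c \<theta> \<in> cball 0 R"
    using that norm_c by auto
  then show ?thesis using that by (metis convexD_alt)
qed

lemma leibniz:
  assumes z0: "norm z0 \<le> R" and k: "continuous_on {0..2*pi} k" and t: "t \<in> {0..1}"
  shows "((\<lambda>t. integral {0..2*pi} (\<lambda>\<theta>. f ((1 - t) *\<^sub>R z0 + t *\<^sub>R c \<theta>) * k \<theta>)) has_vector_derivative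
     integral {0..2*pi} (\<lambda>\<theta>. (P ((1 - t) *\<^sub>R z0 + t *\<^sub>R c \<theta>) * (c \<theta> - z0) + Q ((1 - t) *\<^sub>R z0 + t *\<^sub>R c \<theta>) * cnj (c \<theta> - z0)) * k \<theta>))
     (at t within {0..1})"
proof -
  have "((\<lambda>t. integral (cbox 0 (2*pi)) (\<lambda>\<theta>. f ((1 - t) *\<^sub>R z0 + t *\<^sub>R c \<theta>) * k \<theta>)) has_vector_derivative
     integral (cbox 0 (2*pi)) (\<lambda>\<theta>. (P ((1 - t) *\<^sub>R z0 + t *\<^sub>R c \<theta>) * (c \<theta> - z0) + Q ((1 - t) *\<^sub>R z0 + t *\<^sub>R c \<theta>) * cnj (c \<theta> - z0)) * k \<theta>))
     (at t within {0..1})"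
  proof (rule leibniz_rule_vector_derivative[where U = "{0..1}"])
    fix s \<theta> :: real assume s: "s \<in> {0..1}" and "\<theta> \<in> cbox 0 (2 * pi)"
    let ?p = "(1 - s) *\<^sub>R z0 + s *\<^sub>R c \<theta>"
    have m: "?p \<in> cball 0 R" using mem z0 s by auto
    have "((\<lambda>s. (1 - s) *\<^sub>R z0 + s *\<^sub>R c \<theta>) has_vector_derivative c \<theta> - z0) (at s within {0..1})"
      unfolding has_vector_derivative_def by (auto intro!: derivative_eq_intros simp: algebra_simps)
    from has_vector_derivative_mult_left[OF f_chain[OF this m]]
    show "((\<lambda>s. f ((1 - s) *\<^sub>R z0 + s *\<^sub>R c \<theta>) * k \<theta>) has_vector_derivative
       (P ?p * (c \<theta> - z0) + Q ?p * cnj (c \<theta> - z0)) * k \<theta>) (at s within {0..1})" .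
  next
    fix s :: real assume s: "s \<in> {0..1}"
    show "(\<lambda>\<theta>. f ((1 - s) *\<^sub>R z0 + s *\<^sub>R c \<theta>) * k \<theta>) integrable_on cbox 0 (2 * pi)"
    proof (rule integrable_continuous)
      show "continuous_on (cbox 0 (2 * pi)) (\<lambda>\<theta>. f ((1 - s) *\<^sub>R z0 + s *\<^sub>R c \<theta>) * k \<theta>)"
        using k mem z0 s by (intro continuous_intros continuous_on_compose2[OF continuous_on_f]) auto
    qed
  next
    have k': "continuous_on ({0..1} \<times> {0..2*pi}) (\<lambda>x::real \<times> real. k (snd x))"
      by (rule continuous_on_compose2[OF k]) (auto intro!: continuous_intros)
    have c1: "continuous_on ({0..1} \<times> {0..2*pi}) (\<lambda>x::real \<times> real. (1 - fst x) *\<^sub>R z0 + fst x *\<^sub>R c (snd x))"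
      by (intro continuous_intros)
    have PQ: "continuous_on ({0..1} \<times> {0..2*pi}) (\<lambda>x::real \<times> real. P ((1 - fst x) *\<^sub>R z0 + fst x *\<^sub>R c (snd x)))"
       "continuous_on ({0..1} \<times> {0..2*pi}) (\<lambda>x::real \<times> real. Q ((1 - fst x) *\<^sub>R z0 + fst x *\<^sub>R c (snd x)))"
      using mem z0 by (auto intro!: continuous_on_compose2[OF continuous_on_P c1] continuous_on_compose2[OF continuous_on_Q c1])
    show "continuous_on ({0..1} \<times> cbox 0 (2 * pi)) (\<lambda>(t, \<theta>). (P ((1 - t) *\<^sub>R z0 + t *\<^sub>R c \<theta>) * (c \<theta> - z0) + Q ((1 - t) *\<^sub>R z0 + t *\<^sub>R c \<theta>) * cnj (c \<theta> - z0)) * k \<theta>)"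
      unfolding split_beta cbox_interval using k' PQ by (intro continuous_intros)
  qed (use t in auto)
  then show ?thesis by (simp add: cbox_interval)
qed

text \<open>The total derivative along a closed circle integrates to zero. Combined with the
  derivative in t, this trades the uncontrolled part \<open>P\<close> for the small part
  \<open>Q\<close>.\<close>

lemma by_parts:
  assumes z0: "norm z0 \<le> R" and t: "0 \<le> t" "t \<le> 1"
    and k: "\<And>\<theta>. \<theta> \<in> {0..2*pi} \<Longrightarrow> (k has_vector_derivative k' \<theta>) (at \<theta> within {0..2*pi})"
    and per: "k (2*pi) = k 0"
  shows "((\<lambda>\<theta>. of_real t * \<i> * (P ((1 - t) *\<^sub>R z0 + t *\<^sub>R c \<theta>) * c \<theta> - Q ((1 - t) *\<^sub>R z0 + t *\<^sub>R c \<theta>) * cnj (c \<theta>)) * k \<theta>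
        + f ((1 - t) *\<^sub>R z0 + t *\<^sub>R c \<theta>) * k' \<theta>) has_integral 0) {0..2*pi}"
proof -
  let ?F = "\<lambda>\<theta>. f ((1 - t) *\<^sub>R z0 + t *\<^sub>R c \<theta>) * k \<theta>"
  have "((\<lambda>\<theta>. f ((1 - t) *\<^sub>R z0 + t *\<^sub>R c \<theta>) * k' \<theta> + of_real t * \<i> * (P ((1 - t) *\<^sub>R z0 + t *\<^sub>R c \<theta>) * c \<theta> - Q ((1 - t) *\<^sub>R z0 + t *\<^sub>R c \<theta>) * cnj (c \<theta>)) * k \<theta>)
      has_integral ?F (2*pi) - ?F 0) {0..2*pi}"
  proof (rule fundamental_theorem_of_calculus)
    fix \<theta> :: real assume th: "\<theta> \<in> {0..2*pi}"
    let ?p = "(1 - t) *\<^sub>R z0 + t *\<^sub>R c \<theta>"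
    have m: "?p \<in> cball 0 R" using mem z0 t by auto
    have "((\<lambda>\<theta>. (1 - t) *\<^sub>R z0 + of_real t * c \<theta>) has_vector_derivative 0 + of_real t * (\<i> * c \<theta>)) (at \<theta> within {0..2*pi})"
      by (intro has_vector_derivative_add has_vector_derivative_const has_vector_derivative_mult_right c_deriv)
    then have "((\<lambda>\<theta>. (1 - t) *\<^sub>R z0 + t *\<^sub>R c \<theta>) has_vector_derivative t *\<^sub>R (\<i> * c \<theta>)) (at \<theta> within {0..2*pi})"
      by (simp add: scaleR_conv_of_real)
    from f_chain[OF this m]
    have "((\<lambda>\<theta>. f ((1 - t) *\<^sub>R z0 + t *\<^sub>R c \<theta>)) has_vector_derivative
        P ?p * (t *\<^sub>R (\<i> * c \<theta>)) + Q ?p * cnj (t *\<^sub>R (\<i> * c \<theta>))) (at \<theta> within {0..2*pi})" .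
    moreover have "P ?p * (t *\<^sub>R (\<i> * c \<theta>)) + Q ?p * cnj (t *\<^sub>R (\<i> * c \<theta>)) = of_real t * \<i> * (P ?p * c \<theta> - Q ?p * cnj (c \<theta>))"
      by (simp add: scaleR_conv_of_real algebra_simps)
    ultimately have "((\<lambda>\<theta>. f ((1 - t) *\<^sub>R z0 + t *\<^sub>R c \<theta>)) has_vector_derivative
        of_real t * \<i> * (P ?p * c \<theta> - Q ?p * cnj (c \<theta>))) (at \<theta> within {0..2*pi})" by simp
    from has_vector_derivative_mult[OF this k[OF th]]
    show "(?F has_vector_derivative f ?p * k' \<theta> + of_real t * \<i> * (P ?p * c \<theta> - Q ?p * cnj (c \<theta>)) * k \<theta>) (at \<theta> within {0..2*pi})" .
  qed simp
  moreover have "?F (2*pi) = ?F 0" using per by (simp add: c_def)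
  ultimately show ?thesis by (simp add: add.commute)
qed

lemma integrable_comp:
  fixes g :: "complex \<Rightarrow> complex" and k :: "real \<Rightarrow> complex"
  assumes "norm z0 \<le> R" "0 \<le> t" "t \<le> 1" "continuous_on (cball 0 R) g" "continuous_on {0..2*pi} k"
  shows "(\<lambda>\<theta>. g ((1 - t) *\<^sub>R z0 + t *\<^sub>R c \<theta>) * k \<theta>) integrable_on {0..2*pi}"
proof (rule integrable_continuous_real)
  have "continuous_on {0..2*pi} (\<lambda>\<theta>. g ((1 - t) *\<^sub>R z0 + t *\<^sub>R c \<theta>))"
    using assms(1-3) mem by (intro continuous_on_compose2[OF assms(4)] continuous_intros) auto
  then show "continuous_on {0..2*pi} (\<lambda>\<theta>. g ((1 - t) *\<^sub>R z0 + t *\<^sub>R c \<theta>) * k \<theta>)"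
    using assms(5) by (rule continuous_on_mult)
qed

lemma norm_integral_le:
  fixes g :: "real \<Rightarrow> complex"
  assumes "g integrable_on {0..2*pi}" "\<And>\<theta>. norm (g \<theta>) \<le> B"
  shows "norm (integral {0..2*pi} g) \<le> 2 * pi * B"
proof -
  have "norm (integral {0..2*pi} g) \<le> integral {0..2*pi} (\<lambda>_. B)"
    by (rule integral_norm_bound_integral[OF assms(1)]) (use assms(2) in auto)
  then show ?thesis by simp
qed

text \<open>The circles \<open>(1 - t) z\<^sub>0 + t c\<close> shrink homothetically to \<open>z\<^sub>0\<close>, and the kernel \<open>c / (c - z\<^sub>0)\<close>
  does not depend on \<open>t\<close>, so differentiating in \<open>t\<close> involves no singular integral.\<close>

lemma cauchy_integral_defect:
  assumes bd: "\<And>z. z \<in> cball 0 R \<Longrightarrow> norm (f' z 1 + \<i> * f' z \<i>) \<le> e" and z0: "norm z0 < R"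
  shows "norm (integral {0..2*pi} (\<lambda>\<theta>. f (c \<theta>) * (c \<theta> / (c \<theta> - z0))) - 2 * pi * f z0) \<le> 2 * pi * (R * e)"
proof -
  have cz: "c \<theta> - z0 \<noteq> 0" for \<theta> using norm_c[of \<theta>] z0 by auto
  have Qe: "norm (Q z) \<le> e / 2" if "z \<in> cball 0 R" for z
    using bd[OF that] by (simp add: Q_def norm_divide)
  let ?k = "\<lambda>\<theta>. c \<theta> / (c \<theta> - z0)"
  have k: "continuous_on {0..2*pi} ?k" using cz by (auto intro!: continuous_intros)
  define p where "p t \<theta> = (1 - t) *\<^sub>R z0 + t *\<^sub>R c \<theta>" for t \<theta>
  define J where "J t = integral {0..2*pi} (\<lambda>\<theta>. f (p t \<theta>) * ?k \<theta>)" for t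
  define J' where "J' t = integral {0..2*pi} (\<lambda>\<theta>. (P (p t \<theta>) * (c \<theta> - z0) + Q (p t \<theta>) * cnj (c \<theta> - z0)) * ?k \<theta>)" for t
  have J: "(J has_vector_derivative J' t) (at t within {0..1})" if "t \<in> {0..1}" for t
    using leibniz[OF _ k that, of z0] z0 unfolding J_def[abs_def] J'_def p_def by simp
  have J'bd: "norm (J' t) \<le> 2 * pi * (R * e)" if t: "0 < t" "t < 1" for t
  proof -
    have mm: "p t \<theta> \<in> cball 0 R" for \<theta> unfolding p_def using mem z0 t by simp
    have i1: "((\<lambda>\<theta>. of_real t * \<i> * (P (p t \<theta>) * c \<theta> - Q (p t \<theta>) * cnj (c \<theta>)) * 1
        + f (p t \<theta>) * 0) has_integral 0) {0..2*pi}"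
      using by_parts[of z0 t "\<lambda>_. 1" "\<lambda>_. 0"] z0 t unfolding p_def by simp
    have "((\<lambda>\<theta>. P (p t \<theta>) * c \<theta> - Q (p t \<theta>) * cnj (c \<theta>)) has_integral 0) {0..2*pi}"
      using has_integral_mult_right[OF i1, of "1 / (of_real t * \<i>)"] t by simp
    then have i0: "integral {0..2*pi} (\<lambda>\<theta>. P (p t \<theta>) * c \<theta> - Q (p t \<theta>) * cnj (c \<theta>)) = 0"
      "(\<lambda>\<theta>. P (p t \<theta>) * c \<theta> - Q (p t \<theta>) * cnj (c \<theta>)) integrable_on {0..2*pi}"
      by (auto simp: integral_unique has_integral_integrable)
    let ?q = "\<lambda>\<theta>. cnj (c \<theta>) + cnj (c \<theta> - z0) * ?k \<theta>"
    have i2: "(\<lambda>\<theta>. Q (p t \<theta>) * ?q \<theta>) integrable_on {0..2*pi}"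
      unfolding p_def using z0 t by (intro integrable_comp continuous_on_Q continuous_on_add continuous_on_mult k continuous_intros) auto
    \<comment> \<open>The kernel cancels the factor c - z0 of \<open>P\<close>. What is left of
      \<open>P\<close> pairs with a \<open>Q\<close> term to an angular derivative of integral zero,
      and the remainder contains \<open>Q\<close> alone.\<close>
    have eq: "(P (p t \<theta>) * (c \<theta> - z0) + Q (p t \<theta>) * cnj (c \<theta> - z0)) * ?k \<theta>
        = (P (p t \<theta>) * c \<theta> - Q (p t \<theta>) * cnj (c \<theta>)) + Q (p t \<theta>) * ?q \<theta>" for \<theta>
      using cz[of \<theta>] by (simp add: field_simps)
    have "J' t = integral {0..2*pi} (\<lambda>\<theta>. Q (p t \<theta>) * ?q \<theta>)"
      unfolding J'_def eq using integral_add[OF i0(2) i2] i0(1) by simp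
    also have "norm \<dots> \<le> 2 * pi * (e / 2 * (R + R))"
    proof (rule norm_integral_le[OF i2])
      fix \<theta>
      have "norm (cnj (c \<theta> - z0)) = norm (c \<theta> - z0)" by (rule complex_mod_cnj)
      then have "norm (cnj (c \<theta> - z0) * ?k \<theta>) = R"
        using cz[of \<theta>] norm_c[of \<theta>] unfolding norm_mult norm_divide by simp
      then have "norm (?q \<theta>) \<le> R + R" using norm_triangle_ineq norm_c[of \<theta>] complex_mod_cnj by metis
      then show "norm (Q (p t \<theta>) * ?q \<theta>) \<le> e / 2 * (R + R)"
        unfolding norm_mult using order_trans[OF norm_ge_zero Qe[OF mm]]
        by (intro mult_mono Qe[OF mm]) auto
    qed
    finally show ?thesis by (simp add: field_simps)
  qed
  have "norm (J 1 - J 0) \<le> 2 * pi * (R * e) * 1 - 2 * pi * (R * e) * 0"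
  proof (rule differentiable_bound_general[where \<phi> = "\<lambda>t. 2 * pi * (R * e) * t" and \<phi>' = "\<lambda>_. 2 * pi * (R * e)" and f' = J'])
    show "continuous_on {0..1} J"
      using J has_vector_derivative_continuous continuous_on_eq_continuous_within by blast
    show "(J has_vector_derivative J' x) (at x)" if "0 < x" "x < 1" for x
      using J[of x] that at_within_interior[of x "{0..1}"] by simp
    show "((\<lambda>t. 2 * pi * (R * e) * t) has_vector_derivative 2 * pi * (R * e)) (at x)" for x
      by (auto intro!: derivative_eq_intros simp: has_vector_derivative_def)
  qed (auto intro!: continuous_intros J'bd)
  moreover have "J 1 = integral {0..2*pi} (\<lambda>\<theta>. f (c \<theta>) * ?k \<theta>)" by (simp add: J_def p_def)
  moreover have "J 0 = 2 * pi * f z0"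
  proof -
    \<comment> \<open>The integral of the kernel over the circle is 2 pi: the kernel minus 1 has the
      primitive Ln (1 - z0 / c) up to the factor i, single-valued on the circle because |z0 / c| <
      1.\<close>
    have "((\<lambda>\<theta>. Ln (1 - z0 / c \<theta>)) has_vector_derivative \<i> * (?k \<theta> - 1)) (at \<theta> within {0..2*pi})" for \<theta>
    proof -
      have lt: "norm (z0 / c \<theta>) < 1" using z0 R by (simp add: norm_divide norm_c)
      then have nn: "1 - z0 / c \<theta> \<notin> \<real>\<^sub>\<le>\<^sub>0"
        by (metis abs_Re_le_cmod complex_nonpos_Reals_iff diff_ge_0_iff_ge minus_complex.sel(1) one_complex.sel(1) le_less_trans less_le_not_le abs_le_D1 diff_le_0_iff_le)
      have "((\<lambda>w. Ln (1 - z0 / w)) has_field_derivative (z0 / (c \<theta>)\<^sup>2) / (1 - z0 / c \<theta>)) (at (c \<theta>))"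
        using nn c_nz[of \<theta>] by (auto intro!: derivative_eq_intros simp: power2_eq_square divide_inverse mult_ac)
      from field_vector_diff_chain_within[OF c_deriv has_field_derivative_at_within[OF this]]
      have "((\<lambda>\<theta>. Ln (1 - z0 / c \<theta>)) has_vector_derivative (\<i> * c \<theta>) * ((z0 / (c \<theta>)\<^sup>2) / (1 - z0 / c \<theta>))) (at \<theta> within {0..2*pi})"
        by (simp add: o_def)
      moreover have "(\<i> * c \<theta>) * ((z0 / (c \<theta>)\<^sup>2) / (1 - z0 / c \<theta>)) = \<i> * (?k \<theta> - 1)"
        using c_nz[of \<theta>] cz[of \<theta>] by (simp add: divide_simps power2_eq_square)
      ultimately show ?thesis by simp
    qed
    then have "((\<lambda>\<theta>. \<i> * (?k \<theta> - 1)) has_integral Ln (1 - z0 / c (2*pi)) - Ln (1 - z0 / c 0)) {0..2*pi}"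
      by (intro fundamental_theorem_of_calculus) auto
    moreover have "c (2*pi) = c 0" by (simp add: c_def)
    ultimately have "((\<lambda>\<theta>. \<i> * (?k \<theta> - 1)) has_integral 0) {0..2*pi}" by simp
    from has_integral_mult_right[OF this, of "- \<i>"]
    have "((\<lambda>\<theta>. ?k \<theta> - 1) has_integral 0) {0..2*pi}" by simp
    from has_integral_add[OF this has_integral_const_real[of "1::complex" 0 "2*pi"]]
    have "(?k has_integral 2 * pi) {0..2*pi}" by (simp add: scaleR_conv_of_real)
    from has_integral_mult_right[OF this, of "f z0"]
    show ?thesis unfolding J_def p_def by (simp add: integral_unique mult.commute)
  qed
  ultimately show ?thesis by simp
qed

text \<open>For holomorphic f the first moment over the circle of radius t R, divided by t, is the
  constant 2 pi f'(0). In general its derivative in t is 2 q(t) / t, where q is a weighted mean of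
  \<open>Q\<close>, and its limit at t = 0 vanishes because f is o(|z|). Integrating the quadratic
  bound on \<open>Q\<close> gives the estimate.\<close>

lemma first_moment_bound:
  assumes bd: "\<And>z. z \<in> cball 0 R \<Longrightarrow> norm (f' z 1 + \<i> * f' z \<i>) \<le> C * (norm z)\<^sup>2"
    and C: "C \<ge> 0" and f0: "f 0 = 0" and f'0: "\<And>v. f' 0 v = 0"
  shows "norm (integral {0..2*pi} (\<lambda>\<theta>. f (c \<theta>) * (1 / c \<theta>))) \<le> 2 * pi * (C * R\<^sup>2)"
proof -
  define m where "m t = integral {0..2*pi} (\<lambda>\<theta>. f (t *\<^sub>R c \<theta>) * (1 / c \<theta>))" for t
  define q where "q t = integral {0..2*pi} (\<lambda>\<theta>. Q (t *\<^sub>R c \<theta>) * (cnj (c \<theta>) / c \<theta>))" for t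
  define m' where "m' t = integral {0..2*pi} (\<lambda>\<theta>. (P (t *\<^sub>R c \<theta>) * c \<theta> + Q (t *\<^sub>R c \<theta>) * cnj (c \<theta>)) * (1 / c \<theta>))" for t
  have k: "continuous_on {0..2*pi} (\<lambda>\<theta>. 1 / c \<theta>)" using c_nz by (auto intro!: continuous_intros)
  have md: "(m has_vector_derivative m' t) (at t within {0..1})" if "t \<in> {0..1}" for t
    using leibniz[OF _ k that, of 0] R unfolding m_def[abs_def] m'_def by simp
  have Qb: "norm (q t) \<le> 2 * pi * (C * R\<^sup>2 / 2 * t\<^sup>2)" and rel: "of_real t * m' t - m t = 2 * of_real t * q t"
    if t: "0 < t" "t \<le> 1" for t
  proof -
    have mm: "t *\<^sub>R c \<theta> \<in> cball 0 R" for \<theta> using mem[of 0 t \<theta>] t R by simp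
    have kc: "continuous_on {0..2*pi} (\<lambda>\<theta>. cnj (c \<theta>) / c \<theta>)" using c_nz by (auto intro!: continuous_intros)
    have i2: "(\<lambda>\<theta>. Q (t *\<^sub>R c \<theta>) * (cnj (c \<theta>) / c \<theta>)) integrable_on {0..2*pi}"
      using integrable_comp[of 0 t Q, OF _ _ _ continuous_on_Q kc] t R by simp
    have i1: "(\<lambda>\<theta>. P (t *\<^sub>R c \<theta>) * 1) integrable_on {0..2*pi}"
      using integrable_comp[of 0 t P "\<lambda>_. 1", OF _ _ _ continuous_on_P] t R by simp
    have i3: "(\<lambda>\<theta>. f (t *\<^sub>R c \<theta>) * (1 / c \<theta>)) integrable_on {0..2*pi}"
      using integrable_comp[of 0 t f, OF _ _ _ continuous_on_f k] t R by simp
    show "norm (q t) \<le> 2 * pi * (C * R\<^sup>2 / 2 * t\<^sup>2)" unfolding q_def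
    proof (rule norm_integral_le[OF i2])
      fix \<theta>
      have "norm (Q (t *\<^sub>R c \<theta>)) \<le> C * (norm (t *\<^sub>R c \<theta>))\<^sup>2 / 2"
        using bd[OF mm, of \<theta>] by (simp add: Q_def norm_divide)
      also have "\<dots> = C * R\<^sup>2 / 2 * t\<^sup>2" using t by (simp add: norm_c power_mult_distrib)
      finally have "norm (Q (t *\<^sub>R c \<theta>)) \<le> C * R\<^sup>2 / 2 * t\<^sup>2" .
      moreover have "norm (cnj (c \<theta>) / c \<theta>) = 1" using norm_c[of \<theta>] R by (simp add: norm_divide)
      ultimately show "norm (Q (t *\<^sub>R c \<theta>) * (cnj (c \<theta>) / c \<theta>)) \<le> C * R\<^sup>2 / 2 * t\<^sup>2"
        unfolding norm_mult by simp
    qed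
    have kd: "((\<lambda>\<theta>. 1 / c \<theta>) has_vector_derivative - \<i> / c \<theta>) (at \<theta> within {0..2*pi})" for \<theta>
    proof -
      have "((\<lambda>w. 1 / w) has_field_derivative - 1 / (c \<theta>)\<^sup>2) (at (c \<theta>))"
        using c_nz[of \<theta>] by (auto intro!: derivative_eq_intros simp: power2_eq_square)
      from field_vector_diff_chain_within[OF c_deriv has_field_derivative_at_within[OF this]]
      show ?thesis using c_nz[of \<theta>] by (simp add: o_def power2_eq_square)
    qed
    have "((\<lambda>\<theta>. of_real t * \<i> * (P (t *\<^sub>R c \<theta>) * c \<theta> - Q (t *\<^sub>R c \<theta>) * cnj (c \<theta>)) * (1 / c \<theta>)
        + f (t *\<^sub>R c \<theta>) * (- \<i> / c \<theta>)) has_integral 0) {0..2*pi}"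
      using by_parts[of 0 t "\<lambda>\<theta>. 1 / c \<theta>", OF _ _ _ kd] t R by (simp add: c_def)
    from has_integral_mult_right[OF this, of "- \<i>"]
    have "((\<lambda>\<theta>. of_real t * (P (t *\<^sub>R c \<theta>) * 1 - Q (t *\<^sub>R c \<theta>) * (cnj (c \<theta>) / c \<theta>))
        - f (t *\<^sub>R c \<theta>) * (1 / c \<theta>)) has_integral 0) {0..2*pi}"
      by (simp add: algebra_simps c_nz diff_divide_distrib)
    then have "integral {0..2*pi} (\<lambda>\<theta>. of_real t * (P (t *\<^sub>R c \<theta>) * 1 - Q (t *\<^sub>R c \<theta>) * (cnj (c \<theta>) / c \<theta>))
        - f (t *\<^sub>R c \<theta>) * (1 / c \<theta>)) = 0" by (rule integral_unique)
    moreover have "integral {0..2*pi} (\<lambda>\<theta>. of_real t * (P (t *\<^sub>R c \<theta>) * 1 - Q (t *\<^sub>R c \<theta>) * (cnj (c \<theta>) / c \<theta>))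
        - f (t *\<^sub>R c \<theta>) * (1 / c \<theta>)) = of_real t * (integral {0..2*pi} (\<lambda>\<theta>. P (t *\<^sub>R c \<theta>) * 1) - q t) - m t"
      unfolding q_def m_def using integral_diff[OF i1 i2] integral_diff[OF integrable_on_mult_right[OF integrable_diff[OF i1 i2], of "of_real t"] i3]
      by simp
    moreover have "m' t = integral {0..2*pi} (\<lambda>\<theta>. P (t *\<^sub>R c \<theta>) * 1 + Q (t *\<^sub>R c \<theta>) * (cnj (c \<theta>) / c \<theta>))"
      unfolding m'_def by (rule integral_cong) (simp add: c_nz field_simps)
    moreover have "\<dots> = integral {0..2*pi} (\<lambda>\<theta>. P (t *\<^sub>R c \<theta>) * 1) + q t"
      unfolding q_def by (rule integral_add[OF i1 i2])
    ultimately show "of_real t * m' t - m t = 2 * of_real t * q t" by (simp add: algebra_simps)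
  qed
  \<comment> \<open>The quotient m(t) / t cannot be started at t = 0. It is started at a small a
    where f = o(|z|) makes it at most d, and d is removed at the end.\<close>
  have key: "norm (m 1) \<le> 2 * pi * (C * R\<^sup>2) + d" if d: "d > 0" for d
  proof -
    define e where "e = d / (2 * pi)"
    have e0: "e > 0" using d by (simp add: e_def)
    have "(f has_derivative f' 0) (at 0)" using der R by simp
    then obtain r where r: "r > 0" "\<And>y. norm y < r \<Longrightarrow> norm (f y) \<le> e * norm y"
      using e0 unfolding has_derivative_at_alt f0 f'0 by fastforce
    define a where "a = min (1/2) (r / (2 * R))"
    have a: "0 < a" "a < 1" using r(1) R by (auto simp: a_def)
    have aR: "a * R < r"
    proof -
      have "a * R \<le> r / (2 * R) * R" using R by (intro mult_right_mono) (auto simp: a_def)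
      then show ?thesis using R r(1) by simp
    qed
    have "norm (m a) \<le> 2 * pi * (e * a)" unfolding m_def
    proof (rule norm_integral_le)
      show "(\<lambda>\<theta>. f (a *\<^sub>R c \<theta>) * (1 / c \<theta>)) integrable_on {0..2*pi}"
        using integrable_comp[of 0 a f, OF _ _ _ continuous_on_f k] a R by simp
      fix \<theta>
      have "norm (a *\<^sub>R c \<theta>) = a * R" using a by (simp add: norm_c)
      then have "norm (f (a *\<^sub>R c \<theta>)) \<le> e * (a * R)" using r(2) aR by metis
      then show "norm (f (a *\<^sub>R c \<theta>) * (1 / c \<theta>)) \<le> e * a"
        using R by (simp add: norm_mult norm_divide norm_c field_simps)
    qed
    then have ma: "norm (m a /\<^sub>R a) \<le> d" using a by (simp add: e_def field_simps)
    have "norm (m 1 /\<^sub>R 1 - m a /\<^sub>R a) \<le> 2 * pi * (C * R\<^sup>2) * 1 - 2 * pi * (C * R\<^sup>2) * a"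
    proof (rule differentiable_bound_general[where f = "\<lambda>t. m t /\<^sub>R t" and \<phi> = "\<lambda>t. 2 * pi * (C * R\<^sup>2) * t" and \<phi>' = "\<lambda>_. 2 * pi * (C * R\<^sup>2)" and f' = "\<lambda>t. (2 / t) *\<^sub>R q t"])
      have "continuous_on {0..1} m" using md has_vector_derivative_continuous continuous_on_eq_continuous_within by blast
      then show "continuous_on {a..1} (\<lambda>t. m t /\<^sub>R t)"
        using a by (intro continuous_intros) (auto intro: continuous_on_subset)
      fix t assume t: "a < t" "t < 1"
      have "(m has_vector_derivative m' t) (at t)"
        using md[of t] t a at_within_interior[of t "{0..1}"] by simp
      then have "((\<lambda>t. (1 / t) *\<^sub>R m t) has_vector_derivative (1 / t) *\<^sub>R m' t + (- 1 / t\<^sup>2) *\<^sub>R m t) (at t)"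
        using t a by (intro has_vector_derivative_scaleR) (auto intro!: derivative_eq_intros simp: power2_eq_square)
      moreover have "(1 / t) *\<^sub>R m' t + (- 1 / t\<^sup>2) *\<^sub>R m t = (2 / t) *\<^sub>R q t"
      proof -
        have "(1 / t) *\<^sub>R m' t + (- 1 / t\<^sup>2) *\<^sub>R m t = (1 / t\<^sup>2) *\<^sub>R (of_real t * m' t - m t)"
          using t a by (simp add: scaleR_conv_of_real field_simps power2_eq_square)
        also have "\<dots> = (2 / t) *\<^sub>R q t" using rel[of t] t a by (simp add: scaleR_conv_of_real power2_eq_square)
        finally show ?thesis .
      qed
      ultimately show "((\<lambda>t. m t /\<^sub>R t) has_vector_derivative (2 / t) *\<^sub>R q t) (at t)"
        by (simp add: divide_inverse)
      have "norm ((2 / t) *\<^sub>R q t) = 2 / t * norm (q t)" using t a by simp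
      also have "\<dots> \<le> 2 / t * (2 * pi * (C * R\<^sup>2 / 2 * t\<^sup>2))"
        using Qb[of t] t a by (intro mult_left_mono) auto
      also have "\<dots> = 2 * pi * (C * R\<^sup>2) * t" using t a by (simp add: field_simps power2_eq_square)
      also have "\<dots> \<le> 2 * pi * (C * R\<^sup>2) * 1" using t C by (intro mult_left_mono) auto
      finally show "norm ((2 / t) *\<^sub>R q t) \<le> 2 * pi * (C * R\<^sup>2)" by simp
    qed (use a in \<open>auto intro!: continuous_intros derivative_eq_intros simp: has_vector_derivative_def\<close>)
    moreover have "2 * pi * (C * R\<^sup>2) * a \<ge> 0" using C a by simp
    ultimately have "norm (m 1 /\<^sub>R 1 - m a /\<^sub>R a) \<le> 2 * pi * (C * R\<^sup>2)" by linarith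
    then have "norm (m 1 - m a /\<^sub>R a) \<le> 2 * pi * (C * R\<^sup>2)" by simp
    then show ?thesis using ma norm_triangle_sub[of "m 1" "m a /\<^sub>R a"] by linarith
  qed
  have "norm (m 1) \<le> 2 * pi * (C * R\<^sup>2)" using key by (rule field_le_epsilon)
  then show ?thesis by (simp add: m_def)
qed

text \<open>The Cauchy kernel c / (c - z0) is expanded as 1 + z0 / c + z0^2 / (c (c - z0)). The mean
  is compared with f 0 = 0, the first moment is bounded above, and the remainder uses the a priori
  bound \<open>K\<close>. The three terms of size C R^3 come from the defects at z0 and at 0 and
  from the first moment.\<close>

lemma quadratic_decay:
  assumes bd: "\<And>z. z \<in> cball 0 R \<Longrightarrow> norm (f' z 1 + \<i> * f' z \<i>) \<le> C * (norm z)\<^sup>2"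
    and C: "C \<ge> 0" and f0: "f 0 = 0" and f'0: "\<And>v. f' 0 v = 0"
    and K: "\<And>z. z \<in> cball 0 R \<Longrightarrow> norm (f z) \<le> K * norm z" and z0: "norm z0 \<le> R / 2"
  shows "norm (f z0) \<le> 3 * C * R ^ 3 + 2 * K * (norm z0)\<^sup>2 / R"
proof -
  have z0': "norm z0 < R" using z0 R by simp
  have bd': "norm (f' z 1 + \<i> * f' z \<i>) \<le> C * R\<^sup>2" if "z \<in> cball 0 R" for z
    using bd[OF that] C that mult_left_mono[OF power_mono[of "norm z" R 2] C] by (simp add: order_trans)
  have "0 \<le> K * R" using order_trans[OF norm_ge_zero K[of "of_real R"]] R by simp
  then have K0: "K \<ge> 0" using R by (simp add: zero_le_mult_iff)
  let ?I = "\<lambda>g. integral {0..2*pi} (\<lambda>\<theta>. f (c \<theta>) * g \<theta>)"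
  have cz: "c \<theta> - z0 \<noteq> 0" for \<theta> using norm_c[of \<theta>] z0' by auto
  have int: "(\<lambda>\<theta>. f (c \<theta>) * g \<theta>) integrable_on {0..2*pi}" if "continuous_on {0..2*pi} g" for g
    using integrable_comp[of 0 1 f g, OF _ _ _ continuous_on_f that] R by simp
  have k1: "continuous_on {0..2*pi} (\<lambda>\<theta>. 1 / c \<theta>)" and k2: "continuous_on {0..2*pi} (\<lambda>\<theta>. z0\<^sup>2 / (c \<theta> * (c \<theta> - z0)))"
    using c_nz cz by (auto intro!: continuous_intros)
  have e: "f (c \<theta>) * (c \<theta> / (c \<theta> - z0)) = (f (c \<theta>) * 1 + z0 * (f (c \<theta>) * (1 / c \<theta>))) + f (c \<theta>) * (z0\<^sup>2 / (c \<theta> * (c \<theta> - z0)))" for \<theta>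
  proof -
    have "c \<theta> / (c \<theta> - z0) = 1 + z0 * (1 / c \<theta>) + z0\<^sup>2 / (c \<theta> * (c \<theta> - z0))"
      using c_nz[of \<theta>] cz[of \<theta>] by (simp add: divide_simps power2_eq_square) (simp add: algebra_simps)
    then show ?thesis by (simp add: algebra_simps)
  qed
  have split: "?I (\<lambda>\<theta>. c \<theta> / (c \<theta> - z0)) = ?I (\<lambda>_. 1) + z0 * ?I (\<lambda>\<theta>. 1 / c \<theta>) + ?I (\<lambda>\<theta>. z0\<^sup>2 / (c \<theta> * (c \<theta> - z0)))"
  proof -
    have i1: "(\<lambda>\<theta>. f (c \<theta>) * 1) integrable_on {0..2*pi}" by (intro int continuous_intros)
    have i2: "(\<lambda>\<theta>. z0 * (f (c \<theta>) * (1 / c \<theta>))) integrable_on {0..2*pi}"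
      by (rule integrable_on_mult_right[OF int[OF k1]])
    show ?thesis unfolding e integral_add[OF integrable_add[OF i1 i2] int[OF k2]] integral_add[OF i1 i2]
      by (simp only: integral_mult_right)
  qed
  have d1: "norm (?I (\<lambda>_. 1)) \<le> 2 * pi * (R * (C * R\<^sup>2))"
    using cauchy_integral_defect[OF bd', of 0] R f0 c_nz by simp
  have d2: "norm (z0 * ?I (\<lambda>\<theta>. 1 / c \<theta>)) \<le> R * (2 * pi * (C * R\<^sup>2))"
    unfolding norm_mult using first_moment_bound[OF bd C f0 f'0] z0' R by (intro mult_mono) auto
  have d3: "norm (?I (\<lambda>\<theta>. z0\<^sup>2 / (c \<theta> * (c \<theta> - z0)))) \<le> 2 * pi * (2 * K * (norm z0)\<^sup>2 / R)"
  proof (rule norm_integral_le[OF int[OF k2]])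
    fix \<theta>
    have "R / 2 \<le> norm (c \<theta> - z0)" using norm_triangle_ineq2[of "c \<theta>" z0] norm_c[of \<theta>] z0 by linarith
    moreover have "norm (f (c \<theta>)) \<le> K * R" using K[of "c \<theta>"] norm_c[of \<theta>] by simp
    ultimately have "norm (f (c \<theta>)) * ((norm z0)\<^sup>2 / (R * norm (c \<theta> - z0))) \<le> (K * R) * ((norm z0)\<^sup>2 / (R * (R / 2)))"
      using R K0 by (intro mult_mono divide_left_mono mult_pos_pos mult_left_mono) auto
    also have "\<dots> = 2 * K * (norm z0)\<^sup>2 / R" using R by (simp add: field_simps)
    finally show "norm (f (c \<theta>) * (z0\<^sup>2 / (c \<theta> * (c \<theta> - z0)))) \<le> 2 * K * (norm z0)\<^sup>2 / R"
      by (simp add: norm_mult norm_divide norm_power norm_c)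
  qed
  have "norm (?I (\<lambda>\<theta>. c \<theta> / (c \<theta> - z0)) - 2 * pi * f z0) \<le> 2 * pi * (R * (C * R\<^sup>2))"
    by (rule cauchy_integral_defect[OF bd' z0'])
  then have "norm (2 * pi * f z0) \<le> 2 * pi * (R * (C * R\<^sup>2)) + norm (?I (\<lambda>\<theta>. c \<theta> / (c \<theta> - z0)))"
    by (smt (verit) norm_triangle_sub norm_minus_commute)
  also have "\<dots> \<le> 2 * pi * (R * (C * R\<^sup>2)) + (2 * pi * (R * (C * R\<^sup>2)) + R * (2 * pi * (C * R\<^sup>2)) + 2 * pi * (2 * K * (norm z0)\<^sup>2 / R))"
    unfolding split using d1 d2 d3 by (intro add_left_mono norm_triangle_le add_mono) auto
  also have "\<dots> = 2 * pi * (3 * C * R ^ 3 + 2 * K * (norm z0)\<^sup>2 / R)"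
    by (simp add: algebra_simps power3_eq_cube power2_eq_square)
  finally show ?thesis by (simp add: norm_mult)
qed

end

section \<open>Horoballs tangent to a disk of small curvature\<close>

text \<open>Minkowski space, time coordinate first: \<open>mk x x = -1\<close>, \<open>fst x > 0\<close> describes \<open>H\<^sup>3\<close>, unit normals
  satisfy \<open>mk n n = 1\<close>, and future null directions are the points at infinity.\<close>

type_synonym mink = "real \<times> complex \<times> real"

definition mk :: "mink \<Rightarrow> mink \<Rightarrow> real" where
  "mk a b = snd a \<bullet> snd b - fst a * fst b"

interpretation mk: bounded_bilinear mk
proof
  show "\<exists>K. \<forall>a b. norm (mk a b) \<le> norm a * norm b * K"
  proof (intro exI allI)
    fix a b :: mink
    have "\<bar>mk a b\<bar> \<le> \<bar>snd a \<bullet> snd b\<bar> + \<bar>fst a * fst b\<bar>" by (simp add: mk_def)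
    also have "\<dots> \<le> norm a * norm b + norm a * norm b"
    proof (rule add_mono)
      have s: "norm (snd v) \<le> norm v" and f: "\<bar>fst v\<bar> \<le> norm v" for v :: mink
        using norm_snd_le[of "snd v" "fst v"] norm_fst_le[of "fst v" "snd v"] by simp_all
      show "\<bar>snd a \<bullet> snd b\<bar> \<le> norm a * norm b"
        by (rule order_trans[OF Cauchy_Schwarz_ineq2 mult_mono]) (auto intro: s)
      show "\<bar>fst a * fst b\<bar> \<le> norm a * norm b"
        unfolding abs_mult by (rule mult_mono) (auto intro: f)
    qed
    finally show "norm (mk a b) \<le> norm a * norm b * 2" by simp
  qed
qed (simp_all add: mk_def algebra_simps inner_add_left inner_add_right)

section \<open>Causal vectors and reversed Cauchy-Schwarz inequalities\<close>

lemmas mk_simps = mk.add_left mk.add_right mk.diff_left mk.diff_right mk.minus_left mk.minus_right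
  mk.scaleR_left mk.scaleR_right mk.zero_left mk.zero_right

lemma mk_commute: "mk a b = mk b a"
  by (simp add: mk_def inner_commute mult.commute)

lemma mk_self: "mk a a = (norm (snd a))\<^sup>2 - (fst a)\<^sup>2"
  by (simp add: mk_def power2_norm_eq_inner power2_eq_square[of "fst a"])

lemma causal_norm_le: "norm (snd a) \<le> fst a" if "mk a a \<le> 0" "0 \<le> fst a"
proof (rule power2_le_imp_le)
  show "(norm (snd a))\<^sup>2 \<le> (fst a)\<^sup>2"
    using that by (simp add: mk_self)
qed (use that in simp)

lemma timelike_norm_less: "norm (snd a) < fst a" if "mk a a < 0" "0 < fst a"
proof (rule power2_less_imp_less)
  show "(norm (snd a))\<^sup>2 < (fst a)\<^sup>2"
    using that by (simp add: mk_self)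
qed (use that in simp)

text \<open>A quantitative reversed Cauchy-Schwarz inequality. The factor of \<open>fst a\<close> is
  positive, so bounding the distance to b bounds the time coordinate of a; properness is transported
  this way from one base point to all others.\<close>

lemma causal_timelike_lower:
  assumes "mk a a \<le> 0" "0 \<le> fst a" "mk b b < 0" "0 < fst b"
  shows "fst a * (fst b - norm (snd b)) \<le> - mk a b"
proof -
  have "snd a \<bullet> snd b \<le> norm (snd a) * norm (snd b)" by (rule norm_cauchy_schwarz)
  also have "\<dots> \<le> fst a * norm (snd b)" using causal_norm_le[OF assms(1,2)] by (intro mult_right_mono) auto
  finally show ?thesis by (simp add: mk_def algebra_simps)
qed

lemma timelike_mk_neg: "mk a b < 0" if "mk a a \<le> 0" "0 < fst a" "mk b b < 0" "0 < fst b"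
proof -
  have "0 < fst a * (fst b - norm (snd b))" using that timelike_norm_less[of b] by (intro mult_pos_pos) auto
  then show ?thesis using causal_timelike_lower[of a b] that by linarith
qed

lemma null_mk_nonpos: "mk a b \<le> 0" if "mk a a = 0" "0 < fst a" "mk b b = 0" "0 < fst b"
proof -
  have "snd a \<bullet> snd b \<le> norm (snd a) * norm (snd b)" by (rule norm_cauchy_schwarz)
  also have "\<dots> \<le> fst a * fst b" using causal_norm_le[of a] causal_norm_le[of b] that by (intro mult_mono) auto
  finally show ?thesis by (simp add: mk_def)
qed

lemma null_parallel:
  assumes "mk a a = 0" "0 < fst a" "mk b b = 0" "0 < fst b" "mk a b = 0"
  obtains c where "c > 0" "a = c *\<^sub>R b"
proof -
  have na: "norm (snd a) = fst a" and nb: "norm (snd b) = fst b"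
    using assms by (auto simp: mk_def norm_eq_sqrt_inner)
  have "snd a \<bullet> snd b = norm (snd a) * norm (snd b)" using assms(5) by (simp add: mk_def na nb)
  then have "fst a *\<^sub>R snd b = fst b *\<^sub>R snd a" using norm_cauchy_schwarz_eq na nb by metis
  then have "snd a = (fst a / fst b) *\<^sub>R snd b"
    using assms(4) by (metis (no_types) divide_inverse mult.commute right_inverse less_numeral_extra(3) scaleR_one scaleR_scaleR)
  then have "a = (fst a / fst b) *\<^sub>R b" using assms(4) by (simp add: prod_eq_iff)
  then show ?thesis using that assms by (metis divide_pos_pos)
qed

lemma unit_timelike_mk_le:
  assumes "mk a a = -1" "0 < fst a" "mk b b = -1" "0 < fst b"
  shows "mk a b \<le> -1"
proof -
  let ?p = "norm (snd a)" and ?q = "norm (snd b)"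
  have a: "(fst a)\<^sup>2 = 1 + ?p\<^sup>2" and b: "(fst b)\<^sup>2 = 1 + ?q\<^sup>2"
    using assms by (auto simp: mk_self)
  have "(1 + ?p * ?q)\<^sup>2 \<le> (fst a * fst b)\<^sup>2"
  proof -
    have "(1 + ?p\<^sup>2) * (1 + ?q\<^sup>2) - (1 + ?p * ?q)\<^sup>2 = (?p - ?q)\<^sup>2" by (simp add: power2_eq_square algebra_simps)
    then show ?thesis unfolding power_mult_distrib a b using zero_le_power2[of "?p - ?q"] by linarith
  qed
  then have "1 + ?p * ?q \<le> fst a * fst b" by (rule power2_le_imp_le) (use assms in simp)
  then show ?thesis using norm_cauchy_schwarz[of "snd a" "snd b"] unfolding mk_def by linarith
qed

text \<open>This makes x + n and x - n future pointing, so that they represent points at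
  infinity.\<close>

lemma unit_normal_fst_less:
  assumes "mk x x = -1" "0 < fst x" "mk n n = 1" "mk x n = 0"
  shows "\<bar>fst n\<bar> < fst x"
proof -
  have a: "(fst x)\<^sup>2 = 1 + (norm (snd x))\<^sup>2" and b: "(norm (snd n))\<^sup>2 = 1 + (fst n)\<^sup>2"
    using assms by (auto simp: mk_self)
  have "snd x \<bullet> snd n = fst x * fst n" using assms by (simp add: mk_def)
  then have "(fst x * fst n)\<^sup>2 \<le> (norm (snd x))\<^sup>2 * (norm (snd n))\<^sup>2"
    using Cauchy_Schwarz_ineq[of "snd x" "snd n"] by (simp add: power2_norm_eq_inner)
  then have "(1 + (norm (snd x))\<^sup>2) * (fst n)\<^sup>2 \<le> (norm (snd x))\<^sup>2 * (1 + (fst n)\<^sup>2)"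
    unfolding power_mult_distrib a b .
  then have "(fst n)\<^sup>2 < (fst x)\<^sup>2" unfolding a by (simp add: algebra_simps)
  then have "\<bar>fst n\<bar>\<^sup>2 < (fst x)\<^sup>2" by simp
  then show ?thesis by (rule power2_less_imp_less) (use assms(2) in simp)
qed

lemma gram_cramer:
  fixes r s A B C :: real
  assumes 1: "r * A + s * B = 0" and 2: "r * B + s * C = 0" and D: "A * C - B\<^sup>2 \<noteq> 0"
  shows "r = 0" "s = 0"
proof -
  have "r * (A * C - B\<^sup>2) = C * (r * A + s * B) - B * (r * B + s * C)"
    "s * (A * C - B\<^sup>2) = A * (r * B + s * C) - B * (r * A + s * B)"
    by (simp_all add: power2_eq_square algebra_simps)
  then show "r = 0" "s = 0" unfolding 1 2 using D by simp_all
qed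

lemma mink_basis:
  assumes x: "mk x x = -1" and n: "mk n n = 1" "mk x n = 0"
    and a: "mk x a = 0" "mk n a = 0" and b: "mk x b = 0" "mk n b = 0"
    and gram: "mk a a * mk b b - (mk a b)\<^sup>2 \<noteq> 0"
  shows "\<exists>t r s k. w = t *\<^sub>R x + r *\<^sub>R a + s *\<^sub>R b + k *\<^sub>R n"
proof -
  \<comment> \<open>The four coefficients are packed into a vector of the same four-dimensional
    space, so that injectivity of an endomorphism gives surjectivity.\<close>
  define \<Lambda> :: "mink \<Rightarrow> mink" where
    "\<Lambda> v = fst v *\<^sub>R x + Re (fst (snd v)) *\<^sub>R a + Im (fst (snd v)) *\<^sub>R b + snd (snd v) *\<^sub>R n" for v
  have lin: "linear \<Lambda>" by (rule linearI) (simp_all add: \<Lambda>_def algebra_simps)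
  have "inj \<Lambda>" unfolding linear_injective_0[OF lin]
  proof (intro allI impI)
    fix v assume v: "\<Lambda> v = 0"
    define t r s k where d: "t = fst v" "r = Re (fst (snd v))" "s = Im (fst (snd v))" "k = snd (snd v)"
    have 0: "t *\<^sub>R x + r *\<^sub>R a + s *\<^sub>R b + k *\<^sub>R n = 0" using v by (simp add: \<Lambda>_def d)
    have "mk x (t *\<^sub>R x + r *\<^sub>R a + s *\<^sub>R b + k *\<^sub>R n) = 0" "mk n (t *\<^sub>R x + r *\<^sub>R a + s *\<^sub>R b + k *\<^sub>R n) = 0"
      "mk a (t *\<^sub>R x + r *\<^sub>R a + s *\<^sub>R b + k *\<^sub>R n) = 0" "mk b (t *\<^sub>R x + r *\<^sub>R a + s *\<^sub>R b + k *\<^sub>R n) = 0"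
      unfolding 0 by (simp_all add: mk_simps)
    then have e: "t = 0" "k = 0" "r * mk a a + s * mk a b = 0" "r * mk a b + s * mk b b = 0"
      using assms by (simp_all add: mk_simps mk_commute[of n x] mk_commute[of a x] mk_commute[of b x] mk_commute[of a n] mk_commute[of b n] mk_commute[of b a])
    have "r = 0" "s = 0" using gram_cramer[OF e(3,4) gram] by simp_all
    then show "v = 0" using e d by (simp add: prod_eq_iff complex_eq_iff)
  qed
  then have "surj \<Lambda>" using linear_injective_imp_surjective[OF lin] by blast
  then obtain v where "w = \<Lambda> v" by (metis surjD)
  then show ?thesis unfolding \<Lambda>_def by blast
qed

section \<open>First and second fundamental forms of a disk in the hyperboloid\<close>

lemma linear_complex_split: "f u = Re u *\<^sub>R f 1 + Im u *\<^sub>R f \<i>" if "linear f"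
proof -
  have "f (Re u *\<^sub>R 1 + Im u *\<^sub>R \<i>) = Re u *\<^sub>R f 1 + Im u *\<^sub>R f \<i>"
    by (simp only: linear_add[OF that] linear_cmul[OF that])
  moreover have "Re u *\<^sub>R 1 + Im u *\<^sub>R \<i> = u" by (simp add: complex_eq_iff)
  ultimately show ?thesis by simp
qed

text \<open>The flat second derivative \<open>X2\<close> differs from the covariant one by a
  multiple of X, which is orthogonal to N. Hence \<open>mk (X2 z u v) (N z)\<close> is the second
  fundamental form, and \<open>small\<close> says that the principal curvatures have modulus below
  1. Since -\<open>fst (X z)\<close> is a product with a fixed unit timelike vector,
  \<open>proper\<close> is properness for the distance to one point.\<close>

locale minimal_disk =
  fixes X N :: "complex \<Rightarrow> mink" and X' N' :: "complex \<Rightarrow> complex \<Rightarrow> mink"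
    and X2 :: "complex \<Rightarrow> complex \<Rightarrow> complex \<Rightarrow> mink"
  assumes dX: "\<And>z. (X has_derivative X' z) (at z)"
    and dN: "\<And>z. (N has_derivative N' z) (at z)"
    and dX': "\<And>z u. ((\<lambda>z. X' z u) has_derivative X2 z u) (at z)"
    and cont2: "\<And>u v. continuous_on UNIV (\<lambda>z. X2 z u v)"
    and sym2: "\<And>z u v. X2 z u v = X2 z v u"
    and XX: "\<And>z. mk (X z) (X z) = -1" and Xfut: "\<And>z. 0 < fst (X z)"
    and NN: "\<And>z. mk (N z) (N z) = 1" and XN: "\<And>z. mk (X z) (N z) = 0"
    and X'N: "\<And>z u. mk (X' z u) (N z) = 0"
    and imm: "\<And>z u. u \<noteq> 0 \<Longrightarrow> 0 < mk (X' z u) (X' z u)"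
    and minimal: "\<And>z. mk (X' z \<i>) (X' z \<i>) * mk (X2 z 1 1) (N z) - 2 * mk (X' z 1) (X' z \<i>) * mk (X2 z 1 \<i>) (N z)
       + mk (X' z 1) (X' z 1) * mk (X2 z \<i> \<i>) (N z) = 0"
    and small: "\<And>z u. u \<noteq> 0 \<Longrightarrow> \<bar>mk (X2 z u u) (N z)\<bar> < mk (X' z u) (X' z u)"
    and proper: "\<And>c. compact {z. fst (X z) \<le> c}"
    and injX: "inj X"
begin

abbreviation "g z u v \<equiv> mk (X' z u) (X' z v)"
abbreviation "h z u v \<equiv> mk (X2 z u v) (N z)"

text \<open>Reversing the normal is a symmetry of all assumptions, so each statement about the side
  of N also holds for the other side.\<close>

lemma flip: "minimal_disk X (\<lambda>z. - N z) X' (\<lambda>z u. - N' z u) X2"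
proof
  show "((\<lambda>z. - N z) has_derivative (\<lambda>u. - N' z u)) (at z)" for z by (rule has_derivative_minus[OF dN])
  show "g z \<i> \<i> * mk (X2 z 1 1) (- N z) - 2 * g z 1 \<i> * mk (X2 z 1 \<i>) (- N z) + g z 1 1 * mk (X2 z \<i> \<i>) (- N z) = 0" for z
    using minimal[of z] by (simp add: mk_simps algebra_simps)
  show "X2 z u v = X2 z v u" for z u v by (rule sym2)
qed (use dX dX' cont2 XX Xfut NN XN X'N imm small proper injX in \<open>simp_all add: mk_simps\<close>)

lemma cont_X: "continuous_on A X" and cont_N: "continuous_on A N" and cont_X': "continuous_on A (\<lambda>z. X' z u)"
  using dX dN dX' by (meson continuous_at_imp_continuous_on has_derivative_continuous)+

lemma linear_X': "linear (X' z)" and linear_X2: "linear (X2 z u)"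
  using dX dX' has_derivative_linear by blast+

lemma X'_split: "X' z u = Re u *\<^sub>R X' z 1 + Im u *\<^sub>R X' z \<i>"
  by (rule linear_complex_split[OF linear_X'])

lemma linear_X2_left: "linear (\<lambda>u. X2 z u v)"
  using linear_X2[of z v] sym2[of z _ v] by simp

lemma X2_split: "X2 z u v = (Re u * Re v) *\<^sub>R X2 z 1 1 + (Re u * Im v + Im u * Re v) *\<^sub>R X2 z 1 \<i> + (Im u * Im v) *\<^sub>R X2 z \<i> \<i>"
proof -
  have "X2 z u v = Re u *\<^sub>R X2 z 1 v + Im u *\<^sub>R X2 z \<i> v"
    by (rule linear_complex_split[OF linear_X2_left])
  moreover have "X2 z w v = Re v *\<^sub>R X2 z w 1 + Im v *\<^sub>R X2 z w \<i>" for w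
    by (rule linear_complex_split[OF linear_X2])
  ultimately show ?thesis using sym2[of z \<i> 1] by (simp add: algebra_simps)
qed

lemma g_split: "g z u v = (Re u * Re v) * g z 1 1 + (Re u * Im v + Im u * Re v) * g z 1 \<i> + (Im u * Im v) * g z \<i> \<i>"
  unfolding X'_split[of z u] X'_split[of z v]
  by (simp add: mk_simps mk_commute[of "X' z \<i>" "X' z 1"] algebra_simps)

lemma h_split: "h z u v = (Re u * Re v) * h z 1 1 + (Re u * Im v + Im u * Re v) * h z 1 \<i> + (Im u * Im v) * h z \<i> \<i>"
  unfolding X2_split[of z u v] by (simp add: mk_simps)

lemma gram_scale: "g z u u * g z v v - (g z u v)\<^sup>2 = (Re u * Im v - Im u * Re v)\<^sup>2 * (g z 1 1 * g z \<i> \<i> - (g z 1 \<i>)\<^sup>2)"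
  unfolding g_split[of z u u] g_split[of z v v] g_split[of z u v]
  by (simp add: power2_eq_square algebra_simps)

lemma gram_pos_std: "g z 1 1 * g z \<i> \<i> - (g z 1 \<i>)\<^sup>2 > 0"
proof -
  let ?u = "Complex (- g z 1 \<i>) (g z 1 1)"
  have p: "g z 1 1 > 0" using imm by simp
  then have "?u \<noteq> 0" by (simp add: complex_eq_iff)
  then have "g z ?u ?u > 0" by (rule imm)
  moreover have "g z ?u ?u = g z 1 1 * (g z 1 1 * g z \<i> \<i> - (g z 1 \<i>)\<^sup>2)"
    unfolding g_split[of z ?u ?u] by (simp add: power2_eq_square algebra_simps)
  ultimately show ?thesis using p by (simp add: zero_less_mult_iff)
qed

lemma gram_pos: "g z u u * g z v v - (g z u v)\<^sup>2 > 0" if "Re u * Im v - Im u * Re v \<noteq> 0"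
  unfolding gram_scale[of z u v] using that gram_pos_std[of z] by simp

text \<open>Under a change of basis the expression scales by the square of the determinant, so the
  mean curvature equation holds in every basis; later the basis is adapted to a projection.\<close>

lemma trace_zero: "g z v v * h z u u - 2 * g z u v * h z u v + g z u u * h z v v = 0"
proof -
  have "g z v v * h z u u - 2 * g z u v * h z u v + g z u u * h z v v
     = (Re u * Im v - Im u * Re v)\<^sup>2 * (g z \<i> \<i> * h z 1 1 - 2 * g z 1 \<i> * h z 1 \<i> + g z 1 1 * h z \<i> \<i>)"
    unfolding g_split[of z u u] g_split[of z v v] g_split[of z u v] h_split[of z u u] h_split[of z v v] h_split[of z u v]
    by (simp add: power2_eq_square algebra_simps)
  then show ?thesis using minimal by simp
qed

lemma const_deriv: "D = (\<lambda>_. 0)" if "((\<lambda>z. c::real) has_derivative D) (at z)"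
  using has_derivative_unique[OF that has_derivative_const] .

lemma X'X: "mk (X' z u) (X z) = 0"
proof -
  have "((\<lambda>z. mk (X z) (X z)) has_derivative (\<lambda>u. mk (X z) (X' z u) + mk (X' z u) (X z))) (at z)"
    by (rule mk.FDERIV[OF dX dX])
  from const_deriv[OF this[unfolded XX]]
  have "mk (X z) (X' z u) + mk (X' z u) (X z) = 0" by meson
  then show ?thesis by (simp add: mk_commute)
qed

lemma X2X: "mk (X2 z u v) (X z) = - g z u v"
proof -
  have "((\<lambda>z. mk (X' z u) (X z)) has_derivative (\<lambda>v. mk (X' z u) (X' z v) + mk (X2 z u v) (X z))) (at z)"
    by (rule mk.FDERIV[OF dX' dX])
  from const_deriv[OF this[unfolded X'X]] have "mk (X' z u) (X' z v) + mk (X2 z u v) (X z) = 0" by meson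
  then show ?thesis by simp
qed

lemma X'N': "mk (X' z u) (N' z v) = - h z u v"
proof -
  have "((\<lambda>z. mk (X' z u) (N z)) has_derivative (\<lambda>v. mk (X' z u) (N' z v) + mk (X2 z u v) (N z))) (at z)"
    by (rule mk.FDERIV[OF dX' dN])
  from const_deriv[OF this[unfolded X'N]] have "mk (X' z u) (N' z v) + mk (X2 z u v) (N z) = 0" by meson
  then show ?thesis by simp
qed

lemma NN': "mk (N z) (N' z v) = 0"
proof -
  have "((\<lambda>z. mk (N z) (N z)) has_derivative (\<lambda>u. mk (N z) (N' z u) + mk (N' z u) (N z))) (at z)"
    by (rule mk.FDERIV[OF dN dN])
  from const_deriv[OF this[unfolded NN]]
  have "mk (N z) (N' z v) + mk (N' z v) (N z) = 0" by meson
  then show ?thesis by (simp add: mk_commute)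
qed

lemma XN': "mk (X z) (N' z v) = 0"
proof -
  have "((\<lambda>z. mk (X z) (N z)) has_derivative (\<lambda>u. mk (X z) (N' z u) + mk (X' z u) (N z))) (at z)"
    by (rule mk.FDERIV[OF dX dN])
  from const_deriv[OF this[unfolded XN]]
  have "mk (X z) (N' z v) + mk (X' z v) (N z) = 0" by meson
  then show ?thesis by (simp add: X'N)
qed

lemma basis: "\<exists>t r s k. w = t *\<^sub>R X z + r *\<^sub>R X' z u + s *\<^sub>R X' z v + k *\<^sub>R N z"
  if "Re u * Im v - Im u * Re v \<noteq> 0"
  by (rule mink_basis) (use XX NN XN X'X X'N gram_pos[OF that, of z] mk_commute in \<open>auto simp: mk_commute\<close>)

section \<open>Critical points of the distance to a point\<close>

definition crit :: "mink \<Rightarrow> complex \<Rightarrow> bool" where "crit p z \<longleftrightarrow> (\<forall>u. mk (X' z u) p = 0)"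

text \<open>For p on the hyperboloid, - \<open>mk (X z) p\<close> is cosh of its distance to X z.
  Criticality removes the tangential coefficients because the Gram determinant is nonzero; p then
  lies on the geodesic through X z normal to the disk.\<close>

lemma crit_decomp: "p = (- mk (X z) p) *\<^sub>R X z + mk (N z) p *\<^sub>R N z" if c: "crit p z"
proof -
  obtain t r s k where p: "p = t *\<^sub>R X z + r *\<^sub>R X' z 1 + s *\<^sub>R X' z \<i> + k *\<^sub>R N z"
    using basis[of 1 \<i> p z] by auto
  have e: "r * g z 1 1 + s * g z 1 \<i> = 0" "r * g z 1 \<i> + s * g z \<i> \<i> = 0"
    using c[unfolded crit_def, rule_format, of 1] c[unfolded crit_def, rule_format, of \<i>]
    unfolding p by (simp_all add: mk_simps X'X X'N mk_commute[of "X' z \<i>" "X' z 1"])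
  have "r = 0" "s = 0" using gram_cramer[OF e] gram_pos_std[of z] by simp_all
  then have p: "p = t *\<^sub>R X z + k *\<^sub>R N z" using p by simp
  have "mk (X z) p = - t" "mk (N z) p = k"
    unfolding p by (simp_all add: mk_simps XX XN NN mk_commute[of "N z" "X z"])
  then show ?thesis using p by simp
qed

lemma crit_norm: "(mk (X z) p)\<^sup>2 - (mk (N z) p)\<^sup>2 = 1" if "crit p z" "mk p p = -1"
proof -
  have "mk p p = mk ((- mk (X z) p) *\<^sub>R X z + mk (N z) p *\<^sub>R N z) p"
    using crit_decomp[OF that(1)] by metis
  then show ?thesis using that(2) by (simp add: mk_simps power2_eq_square)
qed

lemma height_deriv: "((\<lambda>z. - mk (X z) p) has_derivative (\<lambda>v. - mk (X' z v) p)) (at z)"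
  by (intro has_derivative_minus bounded_linear.has_derivative[OF mk.bounded_linear_left dX])

lemma height_sublevel_bound:
  assumes "mk p p = -1" "0 < fst p"
  shows "fst (X z) * (fst p - norm (snd p)) \<le> - mk (X z) p"
  by (rule causal_timelike_lower) (use assms XX Xfut in \<open>auto intro: less_imp_le\<close>)

lemma compact_height_sublevel:
  assumes p: "mk p p = -1" "0 < fst p"
  shows "compact {z. - mk (X z) p \<le> c}"
proof -
  have pos: "fst p - norm (snd p) > 0" using timelike_norm_less[of p] p by simp
  have "fst (X z) \<le> c / (fst p - norm (snd p))" if "- mk (X z) p \<le> c" for z
    using height_sublevel_bound[OF p, of z] that pos by (simp add: pos_le_divide_eq)
  then have "{z. - mk (X z) p \<le> c} = {z. fst (X z) \<le> c / (fst p - norm (snd p))} \<inter> {z. - mk (X z) p \<le> c}"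
    by auto
  moreover have "closed {z. - mk (X z) p \<le> c}"
    by (intro closed_Collect_le continuous_intros mk.continuous_on cont_X)
  ultimately show ?thesis using compact_Int_closed[OF proper] by metis
qed

text \<open>Distance functions of \<open>H\<^sup>3\<close> have positive definite Hessian at their critical points on the disk,
  because the principal curvatures are smaller than 1.\<close>

lemma crit_strict_min:
  assumes p: "mk p p = -1" "0 < fst p" and c: "crit p z" and "w \<noteq> z"
  shows "- mk (X z) p < - mk (X w) p"
proof (rule proper_critical_point_unique[where h = "\<lambda>z. - mk (X z) p" and h' = "\<lambda>z v. - mk (X' z v) p"])
  show "((\<lambda>z. - mk (X z) p) has_derivative (\<lambda>v. - mk (X' x v) p)) (at x)" for x by (rule height_deriv)
  show "continuous_on UNIV (\<lambda>x. - mk (X' x v) p)" for v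
    by (intro continuous_intros mk.continuous_on cont_X')
  show "compact {x. - mk (X x) p \<le> c}" for c by (rule compact_height_sublevel[OF p])
  show "- mk (X' z v) p = 0" for v using c by (simp add: crit_def)
  show "w \<noteq> z" by fact
  fix x assume "\<And>v. - mk (X' x v) p = 0"
  then have cx: "crit p x" by (simp add: crit_def)
  show "\<exists>e>0. \<forall>y. y \<noteq> x \<and> dist y x < e \<longrightarrow> - mk (X x) p < - mk (X y) p"
  proof (rule nondegenerate_critical_point_strict_min[where h' = "\<lambda>z v. - mk (X' z v) p" and ?h2.0 = "\<lambda>v w. - mk (X2 x v w) p"])
    show "((\<lambda>z. - mk (X z) p) has_derivative (\<lambda>v. - mk (X' x v) p)) (at x)" for x by (rule height_deriv)
    show "((\<lambda>x. - mk (X' x v) p) has_derivative (\<lambda>w. - mk (X2 x v w) p)) (at x)" for v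
      by (intro has_derivative_minus bounded_linear.has_derivative[OF mk.bounded_linear_left dX'])
    show "- mk (X' x v) p = 0" for v using cx by (simp add: crit_def)
    fix v :: complex assume v: "v \<noteq> 0"
    \<comment> \<open>These are cosh and sinh of the signed distance from the disk to p. The Hessian
      is \<alpha> g - \<beta> h, positive because |\<beta>| < \<alpha> and |h| < g.\<close>
    define \<alpha> \<beta> where "\<alpha> = - mk (X x) p" and "\<beta> = mk (N x) p"
    have "\<alpha> > 0" unfolding \<alpha>_def using timelike_mk_neg[of "X x" p] XX Xfut p by simp
    moreover have "\<alpha>\<^sup>2 - \<beta>\<^sup>2 = 1" using crit_norm[OF cx p(1)] by (simp add: \<alpha>_def \<beta>_def)
    ultimately have ab: "\<bar>\<beta>\<bar> < \<alpha>" by (intro power2_less_imp_less[of "\<bar>\<beta>\<bar>"]) auto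
    have pd: "p = \<alpha> *\<^sub>R X x + \<beta> *\<^sub>R N x" unfolding \<alpha>_def \<beta>_def by (rule crit_decomp[OF cx])
    have "mk (X2 x v v) p = mk (X2 x v v) (\<alpha> *\<^sub>R X x + \<beta> *\<^sub>R N x)" using pd by simp
    then have "- mk (X2 x v v) p = \<alpha> * g x v v - \<beta> * h x v v" by (simp add: mk_simps X2X)
    moreover have "\<bar>\<beta> * h x v v\<bar> < \<alpha> * g x v v"
      unfolding abs_mult using small[OF v, of x] ab by (intro mult_strict_mono') auto
    ultimately show "0 < - mk (X2 x v v) p" by linarith
  qed
qed

lemma crit_unique: "z = w" if "mk p p = -1" "0 < fst p" "crit p z" "crit p w"
  using crit_strict_min[OF that(1,2,3), of w] crit_strict_min[OF that(1,2,4), of z] by fastforce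

lemma crit_exists:
  assumes p: "mk p p = -1" "0 < fst p"
  obtains z where "crit p z"
proof -
  let ?S = "{z. - mk (X z) p \<le> - mk (X 0) p}"
  have "?S \<noteq> {}" by auto
  moreover have "continuous_on ?S (\<lambda>z. - mk (X z) p)" by (intro continuous_intros mk.continuous_on cont_X)
  ultimately obtain z where z: "z \<in> ?S" "\<And>w. w \<in> ?S \<Longrightarrow> - mk (X z) p \<le> - mk (X w) p"
    using continuous_attains_inf[OF compact_height_sublevel[OF p]] by blast
  have "- mk (X z) p \<le> - mk (X w) p" for w using z by (cases "w \<in> ?S") fastforce+
  then have "(\<lambda>v. - mk (X' z v) p) = (\<lambda>_. 0)"
    using has_derivative_local_min[OF height_deriv[of p z]] by simp
  then have "crit p z" unfolding crit_def by (metis minus_equation_iff neg_equal_0_iff_equal)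
  then show ?thesis using that by blast
qed

section \<open>Balls and horoballs tangent to the disk\<close>

definition eq_pt :: "complex \<Rightarrow> real \<Rightarrow> mink" where "eq_pt q s = cosh s *\<^sub>R X q + sinh s *\<^sub>R N q"

lemma eq_pt: "mk (eq_pt q s) (eq_pt q s) = -1" "0 < fst (eq_pt q s)" "crit (eq_pt q s) q"
  "mk (N q) (eq_pt q s) = sinh s" "mk (X q) (eq_pt q s) = - cosh s"
proof -
  have "cosh s ^ 2 - sinh s ^ 2 = 1" by (simp add: cosh_square_eq)
  then show "mk (eq_pt q s) (eq_pt q s) = -1"
    by (simp add: eq_pt_def mk_simps XX NN XN mk_commute[of "N q" "X q"] power2_eq_square)
  have "\<bar>sinh s\<bar> < cosh s" using sinh_less_cosh_real[of "\<bar>s\<bar>"] by simp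
  moreover have "\<bar>fst (N q)\<bar> < fst (X q)" using unit_normal_fst_less XX Xfut NN XN by blast
  ultimately have "\<bar>sinh s * fst (N q)\<bar> < cosh s * fst (X q)"
    unfolding abs_mult by (intro mult_strict_mono') auto
  then show "0 < fst (eq_pt q s)" by (simp add: eq_pt_def)
  show "crit (eq_pt q s) q" by (simp add: crit_def eq_pt_def mk_simps X'X X'N)
  show "mk (N q) (eq_pt q s) = sinh s" "mk (X q) (eq_pt q s) = - cosh s"
    by (simp_all add: eq_pt_def mk_simps XX NN XN mk_commute[of "N q" "X q"])
qed

text \<open>X q is critical for the distance to the point at signed distance s on its normal, hence
  it is the unique nearest point: the ball of radius |s| about that point touches the disk from one
  side.\<close>

lemma tangent_ball: "cosh s \<le> - mk (X w) (eq_pt q s)"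
  using crit_strict_min[OF eq_pt(1,2,3), of w q s] eq_pt(5)[of q s] by (cases "w = q") auto

text \<open>The limit of the tangent balls; \<open>- mk x (X q + N q) < 1\<close> is the open horoball tangent to the disk at \<open>X q\<close>.\<close>

lemma tangent_horoball: "1 \<le> - mk (X w) (X q) - mk (X w) (N q)"
proof -
  have lim: "((\<lambda>s. - mk (X w) (X q) - tanh s * mk (X w) (N q)) \<longlongrightarrow> - mk (X w) (X q) - 1 * mk (X w) (N q)) at_top"
    by (intro tendsto_intros tanh_real_at_top)
  have ev: "\<forall>\<^sub>F s in at_top. 1 \<le> - mk (X w) (X q) - tanh s * mk (X w) (N q)"
  proof (rule always_eventually, rule allI)
    fix s :: real
    have "cosh s \<le> - cosh s * mk (X w) (X q) - sinh s * mk (X w) (N q)"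
      using tangent_ball[of s w q] by (simp add: eq_pt_def mk_simps)
    also have "\<dots> = cosh s * (- mk (X w) (X q) - tanh s * mk (X w) (N q))"
      by (simp add: tanh_def field_simps)
    finally show "1 \<le> - mk (X w) (X q) - tanh s * mk (X w) (N q)"
      using cosh_real_pos[of s] by simp
  qed
  show ?thesis using tendsto_lowerbound[OF lim ev] by simp
qed

lemma tangent_horoballs: "\<bar>mk (X w) (N q)\<bar> \<le> - mk (X w) (X q) - 1"
  using tangent_horoball[of w q] minimal_disk.tangent_horoball[OF flip, of w q] by (simp add: mk_simps)

text \<open>The side of the disk on which \<open>\<gamma> t\<close> lies is the sign of \<open>mk (N z) (\<gamma> t)\<close> at the nearest point \<open>z\<close>.\<close>

lemma side_constant:
  fixes \<gamma> :: "real \<Rightarrow> mink"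
  assumes cont: "continuous_on {0..1} \<gamma>"
    and unit: "\<And>t. t \<in> {0..1} \<Longrightarrow> mk (\<gamma> t) (\<gamma> t) = -1" "\<And>t. t \<in> {0..1} \<Longrightarrow> 0 < fst (\<gamma> t)"
    and avoid: "\<And>t z. t \<in> {0..1} \<Longrightarrow> \<gamma> t \<noteq> X z"
    and start: "crit (\<gamma> 0) z0" "0 < \<sigma> * mk (N z0) (\<gamma> 0)"
  obtains z where "crit (\<gamma> 1) z" "0 < \<sigma> * mk (N z) (\<gamma> 1)"
proof -
  have ne: "{0..1::real} \<noteq> {}" by simp
  obtain M where M: "\<And>t. t \<in> {0..1} \<Longrightarrow> - mk (X 0) (\<gamma> t) \<le> M"
  proof -
    have c: "continuous_on {0..1} (\<lambda>t. - mk (X 0) (\<gamma> t))" by (rule continuous_on_minus[OF mk.continuous_on[OF continuous_on_const cont]])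
    obtain s where "\<forall>t\<in>{0..1}. - mk (X 0) (\<gamma> t) \<le> - mk (X 0) (\<gamma> s)"
      using continuous_attains_sup[OF compact_Icc ne c] by blast
    then show ?thesis using that by blast
  qed
  obtain m where m: "m > 0" "\<And>t. t \<in> {0..1} \<Longrightarrow> m \<le> fst (\<gamma> t) - norm (snd (\<gamma> t))"
  proof -
    have c: "continuous_on {0..1} (\<lambda>t. fst (\<gamma> t) - norm (snd (\<gamma> t)))" by (intro continuous_intros cont)
    obtain s where s: "s \<in> {0..1}" "\<forall>t\<in>{0..1}. fst (\<gamma> s) - norm (snd (\<gamma> s)) \<le> fst (\<gamma> t) - norm (snd (\<gamma> t))"
      using continuous_attains_inf[OF compact_Icc ne c] by blast
    then have "0 < fst (\<gamma> s) - norm (snd (\<gamma> s))" using timelike_norm_less[of "\<gamma> s"] unit[of s] by simp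
    then show ?thesis using that s by blast
  qed
  \<comment> \<open>One compact set contains the nearest points of all \<gamma> t; without it the
    projections to the time axis below need not be closed.\<close>
  define K where "K = {z. fst (X z) \<le> M / m}"
  have K: "z \<in> K" if t: "t \<in> {0..1}" and c: "crit (\<gamma> t) z" for t z
  proof -
    have "fst (X z) * m \<le> fst (X z) * (fst (\<gamma> t) - norm (snd (\<gamma> t)))"
      using m(2)[OF t] Xfut[of z] by (intro mult_left_mono) auto
    also have "\<dots> \<le> - mk (X z) (\<gamma> t)" by (rule height_sublevel_bound[OF unit[OF t]])
    also have "\<dots> \<le> - mk (X 0) (\<gamma> t)" using crit_strict_min[OF unit[OF t] c, of 0] by (cases "z = 0") auto
    also have "\<dots> \<le> M" by (rule M[OF t])
    finally show ?thesis using m(1) by (simp add: K_def pos_le_divide_eq)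
  qed
  have nz: "mk (N z) (\<gamma> t) \<noteq> 0" if t: "t \<in> {0..1}" and c: "crit (\<gamma> t) z" for t z
  proof
    assume 0: "mk (N z) (\<gamma> t) = 0"
    then have "(mk (X z) (\<gamma> t))\<^sup>2 = 1" using crit_norm[OF c] unit[OF t] by simp
    moreover have "mk (X z) (\<gamma> t) < 0" using timelike_mk_neg[of "X z" "\<gamma> t"] XX Xfut unit[OF t] by simp
    ultimately have "mk (X z) (\<gamma> t) = - 1" by (simp add: power2_eq_1_iff)
    then have "\<gamma> t = X z" using crit_decomp[OF c] 0 by simp
    then show False using avoid[OF t] by blast
  qed
  \<comment> \<open>Times at which the nearest point sees \<gamma> t on the side \<epsilon>, with a
    weak inequality to make the set closed. The sets for \<sigma> and -\<sigma> cover the interval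
    since nearest points exist, and are disjoint since \<gamma> avoids the disk and nearest points
    are unique.\<close>
  define T where "T \<epsilon> = fst ` {x \<in> {0..1} \<times> K. crit (\<gamma> (fst x)) (snd x) \<and> 0 \<le> \<epsilon> * mk (N (snd x)) (\<gamma> (fst x))}" for \<epsilon> :: real
  have closed: "closed (T \<epsilon>)" for \<epsilon>
  proof -
    have cg: "continuous_on ({0..1} \<times> K) (\<lambda>x. \<gamma> (fst x))"
      by (rule continuous_on_compose2[OF cont]) (auto intro!: continuous_intros)
    have cN: "continuous_on ({0..1::real} \<times> K) (\<lambda>x. N (snd x))"
      by (rule continuous_on_compose2[OF cont_N[of UNIV]]) (auto intro!: continuous_intros)
    have cX: "continuous_on ({0..1::real} \<times> K) (\<lambda>x. X' (snd x) u)" for u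
      by (rule continuous_on_compose2[OF cont_X'[of UNIV]]) (auto intro!: continuous_intros)
    have kK: "compact ({0..1::real} \<times> K)" unfolding K_def by (intro compact_Times compact_Icc proper)
    have "{x \<in> {0..1} \<times> K. crit (\<gamma> (fst x)) (snd x) \<and> 0 \<le> \<epsilon> * mk (N (snd x)) (\<gamma> (fst x))}
      = (\<Inter>u. {x \<in> {0..1} \<times> K. mk (X' (snd x) u) (\<gamma> (fst x)) = 0}) \<inter> {x \<in> {0..1} \<times> K. \<epsilon> * mk (N (snd x)) (\<gamma> (fst x)) \<in> {0..}}"
      unfolding crit_def by auto
    moreover have "closed {x \<in> {0..1} \<times> K. mk (X' (snd x) u) (\<gamma> (fst x)) = 0}" for u
      by (intro continuous_closed_preimage_constant mk.continuous_on cX cg compact_imp_closed[OF kK])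
    moreover have "closed {x \<in> {0..1} \<times> K. \<epsilon> * mk (N (snd x)) (\<gamma> (fst x)) \<in> {0..}}"
      using continuous_closed_preimage[OF continuous_on_mult[OF continuous_on_const mk.continuous_on[OF cN cg]] compact_imp_closed[OF kK], of "{0..}" \<epsilon>]
      by (simp add: vimage_def Int_def)
    ultimately have "closed {x \<in> {0..1} \<times> K. crit (\<gamma> (fst x)) (snd x) \<and> 0 \<le> \<epsilon> * mk (N (snd x)) (\<gamma> (fst x))}"
      by (simp add: closed_INT closed_Int)
    then have "compact {x \<in> {0..1} \<times> K. crit (\<gamma> (fst x)) (snd x) \<and> 0 \<le> \<epsilon> * mk (N (snd x)) (\<gamma> (fst x))}"
      using compact_Int_closed[OF kK] by (metis (no_types, lifting) Int_absorb1 mem_Collect_eq subsetI)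
    then show ?thesis unfolding T_def
      by (intro compact_imp_closed compact_continuous_image continuous_intros)
  qed
  have T: "t \<in> T \<epsilon> \<longleftrightarrow> t \<in> {0..1} \<and> (\<exists>z. crit (\<gamma> t) z \<and> 0 \<le> \<epsilon> * mk (N z) (\<gamma> t))" for t \<epsilon>
    unfolding T_def using K by (force simp: image_iff)
  have s0: "\<sigma> \<noteq> 0" using start by auto
  have dis: "T \<sigma> \<inter> T (-\<sigma>) \<inter> {0..1} = {}"
  proof (rule ccontr)
    assume "T \<sigma> \<inter> T (-\<sigma>) \<inter> {0..1} \<noteq> {}"
    then obtain t where "t \<in> {0..1}" "t \<in> T \<sigma>" "t \<in> T (-\<sigma>)" by blast
    then obtain z w where t: "t \<in> {0..1}" and z: "crit (\<gamma> t) z" "0 \<le> \<sigma> * mk (N z) (\<gamma> t)"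
      and w: "crit (\<gamma> t) w" "0 \<le> - \<sigma> * mk (N w) (\<gamma> t)" unfolding T by blast
    have "z = w" using crit_unique[OF unit[OF t] z(1) w(1)] .
    then have "\<sigma> * mk (N z) (\<gamma> t) = 0" using z w by simp
    then show False using nz[OF t z(1)] s0 by simp
  qed
  have cov: "{0..1} \<subseteq> T \<sigma> \<union> T (-\<sigma>)"
  proof
    fix t :: real assume t: "t \<in> {0..1}"
    obtain z where z: "crit (\<gamma> t) z" using crit_exists[OF unit[OF t]] by blast
    show "t \<in> T \<sigma> \<union> T (-\<sigma>)"
    proof (cases "0 \<le> \<sigma> * mk (N z) (\<gamma> t)")
      case True
      then show ?thesis using T t z by blast
    next
      case False
      then have "0 \<le> - \<sigma> * mk (N z) (\<gamma> t)" by simp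
      then show ?thesis using T t z by blast
    qed
  qed
  have "T \<sigma> \<inter> {0..1} \<noteq> {}"
  proof -
    have "0 \<in> T \<sigma>" unfolding T using start by (auto intro!: exI[of _ z0])
    then show ?thesis by force
  qed
  then have "T (-\<sigma>) \<inter> {0..1} = {}"
    using connected_closedD[OF connected_Icc dis cov closed closed] by (elim disjE) auto
  moreover have "(1::real) \<in> {0..1}" by simp
  ultimately have "1 \<in> T \<sigma>" using cov by blast
  then obtain z where z: "crit (\<gamma> 1) z" "0 \<le> \<sigma> * mk (N z) (\<gamma> 1)" unfolding T by blast
  moreover have "\<sigma> * mk (N z) (\<gamma> 1) \<noteq> 0" using nz[of 1 z] z s0 by simp
  ultimately show ?thesis using that[of z] by linarith
qed

text \<open>A horoball is geodesically convex: the chord from p to y stays in the half-space -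
  \<open>mk v a\<close> < 1, and projecting it to the hyperboloid divides by a number that is at
  least 1. The geodesic thus avoids the disk and cannot change side.\<close>

lemma side_constant_in_horoball:
  assumes p: "mk p p = -1" "0 < fst p" and y: "mk y y = -1" "0 < fst y"
    and a: "\<And>w. 1 \<le> - mk (X w) a" and pa: "- mk p a < 1" and ya: "- mk y a < 1"
    and start: "crit p z0" "0 < \<sigma> * mk (N z0) p"
  obtains z where "crit y z" "0 < \<sigma> * mk (N z) y"
proof -
  define v where "v t = (1 - t) *\<^sub>R p + t *\<^sub>R y" for t :: real
  define \<nu> where "\<nu> t = sqrt (- mk (v t) (v t))" for t
  define \<gamma> where "\<gamma> t = (1 / \<nu> t) *\<^sub>R v t" for t
  have vv: "1 \<le> - mk (v t) (v t)" if "t \<in> {0..1}" for t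
  proof -
    have "- mk (v t) (v t) = (1-t)\<^sup>2 + t\<^sup>2 + 2 * (t * (1 - t)) * (- mk p y)"
      unfolding v_def by (simp add: mk_simps p y mk_commute[of y p] power2_eq_square algebra_simps)
    also have "\<dots> \<ge> (1-t)\<^sup>2 + t\<^sup>2 + 2 * (t * (1 - t)) * 1"
      using unit_timelike_mk_le[OF p y] that by (intro add_left_mono mult_left_mono) auto
    finally show ?thesis by (simp add: power2_eq_square algebra_simps)
  qed
  have nu: "1 \<le> \<nu> t" if "t \<in> {0..1}" for t unfolding \<nu>_def using vv[OF that] by simp
  have vf: "0 < fst (v t)" if "t \<in> {0..1}" for t
    unfolding v_def using that p(2) y(2) by (cases "t = 0") (auto intro!: add_nonneg_pos)
  have va: "- mk (v t) a < 1" if "t \<in> {0..1}" for t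
  proof -
    have "- mk (v t) a = (1 - t) * (- mk p a) + t * (- mk y a)" unfolding v_def by (simp add: mk_simps)
    also have "\<dots> < 1" using that pa ya by (intro convex_bound_lt) auto
    finally show ?thesis .
  qed
  have start': "\<gamma> 0 = p" and fin: "\<gamma> 1 = y" by (simp_all add: \<gamma>_def \<nu>_def v_def p y)
  show ?thesis
  proof (rule side_constant[of \<gamma> z0 \<sigma>])
    have "continuous_on {0..1} v" unfolding v_def by (intro continuous_intros)
    then show "continuous_on {0..1} \<gamma>" unfolding \<gamma>_def \<nu>_def
      using vv by (intro continuous_intros mk.continuous_on) force+
    fix t :: real assume t: "t \<in> {0..1}"
    have n2: "\<nu> t * \<nu> t = - mk (v t) (v t)" unfolding \<nu>_def using vv[OF t] by simp
    have n3: "mk (v t) (v t) = - (\<nu> t * \<nu> t)" using n2 by simp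
    show "mk (\<gamma> t) (\<gamma> t) = -1" unfolding \<gamma>_def mk_simps n3 using nu[OF t] by simp
    show "0 < fst (\<gamma> t)" unfolding \<gamma>_def using nu[OF t] vf[OF t] by simp
    have "- mk (\<gamma> t) a = - mk (v t) a / \<nu> t" unfolding \<gamma>_def by (simp add: mk_simps)
    also have "\<dots> < 1" by (subst pos_divide_less_eq) (use va[OF t] nu[OF t] in auto)
    finally show "\<gamma> t \<noteq> X z" for z using a[of z] by auto
  qed (use start start' fin that in auto)
qed

text \<open>Null vectors over the two endpoints of the normal geodesic at X z. Their scale matters
  too: it selects the horoballs tangent to the disk at X z.\<close>

lemma normal_pair:
  shows "mk (X z + N z) (X z + N z) = 0" "0 < fst (X z + N z)"
    and "mk (X z - N z) (X z - N z) = 0" "0 < fst (X z - N z)"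
proof -
  have "\<bar>fst (N z)\<bar> < fst (X z)" using unit_normal_fst_less XX Xfut NN XN by blast
  then show "0 < fst (X z + N z)" "0 < fst (X z - N z)" by auto
  show "mk (X z + N z) (X z + N z) = 0" "mk (X z - N z) (X z - N z) = 0"
    by (simp_all add: mk_simps XX NN XN mk_commute[of "N z" "X z"])
qed

lemma horoball_minus: "1 \<le> - mk (X w) (X q - N q)" and horoball_plus: "1 \<le> - mk (X w) (X q + N q)"
  using tangent_horoballs[of w q] by (auto simp: mk_simps)

text \<open>Geometrically: horoballs tangent to the disk from opposite sides are disjoint, since a common point
  would lie on both sides.\<close>

lemma opposite_horoballs: "2 \<le> - mk (X z + N z) (X q - N q)"
proof (rule ccontr)
  define a b where "a = X z + N z" and "b = X q - N q"
  assume "\<not> 2 \<le> - mk (X z + N z) (X q - N q)"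
  then have m2: "- mk a b < 2" by (simp add: a_def b_def)
  have na: "mk a a = 0" "0 < fst a" "mk b b = 0" "0 < fst b"
    unfolding a_def b_def using normal_pair by auto
  have m0: "0 \<le> - mk a b" using null_mk_nonpos[OF na] by simp
  have oz: "- mk (eq_pt z s) a = exp (- s)" and oq: "- mk (eq_pt q (-s)) b = exp (-s)" for s
    unfolding a_def b_def eq_pt_def
    by (simp_all add: mk_simps XX NN XN mk_commute[of "N z" "X z"] mk_commute[of "N q" "X q"] sinh_def cosh_def field_simps)
  obtain y where y: "mk y y = -1" "0 < fst y" "- mk y a < 1" "- mk y b < 1"
  proof (cases "mk a b = 0")
    case True
    then obtain c where c: "c > 0" "a = c *\<^sub>R b" using null_parallel[OF na] by metis
    \<comment> \<open>Both horoballs have the same centre, so a point deep enough inside one lies in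
      both; at this depth the two heights are 1 / (c + 1) and c / (c + 1).\<close>
    define s where "s = ln (c + 1)"
    have es: "exp (- s) = 1 / (c + 1)" using c(1) by (simp add: s_def exp_minus inverse_eq_divide)
    show ?thesis
    proof (rule that[of "eq_pt q (-s)"])
      show "- mk (eq_pt q (-s)) b < 1" unfolding oq es using c(1) by simp
      have "- mk (eq_pt q (-s)) a = c * (- mk (eq_pt q (-s)) b)" unfolding c(2) by (simp add: mk_simps)
      also have "\<dots> = c * (1 / (c + 1))" unfolding oq es ..
      also have "\<dots> < 1" using c(1) by simp
      finally show "- mk (eq_pt q (-s)) a < 1" .
    qed (rule eq_pt)+
  next
    case False
    \<comment> \<open>The common point is taken on the geodesic joining the two centres, where both
      heights equal m / sqrt (2 m) = sqrt (m / 2). This is below 1 exactly for m < 2, which explains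
      the constant 2.\<close>
    define m where "m = - mk a b"
    have m: "0 < m" "m < 2" using m0 m2 False by (auto simp: m_def)
    have sq: "sqrt (2 * m) * sqrt (2 * m) = 2 * m" using m by simp
    have mlt: "m < sqrt (2 * m)" using m by (intro real_less_rsqrt) (auto simp: power2_eq_square)
    show ?thesis
    proof (rule that[of "(1 / sqrt (2 * m)) *\<^sub>R (a + b)"])
      show "mk ((1 / sqrt (2 * m)) *\<^sub>R (a + b)) ((1 / sqrt (2 * m)) *\<^sub>R (a + b)) = -1"
        using m sq by (simp add: mk_simps na mk_commute[of b a] m_def field_simps)
      show "0 < fst ((1 / sqrt (2 * m)) *\<^sub>R (a + b))" using m na by simp
      have "- mk ((1 / sqrt (2 * m)) *\<^sub>R (a + b)) a = m / sqrt (2 * m)" "- mk ((1 / sqrt (2 * m)) *\<^sub>R (a + b)) b = m / sqrt (2 * m)"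
        by (simp_all add: mk_simps na mk_commute[of b a] m_def)
      then show "- mk ((1 / sqrt (2 * m)) *\<^sub>R (a + b)) a < 1" "- mk ((1 / sqrt (2 * m)) *\<^sub>R (a + b)) b < 1"
        using m mlt by (simp_all add: pos_divide_less_eq)
    qed
  qed
  have ha: "1 \<le> - mk (X w) a" and hb: "1 \<le> - mk (X w) b" for w
    unfolding a_def b_def using horoball_plus horoball_minus by auto
  \<comment> \<open>Within the horoball of a, y is joined to a point on the positive side; within
    that of b, to one on the negative side. The unique nearest point of y would then carry both
    signs.\<close>
  obtain z1 where z1: "crit y z1" "0 < 1 * mk (N z1) y"
    using side_constant_in_horoball[of "eq_pt z 1" y a z 1, OF eq_pt(1,2) y(1,2) ha _ y(3) eq_pt(3)] oz[of 1] eq_pt(4)[of z 1]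
    by auto
  have "0 < -1 * mk (N q) (eq_pt q (-1))" unfolding eq_pt(4) by simp
  then obtain z2 where z2: "crit y z2" "0 < - 1 * mk (N z2) y"
    using side_constant_in_horoball[of "eq_pt q (-1)" y b q "-1", OF eq_pt(1,2) y(1,2) hb _ y(4) eq_pt(3)] oq[of 1]
    by auto
  show False using crit_unique[OF y(1,2) z1(1) z2(1)] z1(2) z2(2) by simp
qed

text \<open>The opposite-horoball inequalities for (z, q) and for (q, z) are added; the mixed
  products of points with normals cancel. The result acts as a Lipschitz bound for the normal, since
  1 + \<open>mk (X z) (X q)\<close> is quadratic in the distance.\<close>

lemma normal_inner_lower: "2 + mk (X z) (X q) \<le> mk (N z) (N q)"
proof -
  have "2 \<le> - mk (X z + N z) (X q - N q)" "2 \<le> - mk (X q + N q) (X z - N z)"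
    by (rule opposite_horoballs)+
  then show ?thesis
    by (simp add: mk_simps mk_commute[of "X q"] mk_commute[of "N q"])
qed

end

section \<open>The Gauss map near an umbilic point\<close>

text \<open>A is the solution of G A = -H. For G the identity it would be symmetric; in general its
  asymmetry times det G is \<open>G12 * (H22 - H11) - (G22 - G11) * H12\<close>, which is linear in
  the deviation e. Cramer's formulas are recorded as well, since they yield continuity of A and A =
  0 where H = 0.\<close>

lemma trace_free_shape_asymmetry:
  fixes G11 G12 G22 H11 H12 H22 A11 A12 A21 A22 e :: real
  assumes eqs: "G11 * A11 + G12 * A21 = - H11" "G12 * A11 + G22 * A21 = - H12"
      "G11 * A12 + G12 * A22 = - H12" "G12 * A12 + G22 * A22 = - H22"
    and tr: "G22 * H11 - 2 * G12 * H12 + G11 * H22 = 0"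
    and G: "\<bar>G11 - 1\<bar> \<le> e" "\<bar>G12\<bar> \<le> e" "\<bar>G22 - 1\<bar> \<le> e" and e: "e \<le> 1/8"
    and H: "\<bar>H11\<bar> \<le> G11" "\<bar>H22\<bar> \<le> G22" "\<bar>H12\<bar> \<le> (G11 + G22) / 2"
  shows "A11 + A22 = 0" "\<bar>A12 - A21\<bar> \<le> 6 * e" "A11 = - (G22 * H11 - G12 * H12) / (G11 * G22 - G12\<^sup>2)"
    "A21 = - (G11 * H12 - G12 * H11) / (G11 * G22 - G12\<^sup>2)" "A12 = - (G22 * H12 - G12 * H22) / (G11 * G22 - G12\<^sup>2)"
proof -
  define D where "D = G11 * G22 - G12\<^sup>2"
  have g: "7/8 \<le> G11" "G11 \<le> 9/8" "7/8 \<le> G22" "G22 \<le> 9/8" "\<bar>G12\<bar> \<le> 1/8" using G e by linarith+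
  have "49/64 \<le> G11 * G22" using mult_mono[of "7/8" G11 "7/8" G22] g by simp
  moreover have "G12\<^sup>2 \<le> 1/64" using abs_le_square_iff[of G12 "1/8"] g by (simp add: power2_eq_square)
  ultimately have D: "3/4 \<le> D" by (simp add: D_def)
  have A11: "D * A11 = - (G22 * H11 - G12 * H12)"
  proof -
    have "D * A11 = G22 * (G11 * A11 + G12 * A21) - G12 * (G12 * A11 + G22 * A21)"
      by (simp add: D_def power2_eq_square algebra_simps)
    then show ?thesis unfolding eqs by (simp add: algebra_simps)
  qed
  have A21: "D * A21 = - (G11 * H12 - G12 * H11)"
  proof -
    have "D * A21 = G11 * (G12 * A11 + G22 * A21) - G12 * (G11 * A11 + G12 * A21)"
      by (simp add: D_def power2_eq_square algebra_simps)
    then show ?thesis unfolding eqs by (simp add: algebra_simps)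
  qed
  have A12: "D * A12 = - (G22 * H12 - G12 * H22)"
  proof -
    have "D * A12 = G22 * (G11 * A12 + G12 * A22) - G12 * (G12 * A12 + G22 * A22)"
      by (simp add: D_def power2_eq_square algebra_simps)
    then show ?thesis unfolding eqs by (simp add: algebra_simps)
  qed
  have A22: "D * A22 = - (G11 * H22 - G12 * H12)"
  proof -
    have "D * A22 = G11 * (G12 * A12 + G22 * A22) - G12 * (G11 * A12 + G12 * A22)"
      by (simp add: D_def power2_eq_square algebra_simps)
    then show ?thesis unfolding eqs by (simp add: algebra_simps)
  qed
  have "D * (A11 + A22) = 0" using A11 A22 tr by (simp add: distrib_left)
  then show "A11 + A22 = 0" using D by simp
  show "A11 = - (G22 * H11 - G12 * H12) / (G11 * G22 - G12\<^sup>2)"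
    "A21 = - (G11 * H12 - G12 * H11) / (G11 * G22 - G12\<^sup>2)" "A12 = - (G22 * H12 - G12 * H22) / (G11 * G22 - G12\<^sup>2)"
    unfolding D_def[symmetric] A11[symmetric] A12[symmetric] A21[symmetric] using D by simp_all
  have "D * (A12 - A21) = G12 * (H22 - H11) - (G22 - G11) * H12"
    using A12 A21 by (simp add: algebra_simps)
  then have "\<bar>D * (A12 - A21)\<bar> \<le> \<bar>G12 * (H22 - H11)\<bar> + \<bar>(G22 - G11) * H12\<bar>" by linarith
  also have "\<dots> \<le> e * (9/4) + (2 * e) * (9/8)"
    unfolding abs_mult
  proof (intro add_mono mult_mono)
    have "2 * \<bar>H12\<bar> \<le> G11 + G22" using H(3) by simp
    then show "\<bar>H12\<bar> \<le> 9/8" using g by linarith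
    show "0 \<le> e" "0 \<le> 2 * e" using G(2) abs_ge_zero[of G12] by linarith+
  qed (use G H g in linarith)+
  finally have "D * \<bar>A12 - A21\<bar> \<le> 3/4 * (6 * e)" using D by (simp add: abs_mult)
  moreover have "3/4 * \<bar>A12 - A21\<bar> \<le> D * \<bar>A12 - A21\<bar>" using D by (intro mult_right_mono) auto
  ultimately have "3/4 * \<bar>A12 - A21\<bar> \<le> 3/4 * (6 * e)" by (rule order_trans[rotated])
  then show "\<bar>A12 - A21\<bar> \<le> 6 * e" by simp
qed

section \<open>The disk as a graph over its tangent plane at an umbilic point\<close>

locale umbilic_point = minimal_disk +
  fixes q :: complex and e1 e2 :: mink
  assumes umbilic: "\<And>u v. mk (X2 q u v) (N q) = 0"
    and frame: "mk e1 e1 = 1" "mk e2 e2 = 1" "mk e1 e2 = 0" "mk (X q) e1 = 0" "mk (X q) e2 = 0"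
      "mk (N q) e1 = 0" "mk (N q) e2 = 0"
begin

lemma frame_complete: "mk v w = - (mk v (X q) * mk w (X q)) + mk v e1 * mk w e1 + mk v e2 * mk w e2 + mk v (N q) * mk w (N q)"
proof -
  obtain t r s k where w: "w = t *\<^sub>R X q + r *\<^sub>R e1 + s *\<^sub>R e2 + k *\<^sub>R N q"
    using mink_basis[of "X q" "N q" e1 e2 w] XX NN XN frame by auto
  have "mk w (X q) = - t" "mk w e1 = r" "mk w e2 = s" "mk w (N q) = k"
    unfolding w using frame XX[of q] NN[of q] XN[of q] mk_commute[of e1 "X q"] mk_commute[of e2 "X q"]
      mk_commute[of e1 "N q"] mk_commute[of e2 "N q"] mk_commute[of "N q" "X q"] mk_commute[of e2 e1]
    by (simp_all add: mk_simps)
  then show ?thesis unfolding w by (simp add: mk_simps)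
qed

lemma frame_eqI: "v = w" if "mk v (X q) = mk w (X q)" "mk v e1 = mk w e1" "mk v e2 = mk w e2" "mk v (N q) = mk w (N q)"
proof -
  have 0: "mk (v - w) u = 0" for u
    unfolding frame_complete[of "v - w" u] using that by (simp add: mk_simps)
  have n: "(norm u)\<^sup>2 = mk u (- fst u, snd u)" for u :: mink
    by (subst norm_prod_def) (simp add: mk_def power2_norm_eq_inner[of "snd u"] power2_eq_square[of "fst u"])
  show ?thesis using n[of "v - w"] unfolding 0 by simp
qed

text \<open>Coordinates in the Lorentz frame at q: \<open>x0\<close>, \<open>x3\<close> are the time
  and normal coordinates of X, \<open>n0\<close>, \<open>n3\<close> those of N, while
  \<open>proj\<close> and \<open>nu\<close> are the tangential parts. \<open>x0 z\<close> is cosh of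
  the distance from X z to X q.\<close>

definition "x0 z = - mk (X z) (X q)"
definition "x3 z = mk (X z) (N q)"
definition "n0 z = - mk (N z) (X q)"
definition "n3 z = mk (N z) (N q)"
definition proj :: "complex \<Rightarrow> complex" where "proj z = Complex (mk (X z) e1) (mk (X z) e2)"
definition nu :: "complex \<Rightarrow> complex" where "nu z = Complex (mk (N z) e1) (mk (N z) e2)"
definition proj' :: "complex \<Rightarrow> complex \<Rightarrow> complex" where "proj' z u = Complex (mk (X' z u) e1) (mk (X' z u) e2)"

lemma normsq: "(norm (Complex a b))\<^sup>2 = a\<^sup>2 + b\<^sup>2" by (simp add: cmod_def)

lemma cdot: "Complex a b \<bullet> Complex c d = a * c + b * d" by (simp add: inner_complex_def)

lemma
  shows XX_coord: "(x0 z)\<^sup>2 = 1 + (norm (proj z))\<^sup>2 + (x3 z)\<^sup>2"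
    and NN_coord: "(norm (nu z))\<^sup>2 + (n3 z)\<^sup>2 = 1 + (n0 z)\<^sup>2"
  using XX[of z] NN[of z] frame_complete[of "X z" "X z"] frame_complete[of "N z" "N z"]
  unfolding x0_def x3_def n0_def n3_def proj_def nu_def normsq
  by (simp_all add: power2_eq_square)

lemma x0_ge: "1 \<le> x0 z"
  using unit_timelike_mk_le[of "X z" "X q"] XX Xfut by (simp add: x0_def)

lemma x3_bound: "\<bar>x3 z\<bar> \<le> x0 z - 1"
  using tangent_horoballs[of z q] by (simp add: x0_def x3_def)

lemma n0_bound: "\<bar>n0 z\<bar> \<le> x0 z - 1"
  using tangent_horoballs[of q z] by (simp add: x0_def n0_def mk_commute)

lemma n3_lower: "2 - x0 z \<le> n3 z"
  using normal_inner_lower[of z q] by (simp add: x0_def n3_def)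

text \<open>The tangent horoballs at q confine \<open>x3\<close> to at most x0 - 1 in modulus, so
  the quadratic terms in x0 cancel from the hyperboloid equation and a linear inequality
  remains.\<close>

lemma x0_upper: "x0 z - 1 \<le> (norm (proj z))\<^sup>2 / 2"
proof -
  have "(x3 z)\<^sup>2 \<le> (x0 z - 1)\<^sup>2" using x3_bound[of z] x0_ge[of z] by (simp add: abs_le_square_iff[symmetric])
  then show ?thesis using XX_coord[of z] by (simp add: power2_eq_square algebra_simps)
qed

text \<open>The bounds on \<open>n0\<close> and \<open>n3\<close> leave at most 1 + (x0 - 1)^2 - (2
  - x0)^2 = 2 (x0 - 1) for the square of |nu|. This is the a priori linear bound, with constant 1,
  for the Cauchy-Pompeiu estimate.\<close>

lemma nu_bound: "norm (nu z) \<le> norm (proj z)" if "norm (proj z) \<le> 1"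
proof (rule power2_le_imp_le)
  have "(norm (proj z))\<^sup>2 \<le> 1" using that by (simp add: power_le_one)
  then have "x0 z \<le> 2" using x0_upper[of z] by simp
  then have "(2 - x0 z)\<^sup>2 \<le> (n3 z)\<^sup>2" using n3_lower[of z] by (intro power_mono) auto
  moreover have "(n0 z)\<^sup>2 \<le> (x0 z - 1)\<^sup>2" using n0_bound[of z] x0_ge[of z] by (simp add: abs_le_square_iff[symmetric])
  ultimately have "(norm (nu z))\<^sup>2 \<le> 1 + (x0 z - 1)\<^sup>2 - (2 - x0 z)\<^sup>2" using NN_coord[of z] by linarith
  also have "\<dots> = 2 * (x0 z - 1)" by (simp add: power2_eq_square algebra_simps)
  also have "\<dots> \<le> (norm (proj z))\<^sup>2" using x0_upper[of z] by simp
  finally show "(norm (nu z))\<^sup>2 \<le> (norm (proj z))\<^sup>2" .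
qed simp

lemma small_bounds:
  assumes "norm (proj z) \<le> 1/2"
  shows "x0 z \<le> 9/8" "\<bar>x3 z\<bar> \<le> 1/8" "\<bar>n0 z\<bar> \<le> 1/8" "7/8 \<le> n3 z"
proof -
  have "(norm (proj z))\<^sup>2 \<le> (1/2)\<^sup>2" using assms by (intro power_mono) auto
  then have "x0 z - 1 \<le> 1/8" using x0_upper[of z] by (simp add: power2_eq_square)
  then show "x0 z \<le> 9/8" "\<bar>x3 z\<bar> \<le> 1/8" "\<bar>n0 z\<bar> \<le> 1/8" "7/8 \<le> n3 z"
    using x3_bound[of z] n0_bound[of z] n3_lower[of z] by linarith+
qed

lemma tangent_coords:
  "x0 z * mk (X' z u) (X q) = - (proj z \<bullet> proj' z u) - x3 z * mk (X' z u) (N q)"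
  "n3 z * mk (X' z u) (N q) = - (nu z \<bullet> proj' z u) - n0 z * mk (X' z u) (X q)"
  using X'X[of z u] X'N[of z u] frame_complete[of "X' z u" "X z"] frame_complete[of "X' z u" "N z"]
  unfolding x0_def x3_def n0_def n3_def proj_def nu_def proj'_def cdot
  by (simp_all add: algebra_simps)

text \<open>Orthogonality of a tangent vector to X z and to N z gives two linear equations for its
  coordinates along X q and N q. The system is diagonally dominant and its right-hand sides have
  size |proj| |proj'|.\<close>

lemma vertical_bounds:
  assumes r: "norm (proj z) \<le> 1/2"
  shows "\<bar>mk (X' z u) (X q)\<bar> \<le> 2 * (norm (proj z) * norm (proj' z u))"
    "\<bar>mk (X' z u) (N q)\<bar> \<le> 2 * (norm (proj z) * norm (proj' z u))"
proof -
  define a b m where "a = \<bar>mk (X' z u) (X q)\<bar>" and "b = \<bar>mk (X' z u) (N q)\<bar>" and "m = norm (proj z) * norm (proj' z u)"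
  note s = small_bounds[OF r]
  have m1: "\<bar>proj z \<bullet> proj' z u\<bar> \<le> m" unfolding m_def by (rule Cauchy_Schwarz_ineq2)
  have m2: "\<bar>nu z \<bullet> proj' z u\<bar> \<le> m"
    unfolding m_def using nu_bound[of z] r
    by (intro order_trans[OF Cauchy_Schwarz_ineq2] mult_right_mono) auto
  have "1 * a \<le> \<bar>x0 z * mk (X' z u) (X q)\<bar>"
    unfolding abs_mult a_def using x0_ge[of z] by (intro mult_right_mono) auto
  also have "\<dots> \<le> m + \<bar>x3 z * mk (X' z u) (N q)\<bar>" unfolding tangent_coords(1) using m1 by linarith
  also have "\<bar>x3 z * mk (X' z u) (N q)\<bar> \<le> 1/8 * b" unfolding abs_mult b_def using s by (intro mult_right_mono) auto
  finally have 1: "a \<le> m + b / 8" by simp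
  have "7/8 * b \<le> \<bar>n3 z * mk (X' z u) (N q)\<bar>"
    unfolding abs_mult b_def using s by (intro mult_right_mono) auto
  also have "\<dots> \<le> m + \<bar>n0 z * mk (X' z u) (X q)\<bar>" unfolding tangent_coords(2) using m2 by linarith
  also have "\<bar>n0 z * mk (X' z u) (X q)\<bar> \<le> 1/8 * a" unfolding abs_mult a_def using s by (intro mult_right_mono) auto
  finally have 2: "7/8 * b \<le> m + a / 8" by simp
  have "0 \<le> a" "0 \<le> b" by (simp_all add: a_def b_def)
  then have "a \<le> 2 * m" "b \<le> 2 * m" using 1 2 by linarith+
  then show "\<bar>mk (X' z u) (X q)\<bar> \<le> 2 * (norm (proj z) * norm (proj' z u))"
    "\<bar>mk (X' z u) (N q)\<bar> \<le> 2 * (norm (proj z) * norm (proj' z u))" by (simp_all add: a_def b_def m_def)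
qed

text \<open>The deviation from the Euclidean product is a sum of products of two vertical
  coordinates, each linear in |proj|. This quadratic order is what the d-bar estimate
  requires.\<close>

lemma metric_estimate:
  assumes r: "norm (proj z) \<le> 1/2"
  shows "\<bar>g z u v - proj' z u \<bullet> proj' z v\<bar> \<le> 8 * (norm (proj z))\<^sup>2 * (norm (proj' z u) * norm (proj' z v))"
proof -
  let ?r = "norm (proj z)" and ?a = "norm (proj' z u)" and ?b = "norm (proj' z v)"
  have "g z u v - proj' z u \<bullet> proj' z v = mk (X' z u) (N q) * mk (X' z v) (N q) - mk (X' z u) (X q) * mk (X' z v) (X q)"
    unfolding frame_complete[of "X' z u" "X' z v"] proj'_def cdot by simp
  also have "\<bar>\<dots>\<bar> \<le> \<bar>mk (X' z u) (N q)\<bar> * \<bar>mk (X' z v) (N q)\<bar> + \<bar>mk (X' z u) (X q)\<bar> * \<bar>mk (X' z v) (X q)\<bar>"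
    unfolding abs_mult[symmetric] by (rule abs_triangle_ineq4)
  also have "\<dots> \<le> (2 * (?r * ?a)) * (2 * (?r * ?b)) + (2 * (?r * ?a)) * (2 * (?r * ?b))"
    using vertical_bounds[OF r] by (intro add_mono mult_mono) auto
  also have "\<dots> = 8 * ?r\<^sup>2 * (?a * ?b)" by (simp add: power2_eq_square)
  finally show ?thesis .
qed

lemma proj_deriv: "(proj has_derivative proj' z) (at z)"
proof -
  have "((\<lambda>z. of_real (mk (X z) e1) + \<i> * of_real (mk (X z) e2)) has_derivative
      (\<lambda>u. of_real (mk (X' z u) e1) + \<i> * of_real (mk (X' z u) e2))) (at z)"
    by (intro has_derivative_add has_derivative_mult_right bounded_linear.has_derivative[OF bounded_linear_of_real]
        bounded_linear.has_derivative[OF mk.bounded_linear_left dX])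
  then show ?thesis by (simp add: proj_def[abs_def] proj'_def[abs_def] Complex_eq)
qed

lemma nu_deriv: "(nu has_derivative (\<lambda>u. Complex (mk (N' z u) e1) (mk (N' z u) e2))) (at z)"
proof -
  have "((\<lambda>z. of_real (mk (N z) e1) + \<i> * of_real (mk (N z) e2)) has_derivative
      (\<lambda>u. of_real (mk (N' z u) e1) + \<i> * of_real (mk (N' z u) e2))) (at z)"
    by (intro has_derivative_add has_derivative_mult_right bounded_linear.has_derivative[OF bounded_linear_of_real]
        bounded_linear.has_derivative[OF mk.bounded_linear_left dN])
  then show ?thesis by (simp add: nu_def[abs_def] Complex_eq)
qed

lemma proj'_injective: "u = 0" if r: "norm (proj z) \<le> 1/2" and 0: "proj' z u = 0"
proof (rule ccontr)
  assume "u \<noteq> 0"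
  then have "0 < g z u u" by (rule imm)
  moreover have "g z u u \<le> 0" using metric_estimate[OF r, of u u] 0 by simp
  ultimately show False by simp
qed

definition W :: "complex set" where "W = {z. norm (proj z) < 1/2}"

lemma cont_proj: "continuous_on A proj"
  using proj_deriv by (meson continuous_at_imp_continuous_on has_derivative_continuous)

lemma open_W: "open W" unfolding W_def by (intro open_Collect_less continuous_intros cont_proj)

lemma proj_q: "proj q = 0" and nu_q: "nu q = 0"
  by (simp_all add: proj_def nu_def frame zero_complex.code)

text \<open>Two points of the disk on the same vertical line would lie in each other's tangent horoballs.\<close>

lemma inj_on_proj: "inj_on proj W"
proof (rule inj_onI)
  fix z w assume z: "z \<in> W" and w: "w \<in> W" and eq: "proj z = proj w"
  define d where "d = X z - X w"
  have d12: "mk d e1 = 0" "mk d e2 = 0" using eq by (simp_all add: d_def proj_def mk_simps)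
  define d0 d3 where "d0 = mk d (X q)" and "d3 = mk d (N q)"
  have dd: "mk d d = d3\<^sup>2 - d0\<^sup>2"
    unfolding frame_complete[of d d] d12 by (simp add: d0_def d3_def power2_eq_square)
  have C: "mk d d = 2 * (- mk (X w) (X z) - 1)"
    unfolding d_def by (simp add: mk_simps XX mk_commute[of "X z" "X w"])
  have dN: "mk d (N z) = - mk (X w) (N z)" unfolding d_def by (simp add: mk_simps XN)
  have "mk d (N z) = d0 * n0 z + d3 * n3 z"
    unfolding frame_complete[of d "N z"] d12 by (simp add: d0_def d3_def n0_def n3_def mk_commute)
  \<comment> \<open>The horoballs at X z bound the normal part of d by half of its squared length,
    at most d3^2 / 2. That normal part is also at least 3/4 |d3|, and |d3| \<le> 1/4, so d3 =
    0.\<close>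
  moreover have "2 * \<bar>mk d (N z)\<bar> \<le> mk d d" unfolding C dN using tangent_horoballs[of w z] by simp
  ultimately have e1: "2 * \<bar>d0 * n0 z + d3 * n3 z\<bar> \<le> d3\<^sup>2 - d0\<^sup>2" unfolding dd by simp
  then have "0 \<le> d3\<^sup>2 - d0\<^sup>2" by (rule order_trans[rotated]) simp
  then have "d0\<^sup>2 \<le> d3\<^sup>2" by simp
  then have d03: "\<bar>d0\<bar> \<le> \<bar>d3\<bar>" by (simp add: abs_le_square_iff)
  note sz = small_bounds[of z] and sw = small_bounds[of w]
  have "d3 = x3 z - x3 w" by (simp add: d3_def d_def mk_simps x3_def)
  moreover have "\<bar>x3 z\<bar> \<le> 1/8" "\<bar>x3 w\<bar> \<le> 1/8" using sz(2) sw(2) z w by (auto simp: W_def)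
  ultimately have d3s: "\<bar>d3\<bar> \<le> 1/4" by linarith
  have "7/8 * \<bar>d3\<bar> \<le> \<bar>d3 * n3 z\<bar>" unfolding abs_mult using sz(4) z mult_right_mono[of "7/8" "\<bar>n3 z\<bar>" "\<bar>d3\<bar>"] by (simp add: W_def mult.commute)
  moreover have "\<bar>d0 * n0 z\<bar> \<le> \<bar>d3\<bar> * (1/8)" unfolding abs_mult using d03 sz(3) z by (intro mult_mono) (auto simp: W_def)
  moreover have "\<bar>d3 * n3 z\<bar> - \<bar>d0 * n0 z\<bar> \<le> \<bar>d0 * n0 z + d3 * n3 z\<bar>" by arith
  ultimately have "3/4 * \<bar>d3\<bar> \<le> \<bar>d0 * n0 z + d3 * n3 z\<bar>" by simp
  also have "2 * \<bar>d0 * n0 z + d3 * n3 z\<bar> \<le> d3\<^sup>2" by (rule order_trans[OF e1]) simp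
  then have "\<bar>d0 * n0 z + d3 * n3 z\<bar> \<le> d3\<^sup>2 / 2" by simp
  also have "\<dots> = \<bar>d3\<bar> * \<bar>d3\<bar> / 2" by (simp add: power2_eq_square)
  also have "\<dots> \<le> \<bar>d3\<bar> * (1/4) / 2" using d3s by (intro divide_right_mono mult_left_mono) auto
  finally have "d3 = 0" by simp
  then have "d0 = 0" using d03 by simp
  have "X z = X w" by (rule frame_eqI) (use d12 \<open>d3 = 0\<close> \<open>d0 = 0\<close> in \<open>simp_all add: d0_def d3_def d_def mk_simps\<close>)
  then show "z = w" using injX by (simp add: inj_eq)
qed

text \<open>The image is open by invariance of domain and relatively closed by properness, and the
  ball is connected.\<close>

lemma proj_image: "proj ` W = ball 0 (1/2)"
proof -
  have op: "open (proj ` W)" by (rule invariance_of_domain[OF cont_proj open_W inj_on_proj])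
  have "open (ball 0 (1/2) - proj ` W)"
  proof (rule openI)
    fix x :: complex assume x: "x \<in> ball 0 (1/2) - proj ` W"
    obtain s where s: "norm x < s" "s < 1/2" using x dense[of "norm x" "1/2"] by auto
    let ?K = "{z. norm (proj z) \<le> s}"
    \<comment> \<open>Closeness of the projection to 0 forces x0 \<le> 9/8, so the set lies in a
      compact sublevel set of the distance to X q.\<close>
    have "?K = {z. - mk (X z) (X q) \<le> 9/8} \<inter> ?K"
      using small_bounds(1) s by (auto simp: x0_def)
    moreover have "closed ?K" by (intro closed_Collect_le continuous_intros cont_proj)
    ultimately have "compact ?K" using compact_Int_closed[OF compact_height_sublevel[OF XX Xfut]] by metis
    then have "closed (proj ` ?K)" by (intro compact_imp_closed compact_continuous_image cont_proj)
    then have "open (ball 0 s - proj ` ?K)" by (intro open_Diff open_ball)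
    moreover have "x \<in> ball 0 s - proj ` ?K" using x s by (auto simp: W_def)
    ultimately obtain e where "e > 0" "ball x e \<subseteq> ball 0 s - proj ` ?K" by (meson open_contains_ball)
    moreover have "ball 0 s - proj ` ?K \<subseteq> ball 0 (1/2) - proj ` W" using s by (auto simp: W_def)
    ultimately show "\<exists>e>0. ball x e \<subseteq> ball 0 (1/2) - proj ` W" by blast
  qed
  moreover have sub: "proj ` W \<subseteq> ball 0 (1/2)" by (auto simp: W_def)
  moreover have "0 \<in> proj ` W" using proj_q by (force simp: W_def)
  ultimately have "ball 0 (1/2) - proj ` W = {}"
    using connectedD[OF connected_ball op, of "ball 0 (1/2) - proj ` W" 0 "1/2"] by auto
  then show ?thesis using sub by blast
qed

section \<open>The projection to the tangent plane as a chart\<close>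

definition \<sigma> :: "complex \<Rightarrow> complex" where "\<sigma> = the_inv_into W proj"

lemma \<sigma>_in: "\<sigma> \<zeta> \<in> W" and proj_\<sigma>: "proj (\<sigma> \<zeta>) = \<zeta>" if "norm \<zeta> < 1/2"
proof -
  have "\<zeta> \<in> proj ` W" using that proj_image by simp
  then show "\<sigma> \<zeta> \<in> W" "proj (\<sigma> \<zeta>) = \<zeta>"
    unfolding \<sigma>_def using the_inv_into_into[OF inj_on_proj] f_the_inv_into_f[OF inj_on_proj] by auto
qed

lemma \<sigma>_proj: "\<sigma> (proj z) = z" if "z \<in> W"
  unfolding \<sigma>_def by (rule the_inv_into_f_f[OF inj_on_proj that])

lemma \<sigma>_0: "\<sigma> 0 = q" using \<sigma>_proj[of q] proj_q by (simp add: W_def)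

definition jac :: "complex \<Rightarrow> real" where
  "jac z = Re (proj' z 1) * Im (proj' z \<i>) - Re (proj' z \<i>) * Im (proj' z 1)"

text \<open>Cramer's rule for the inverse of \<open>proj' z\<close>.\<close>

definition \<tau> :: "complex \<Rightarrow> complex \<Rightarrow> complex" where
  "\<tau> z v = Complex ((Im (proj' z \<i>) * Re v - Re (proj' z \<i>) * Im v) / jac z)
                    ((Re (proj' z 1) * Im v - Im (proj' z 1) * Re v) / jac z)"

lemma linear_proj': "linear (proj' z)" using proj_deriv has_derivative_linear by blast

lemma jac_nz: "jac z \<noteq> 0" if "norm (proj z) \<le> 1/2"
proof
  assume j: "jac z = 0"
  have s: "proj' z u = Re u *\<^sub>R proj' z 1 + Im u *\<^sub>R proj' z \<i>" for u by (rule linear_complex_split[OF linear_proj'])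
  have "proj' z (Complex (Re (proj' z \<i>)) (- Re (proj' z 1))) = 0" "proj' z (Complex (Im (proj' z \<i>)) (- Im (proj' z 1))) = 0"
    unfolding s[of "Complex _ _"] using j by (simp_all add: complex_eq_iff jac_def algebra_simps)
  then have "Complex (Re (proj' z \<i>)) (- Re (proj' z 1)) = 0" "Complex (Im (proj' z \<i>)) (- Im (proj' z 1)) = 0"
    using proj'_injective[OF that] by blast+
  then have "proj' z 1 = 0" by (simp add: complex_eq_iff)
  then show False using proj'_injective[OF that] by fastforce
qed

lemma proj'_\<tau>: "proj' z (\<tau> z v) = v" if "norm (proj z) \<le> 1/2"
proof -
  have s: "proj' z u = Re u *\<^sub>R proj' z 1 + Im u *\<^sub>R proj' z \<i>" for u by (rule linear_complex_split[OF linear_proj'])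
  have j: "jac z \<noteq> 0" by (rule jac_nz[OF that])
  have t: "jac z * Re (\<tau> z v) = Im (proj' z \<i>) * Re v - Re (proj' z \<i>) * Im v"
    "jac z * Im (\<tau> z v) = Re (proj' z 1) * Im v - Im (proj' z 1) * Re v"
    using j by (simp_all add: \<tau>_def)
  have "jac z * Re (proj' z (\<tau> z v)) = (jac z * Re (\<tau> z v)) * Re (proj' z 1) + (jac z * Im (\<tau> z v)) * Re (proj' z \<i>)"
    "jac z * Im (proj' z (\<tau> z v)) = (jac z * Re (\<tau> z v)) * Im (proj' z 1) + (jac z * Im (\<tau> z v)) * Im (proj' z \<i>)"
    by (simp_all add: arg_cong[OF s[of "\<tau> z v"], of Re] arg_cong[OF s[of "\<tau> z v"], of Im] algebra_simps)
  then have "jac z * Re (proj' z (\<tau> z v)) = jac z * Re v" "jac z * Im (proj' z (\<tau> z v)) = jac z * Im v"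
    unfolding t by (simp_all add: jac_def algebra_simps)
  then show ?thesis using j by (simp add: complex_eq_iff)
qed

lemma \<sigma>_deriv: "(\<sigma> has_derivative \<tau> (\<sigma> \<zeta>)) (at \<zeta>)" if "norm \<zeta> < 1/2"
proof (rule has_derivative_inverse_strong_x[OF open_W])
  show "\<sigma> \<zeta> \<in> W" "proj (\<sigma> \<zeta>) = \<zeta>" using \<sigma>_in proj_\<sigma> that by auto
  show "continuous_on W proj" by (rule cont_proj)
  show "\<sigma> (proj z) = z" if "z \<in> W" for z by (rule \<sigma>_proj[OF that])
  show "(proj has_derivative proj' (\<sigma> \<zeta>)) (at (\<sigma> \<zeta>))" by (rule proj_deriv)
  show "proj' (\<sigma> \<zeta>) \<circ> \<tau> (\<sigma> \<zeta>) = id"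
    using proj'_\<tau>[of "\<sigma> \<zeta>"] proj_\<sigma>[OF that] that by (auto simp: fun_eq_iff)
qed

lemma cont_\<sigma>: "continuous_on (ball 0 (1/2)) \<sigma>"
  using \<sigma>_deriv by (intro continuous_at_imp_continuous_on ballI has_derivative_continuous) auto

section \<open>The shape operator in the chart\<close>

definition "G z u v = g z (\<tau> z u) (\<tau> z v)"
definition "H z u v = h z (\<tau> z u) (\<tau> z v)"
definition "A1 z v = mk (N' z (\<tau> z v)) e1"
definition "A2 z v = mk (N' z (\<tau> z v)) e2"

text \<open>The derivative of N is tangent, and \<open>proj'\<close> sends the basis vectors
  \<open>\<tau> z 1\<close>, \<open>\<tau> z \<i>\<close> to 1 and i. Frame coordinates of a tangent
  vector are therefore its coefficients in this basis, so the Jacobian of \<open>nu\<close> in the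
  chart is the matrix of minus the shape operator.\<close>

lemma N'_tangent:
  assumes r: "norm (proj z) \<le> 1/2"
  shows "N' z (\<tau> z v) = A1 z v *\<^sub>R X' z (\<tau> z 1) + A2 z v *\<^sub>R X' z (\<tau> z \<i>)"
proof -
  have p1: "proj' z (\<tau> z 1) = 1" and p2: "proj' z (\<tau> z \<i>) = \<i>" using proj'_\<tau>[OF r] by auto
  have "Re (\<tau> z 1) * Im (\<tau> z \<i>) - Im (\<tau> z 1) * Re (\<tau> z \<i>) = 1 / jac z"
    using jac_nz[OF r] by (simp add: \<tau>_def field_simps) (simp add: jac_def algebra_simps)
  then have "Re (\<tau> z 1) * Im (\<tau> z \<i>) - Im (\<tau> z 1) * Re (\<tau> z \<i>) \<noteq> 0" using jac_nz[OF r] by simp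
  from basis[OF this, of "N' z (\<tau> z v)" z]
  obtain t a b k where e: "N' z (\<tau> z v) = t *\<^sub>R X z + a *\<^sub>R X' z (\<tau> z 1) + b *\<^sub>R X' z (\<tau> z \<i>) + k *\<^sub>R N z" by blast
  have "mk (X z) (N' z (\<tau> z v)) = - t" "mk (N z) (N' z (\<tau> z v)) = k"
    unfolding e by (simp_all add: mk_simps XX NN XN X'X X'N mk_commute[of "N z" "X z"] mk_commute[of "X z" "X' z _"] mk_commute[of "N z" "X' z _"])
  then have "t = 0" "k = 0" using XN' NN' by simp_all
  then have e: "N' z (\<tau> z v) = a *\<^sub>R X' z (\<tau> z 1) + b *\<^sub>R X' z (\<tau> z \<i>)" using e by simp
  have "mk (X' z (\<tau> z 1)) e1 = 1" "mk (X' z (\<tau> z 1)) e2 = 0" "mk (X' z (\<tau> z \<i>)) e1 = 0" "mk (X' z (\<tau> z \<i>)) e2 = 1"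
    using p1 p2 by (simp_all add: proj'_def complex_eq_iff)
  then have "A1 z v = a" "A2 z v = b" unfolding A1_def A2_def e by (simp_all add: mk_simps)
  then show ?thesis using e by simp
qed

lemma h_bound: "\<bar>h z u u\<bar> \<le> g z u u"
  using small[of u z] linear_0[OF linear_X'[of z]] linear_0[OF linear_X2[of z 0]]
  by (cases "u = 0") (auto simp: mk_simps)

lemma h_bound_polar: "\<bar>h z u v\<bar> \<le> (g z u u + g z v v) / 2"
proof -
  have p: "h z (u + v) (u + v) - h z (u - v) (u - v) = 4 * h z u v"
    unfolding h_split[of z "u + v" "u + v"] h_split[of z "u - v" "u - v"] h_split[of z u v] by (simp add: algebra_simps)
  have "g z (u + v) (u + v) + g z (u - v) (u - v) = 2 * (g z u u + g z v v)"
    unfolding linear_add[OF linear_X'] linear_diff[OF linear_X'] by (simp add: mk_simps)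
  then show ?thesis using p h_bound[of z "u + v"] h_bound[of z "u - v"] by linarith
qed

text \<open>The shape operator is trace free and self-adjoint for a metric that is Euclidean up to \<open>O(r\<^sup>2)\<close> in the
  coordinate \<open>proj\<close>. Hence the conjugate of the tangential part \<open>nu\<close> of the normal satisfies the
  Cauchy-Riemann equations up to \<open>O(r\<^sup>2)\<close>.\<close>

lemma shape:
  assumes r: "norm (proj z) \<le> 1/8"
  shows "A1 z 1 + A2 z \<i> = 0" "\<bar>A1 z \<i> - A2 z 1\<bar> \<le> 48 * (norm (proj z))\<^sup>2"
    "A1 z 1 = - (G z \<i> \<i> * H z 1 1 - G z 1 \<i> * H z 1 \<i>) / (G z 1 1 * G z \<i> \<i> - (G z 1 \<i>)\<^sup>2)"
    "A2 z 1 = - (G z 1 1 * H z 1 \<i> - G z 1 \<i> * H z 1 1) / (G z 1 1 * G z \<i> \<i> - (G z 1 \<i>)\<^sup>2)"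
    "A1 z \<i> = - (G z \<i> \<i> * H z 1 \<i> - G z 1 \<i> * H z \<i> \<i>) / (G z 1 1 * G z \<i> \<i> - (G z 1 \<i>)\<^sup>2)"
proof -
  have r2: "norm (proj z) \<le> 1/2" using r by simp
  have est: "\<bar>G z u v - u \<bullet> v\<bar> \<le> 8 * (norm (proj z))\<^sup>2 * (norm u * norm v)" for u v
    using metric_estimate[OF r2, of "\<tau> z u" "\<tau> z v"] unfolding G_def proj'_\<tau>[OF r2] .
  have "(norm (proj z))\<^sup>2 \<le> (1/8)\<^sup>2" using r by (intro power_mono) auto
  \<comment> \<open>The radius 1/8 is the largest for which 8 r^2 \<le> 1/8, the smallness required
    of the metric deviation e = 8 r^2; the bound 6 e then gives the constant 48.\<close>
  then have e: "8 * (norm (proj z))\<^sup>2 \<le> 1/8" by (simp add: power2_eq_square)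
  have eq: "G z u 1 * A1 z v + G z u \<i> * A2 z v = - H z u v" for u v
    using X'N'[of z "\<tau> z u" "\<tau> z v"] unfolding N'_tangent[OF r2, of v] G_def H_def by (simp add: mk_simps mult.commute)
  have sym: "G z \<i> 1 = G z 1 \<i>" "H z \<i> 1 = H z 1 \<i>"
    unfolding G_def H_def by (rule mk_commute) (simp add: sym2[of z "\<tau> z \<i>"])
  have G: "\<bar>G z 1 1 - 1\<bar> \<le> 8 * (norm (proj z))\<^sup>2" "\<bar>G z 1 \<i>\<bar> \<le> 8 * (norm (proj z))\<^sup>2" "\<bar>G z \<i> \<i> - 1\<bar> \<le> 8 * (norm (proj z))\<^sup>2"
    using est[of 1 1] est[of 1 \<i>] est[of \<i> \<i>] by (simp_all add: inner_complex_def)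
  have H: "\<bar>H z 1 1\<bar> \<le> G z 1 1" "\<bar>H z \<i> \<i>\<bar> \<le> G z \<i> \<i>" "\<bar>H z 1 \<i>\<bar> \<le> (G z 1 1 + G z \<i> \<i>) / 2"
    unfolding G_def H_def by (rule h_bound h_bound_polar)+
  have tr: "G z \<i> \<i> * H z 1 1 - 2 * G z 1 \<i> * H z 1 \<i> + G z 1 1 * H z \<i> \<i> = 0"
    unfolding G_def H_def by (rule trace_zero)
  note T = trace_free_shape_asymmetry[OF eq[of 1 1] eq[of \<i> 1, unfolded sym] eq[of 1 \<i>] eq[of \<i> \<i>, unfolded sym] tr G e H]
  show "A1 z 1 + A2 z \<i> = 0" by (rule T(1))
  show "\<bar>A1 z \<i> - A2 z 1\<bar> \<le> 48 * (norm (proj z))\<^sup>2" using T(2) by simp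
  show "A1 z 1 = - (G z \<i> \<i> * H z 1 1 - G z 1 \<i> * H z 1 \<i>) / (G z 1 1 * G z \<i> \<i> - (G z 1 \<i>)\<^sup>2)"
    "A2 z 1 = - (G z 1 1 * H z 1 \<i> - G z 1 \<i> * H z 1 1) / (G z 1 1 * G z \<i> \<i> - (G z 1 \<i>)\<^sup>2)"
    "A1 z \<i> = - (G z \<i> \<i> * H z 1 \<i> - G z 1 \<i> * H z \<i> \<i>) / (G z 1 1 * G z \<i> \<i> - (G z 1 \<i>)\<^sup>2)" by (rule T)+
qed

lemma continuous_on_GH: "continuous_on W (\<lambda>z. G z u v)" "continuous_on W (\<lambda>z. H z u v)"
proof -
  have p: "continuous_on W (\<lambda>z. Re (proj' z u))" "continuous_on W (\<lambda>z. Im (proj' z u))" for u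
    by (simp_all add: proj'_def) (intro mk.continuous_on cont_X' continuous_on_const)+
  have jn: "z \<in> W \<Longrightarrow> jac z \<noteq> 0" for z using jac_nz by (simp add: W_def)
  have j: "continuous_on W jac" unfolding jac_def by (intro continuous_intros p)
  have t: "continuous_on W (\<lambda>z. Re (\<tau> z u))" "continuous_on W (\<lambda>z. Im (\<tau> z u))" for u
    using jn by (auto simp: \<tau>_def intro!: continuous_intros p j)
  have g: "continuous_on W (\<lambda>z. g z u v)" for u v by (intro mk.continuous_on cont_X')
  have hc: "continuous_on W (\<lambda>z. h z u v)" for u v
    by (intro mk.continuous_on cont_N continuous_on_subset[OF cont2]) auto
  show "continuous_on W (\<lambda>z. G z u v)" unfolding G_def g_split[of _ "\<tau> _ u" "\<tau> _ v"]
    by (intro continuous_on_add continuous_on_mult t g)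
  show "continuous_on W (\<lambda>z. H z u v)" unfolding H_def h_split[of _ "\<tau> _ u" "\<tau> _ v"]
    by (intro continuous_on_add continuous_on_mult t hc)
qed

text \<open>Conjugated because a trace-free symmetric matrix is the real Jacobian of an
  antiholomorphic map.\<close>

definition f :: "complex \<Rightarrow> complex" where "f \<zeta> = cnj (nu (\<sigma> \<zeta>))"
definition f' :: "complex \<Rightarrow> complex \<Rightarrow> complex" where "f' \<zeta> v = Complex (A1 (\<sigma> \<zeta>) v) (- A2 (\<sigma> \<zeta>) v)"

lemma f_deriv: "(f has_derivative f' \<zeta>) (at \<zeta>)" if "norm \<zeta> < 1/2"
proof -
  have "((\<lambda>\<zeta>. nu (\<sigma> \<zeta>)) has_derivative (\<lambda>v. Complex (mk (N' (\<sigma> \<zeta>) (\<tau> (\<sigma> \<zeta>) v)) e1) (mk (N' (\<sigma> \<zeta>) (\<tau> (\<sigma> \<zeta>) v)) e2))) (at \<zeta>)"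
    by (rule has_derivative_compose[OF \<sigma>_deriv[OF that] nu_deriv])
  note bounded_linear.has_derivative[OF bounded_linear_cnj this]
  moreover have "cnj (Complex a b) = Complex a (- b)" for a b by (simp add: complex_eq_iff)
  ultimately show ?thesis unfolding f_def[abs_def] f'_def[abs_def] A1_def A2_def by simp
qed

lemma small_disc:
  assumes "norm \<zeta> \<le> 1/8"
  shows "norm \<zeta> < 1/2" "proj (\<sigma> \<zeta>) = \<zeta>" "\<sigma> \<zeta> \<in> W" "norm (proj (\<sigma> \<zeta>)) \<le> 1/8"
proof -
  show 1: "norm \<zeta> < 1/2" using assms by simp
  show 2: "proj (\<sigma> \<zeta>) = \<zeta>" and "\<sigma> \<zeta> \<in> W" using proj_\<sigma>[OF 1] \<sigma>_in[OF 1] by auto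
  show "norm (proj (\<sigma> \<zeta>)) \<le> 1/8" unfolding 2 by (rule assms)
qed

text \<open>The derivative of N is given pointwise, with no continuity assumed. Continuity comes
  from the formulas for its entries in terms of G and H, which involve at most second derivatives of
  X.\<close>

lemma f'_continuous: "continuous_on (cball 0 (1/8)) (\<lambda>\<zeta>. f' \<zeta> v)"
proof -
  have s: "continuous_on (cball 0 (1/8)) \<sigma>" by (rule continuous_on_subset[OF cont_\<sigma>]) auto
  have c: "continuous_on (cball 0 (1/8)) (\<lambda>\<zeta>. G (\<sigma> \<zeta>) u v)" "continuous_on (cball 0 (1/8)) (\<lambda>\<zeta>. H (\<sigma> \<zeta>) u v)" for u v
    by (rule continuous_on_compose2[OF continuous_on_GH(1) s] continuous_on_compose2[OF continuous_on_GH(2) s], auto simp: small_disc)+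
  have d: "G (\<sigma> \<zeta>) 1 1 * G (\<sigma> \<zeta>) \<i> \<i> - (G (\<sigma> \<zeta>) 1 \<i>)\<^sup>2 \<noteq> 0" if "\<zeta> \<in> cball 0 (1/8)" for \<zeta>
  proof -
    have r: "norm (proj (\<sigma> \<zeta>)) \<le> 1/2" using small_disc(4)[of \<zeta>] that by simp
    have "Re (\<tau> (\<sigma> \<zeta>) 1) * Im (\<tau> (\<sigma> \<zeta>) \<i>) - Im (\<tau> (\<sigma> \<zeta>) 1) * Re (\<tau> (\<sigma> \<zeta>) \<i>) = 1 / jac (\<sigma> \<zeta>)"
      using jac_nz[OF r] by (simp add: \<tau>_def field_simps) (simp add: jac_def algebra_simps)
    then show ?thesis unfolding G_def using jac_nz[OF r] gram_pos[of "\<tau> (\<sigma> \<zeta>) 1" "\<tau> (\<sigma> \<zeta>) \<i>" "\<sigma> \<zeta>"] by simp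
  qed
  have k: "continuous_on (cball 0 (1/8)) (\<lambda>\<zeta>. - (G (\<sigma> \<zeta>) \<i> \<i> * H (\<sigma> \<zeta>) 1 1 - G (\<sigma> \<zeta>) 1 \<i> * H (\<sigma> \<zeta>) 1 \<i>) / (G (\<sigma> \<zeta>) 1 1 * G (\<sigma> \<zeta>) \<i> \<i> - (G (\<sigma> \<zeta>) 1 \<i>)\<^sup>2))"
    "continuous_on (cball 0 (1/8)) (\<lambda>\<zeta>. - (G (\<sigma> \<zeta>) 1 1 * H (\<sigma> \<zeta>) 1 \<i> - G (\<sigma> \<zeta>) 1 \<i> * H (\<sigma> \<zeta>) 1 1) / (G (\<sigma> \<zeta>) 1 1 * G (\<sigma> \<zeta>) \<i> \<i> - (G (\<sigma> \<zeta>) 1 \<i>)\<^sup>2))"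
    "continuous_on (cball 0 (1/8)) (\<lambda>\<zeta>. - (G (\<sigma> \<zeta>) \<i> \<i> * H (\<sigma> \<zeta>) 1 \<i> - G (\<sigma> \<zeta>) 1 \<i> * H (\<sigma> \<zeta>) \<i> \<i>) / (G (\<sigma> \<zeta>) 1 1 * G (\<sigma> \<zeta>) \<i> \<i> - (G (\<sigma> \<zeta>) 1 \<i>)\<^sup>2))"
    using d by (auto intro!: continuous_on_divide continuous_on_minus continuous_on_diff continuous_on_mult continuous_on_power c)
  have a: "continuous_on (cball 0 (1/8)) (\<lambda>\<zeta>. A1 (\<sigma> \<zeta>) 1)" "continuous_on (cball 0 (1/8)) (\<lambda>\<zeta>. A2 (\<sigma> \<zeta>) 1)"
    "continuous_on (cball 0 (1/8)) (\<lambda>\<zeta>. A1 (\<sigma> \<zeta>) \<i>)"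
    by (rule continuous_on_eq[OF k(1)] continuous_on_eq[OF k(2)] continuous_on_eq[OF k(3)], use shape(3-5) small_disc(4) in simp)+
  have a2: "continuous_on (cball 0 (1/8)) (\<lambda>\<zeta>. A2 (\<sigma> \<zeta>) \<i>)"
  proof (rule continuous_on_eq[OF continuous_on_minus[OF a(1)]])
    fix \<zeta> :: complex assume "\<zeta> \<in> cball 0 (1/8)"
    then show "- A1 (\<sigma> \<zeta>) 1 = A2 (\<sigma> \<zeta>) \<i>" using shape(1)[OF small_disc(4)[of \<zeta>]] by simp
  qed
  have "continuous_on (cball 0 (1/8)) (\<lambda>\<zeta>. Re v *\<^sub>R f' \<zeta> 1 + Im v *\<^sub>R f' \<zeta> \<i>)"
    unfolding f'_def Complex_eq by (intro continuous_intros a a2)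
  then show ?thesis
  proof (rule continuous_on_eq)
    fix \<zeta> :: complex assume "\<zeta> \<in> cball 0 (1/8)"
    then have "linear (f' \<zeta>)" using f_deriv[of \<zeta>] has_derivative_linear by auto
    from linear_complex_split[OF this, of v] show "Re v *\<^sub>R f' \<zeta> 1 + Im v *\<^sub>R f' \<zeta> \<i> = f' \<zeta> v" by simp
  qed
qed

text \<open>With r = 1/2560 and R = 16 r = 1/160, the term 144 R^3 is 0.09 r and 2 r^2 / R is r/8,
  together below r/4.\<close>

lemma f_small: "norm (f \<zeta>) \<le> 1/10240" if z: "norm \<zeta> \<le> 1/2560"
proof -
  interpret C: C1_disc f f' "1/160"
    by unfold_locales (auto intro!: f_deriv continuous_on_subset[OF f'_continuous])
  have "norm (f \<zeta>) \<le> 3 * 48 * (1/160) ^ 3 + 2 * 1 * (norm \<zeta>)\<^sup>2 / (1/160)"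
  proof (rule C.quadratic_decay)
    fix w :: complex assume "w \<in> cball 0 (1/160)"
    then have w: "norm w \<le> 1/8" by simp
    have "f' w 1 + \<i> * f' w \<i> = \<i> * of_real (A1 (\<sigma> w) \<i> - A2 (\<sigma> w) 1)"
      using shape(1)[OF small_disc(4)[OF w]] by (simp add: f'_def complex_eq_iff)
    then have "norm (f' w 1 + \<i> * f' w \<i>) = \<bar>A1 (\<sigma> w) \<i> - A2 (\<sigma> w) 1\<bar>" by (simp only: norm_mult norm_of_real norm_ii mult_1)
    then show "norm (f' w 1 + \<i> * f' w \<i>) \<le> 48 * (norm w)\<^sup>2"
      using shape(2)[OF small_disc(4)[OF w]] small_disc(2)[OF w] by simp
    show "norm (f w) \<le> 1 * norm w"
      using nu_bound[of "\<sigma> w"] small_disc(2)[OF w] w by (simp add: f_def)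
  next
    show "f 0 = 0" by (simp add: f_def \<sigma>_0 nu_q)
    \<comment> \<open>The vanishing Hopf differential is used here: it kills the shape operator at q
      and hence the derivative of f at 0.\<close>
    have H0: "H q u v = 0" for u v unfolding H_def by (rule umbilic)
    have r: "norm (proj q) \<le> 1/8" by (simp add: proj_q)
    have "A1 q 1 = 0" "A2 q 1 = 0" "A1 q \<i> = 0" using shape(3-5)[OF r] by (simp_all add: H0)
    moreover have "A2 q \<i> = 0" using shape(1)[OF r] \<open>A1 q 1 = 0\<close> by simp
    ultimately have "f' 0 1 = 0" "f' 0 \<i> = 0" by (simp_all add: f'_def \<sigma>_0 complex_eq_iff)
    then show "f' 0 v = 0" for v
      using linear_complex_split[OF has_derivative_linear[OF f_deriv[of 0]], of v] by simp
  qed (use z in auto)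
  also have "\<dots> \<le> 3 * 48 * (1/160) ^ 3 + 2 * 1 * (1/2560)\<^sup>2 / (1/160)"
    using z by (intro add_mono divide_right_mono mult_left_mono power_mono) auto
  also have "\<dots> \<le> 1/10240" by (simp add: power_divide)
  finally show ?thesis .
qed

text \<open>By Brouwer, the hyperbolic Gauss map covers a disc of definite size, since it is uniformly close to
  the Gauss map of the tangent plane.\<close>

lemma gauss_map_covers:
  assumes \<beta>: "norm \<beta> \<le> 1/5120"
  obtains z where "z \<in> W" "norm (proj z) \<le> 1/2560" "proj z + nu z = of_real (x0 z + n0 z) * \<beta>"
proof -
  define k where "k \<zeta> = x0 (\<sigma> \<zeta>) + n0 (\<sigma> \<zeta>)" for \<zeta>
  \<comment> \<open>Here k is the time coordinate of X + N, so (\<zeta> + nu) / k is the tangential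
    coordinate of the Gauss image, and fixed points of \<Phi> are the points with Gauss coordinate
    \<beta>. On the disc of radius r the image has modulus at most r^3 + r/4 + r/2, which is below
    r.\<close>
  define \<Phi> where "\<Phi> \<zeta> = \<zeta> - (\<zeta> + cnj (f \<zeta>)) / of_real (k \<zeta>) + \<beta>" for \<zeta>
  let ?B = "cball (0::complex) (1/2560)"
  have sd: "norm \<zeta> \<le> 1/8" if "\<zeta> \<in> ?B" for \<zeta> using that by simp
  have k: "1 \<le> k \<zeta>" "k \<zeta> \<le> 1 + (norm \<zeta>)\<^sup>2" if "\<zeta> \<in> ?B" for \<zeta>
    using n0_bound[of "\<sigma> \<zeta>"] x0_upper[of "\<sigma> \<zeta>"] small_disc(2)[OF sd[OF that]] unfolding k_def by auto
  have s: "continuous_on ?B \<sigma>" by (rule continuous_on_subset[OF cont_\<sigma>]) auto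
  have ck: "continuous_on ?B k" unfolding k_def x0_def n0_def
    by (intro continuous_intros mk.continuous_on continuous_on_compose2[OF cont_X[of UNIV] s] continuous_on_compose2[OF cont_N[of UNIV] s]) auto
  have cf: "continuous_on ?B f"
  proof (intro continuous_at_imp_continuous_on ballI)
    show "isCont f x" if "x \<in> ?B" for x using has_derivative_continuous[OF f_deriv[of x]] that by simp
  qed
  have "continuous_on ?B \<Phi>" unfolding \<Phi>_def using k(1)
    by (intro continuous_intros ck cf) fastforce
  moreover have "\<Phi> \<in> ?B \<rightarrow> ?B"
  proof
    fix \<zeta> assume z: "\<zeta> \<in> ?B"
    then have z': "norm \<zeta> \<le> 1/2560" by simp
    have k0: "k \<zeta> \<noteq> 0" using k(1)[OF z] by simp
    have "\<Phi> \<zeta> = of_real (1 - 1 / k \<zeta>) * \<zeta> - cnj (f \<zeta>) / of_real (k \<zeta>) + \<beta>"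
      unfolding \<Phi>_def using k0 by (simp add: field_simps)
    also have "norm \<dots> \<le> norm (of_real (1 - 1 / k \<zeta>) * \<zeta>) + norm (cnj (f \<zeta>) / of_real (k \<zeta>)) + norm \<beta>"
      by (intro norm_triangle_le norm_triangle_le_diff add_mono) auto
    also have "norm (of_real (1 - 1 / k \<zeta>) * \<zeta>) \<le> (norm \<zeta>)\<^sup>2 * norm \<zeta>"
    proof -
      have "\<bar>1 - 1 / k \<zeta>\<bar> = (k \<zeta> - 1) / k \<zeta>" using k(1)[OF z] by (simp add: diff_divide_distrib)
      also have "\<dots> \<le> (k \<zeta> - 1) / 1" using k(1)[OF z] by (intro divide_left_mono) auto
      also have "\<dots> = k \<zeta> - 1" by simp
      also have "\<dots> \<le> (norm \<zeta>)\<^sup>2" using k(2)[OF z] by simp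
      finally show ?thesis unfolding norm_mult norm_of_real by (intro mult_right_mono) auto
    qed
    also have "(norm \<zeta>)\<^sup>2 * norm \<zeta> \<le> (1/2560)\<^sup>2 * (1/2560)" using z' by (intro mult_mono power_mono) auto
    also have "norm (cnj (f \<zeta>) / of_real (k \<zeta>)) \<le> 1/10240"
    proof -
      have "norm (cnj (f \<zeta>) / of_real (k \<zeta>)) = norm (f \<zeta>) / k \<zeta>" using k(1)[OF z] by (simp add: norm_divide)
      also have "\<dots> \<le> norm (f \<zeta>) / 1" using k(1)[OF z] by (intro divide_left_mono) auto
      finally show ?thesis using f_small[OF z'] by simp
    qed
    also note \<beta>
    finally have "norm (\<Phi> \<zeta>) \<le> (1/2560)\<^sup>2 * (1/2560) + 1/10240 + 1/5120" by simp
    also have "\<dots> \<le> 1/2560" by (simp add: power_divide)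
    finally show "\<Phi> \<zeta> \<in> ?B" by simp
  qed
  ultimately obtain \<zeta> where z: "\<zeta> \<in> ?B" "\<Phi> \<zeta> = \<zeta>" using brouwer[of ?B \<Phi>] by auto
  have k0: "of_real (k \<zeta>) \<noteq> (0::complex)" using k(1)[OF z(1)] by simp
  have "(\<zeta> + cnj (f \<zeta>)) / of_real (k \<zeta>) = \<beta>" using z(2) unfolding \<Phi>_def by (simp add: algebra_simps)
  then have "\<zeta> + cnj (f \<zeta>) = of_real (k \<zeta>) * \<beta>" using k0 by (simp add: field_simps)
  then have "proj (\<sigma> \<zeta>) + nu (\<sigma> \<zeta>) = of_real (x0 (\<sigma> \<zeta>) + n0 (\<sigma> \<zeta>)) * \<beta>"
    using small_disc(2)[OF sd[OF z(1)]] by (simp add: f_def k_def)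
  then show ?thesis using that small_disc(2,3)[OF sd[OF z(1)]] z(1) by simp
qed

text \<open>The condition \<open>near\<close> says that the normalized tangential coordinate of b
  has modulus at most 1/5120. Hence b is a positive multiple of some X z + N z, whose tangent
  horoball misses the disk; the factor 1/2 comes from k \<le> 2.\<close>

lemma horoballs_near_umbilic_normal:
  assumes b: "mk b b = 0" "0 < - mk b (X q)" "0 < mk b (N q)"
    and near: "(mk b (X q))\<^sup>2 - (mk b (N q))\<^sup>2 \<le> (mk b (X q) / 5120)\<^sup>2"
  shows "- mk b (X q) / 2 \<le> - mk (X w) b"
proof -
  define b0 b3 where "b0 = - mk b (X q)" and "b3 = mk b (N q)"
  define \<beta>1 \<beta>2 where "\<beta>1 = mk b e1 / b0" and "\<beta>2 = mk b e2 / b0"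
  define \<beta> where "\<beta> = Complex \<beta>1 \<beta>2"
  have b0: "b0 > 0" "b3 > 0" using b by (simp_all add: b0_def b3_def)
  have s: "(mk b e1)\<^sup>2 + (mk b e2)\<^sup>2 = b0\<^sup>2 - b3\<^sup>2"
    using b(1) frame_complete[of b b] by (simp add: b0_def b3_def power2_eq_square)
  have "(norm \<beta>)\<^sup>2 = ((mk b e1)\<^sup>2 + (mk b e2)\<^sup>2) / b0\<^sup>2"
    unfolding \<beta>_def normsq \<beta>1_def \<beta>2_def by (simp add: power_divide add_divide_distrib)
  then have n\<beta>: "(norm \<beta>)\<^sup>2 = 1 - (b3 / b0)\<^sup>2" unfolding s using b0 by (simp add: diff_divide_distrib power_divide)
  have "(norm \<beta>)\<^sup>2 \<le> (1/5120)\<^sup>2"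
  proof -
    have "b0\<^sup>2 - b3\<^sup>2 \<le> (1/5120)\<^sup>2 * b0\<^sup>2" using near by (simp add: b0_def b3_def power_divide)
    then show ?thesis using \<open>(norm \<beta>)\<^sup>2 = _ / _\<close> b0 unfolding s by (simp add: pos_divide_le_eq)
  qed
  then have "norm \<beta> \<le> 1/5120" by (rule power2_le_imp_le) simp
  then obtain z where z: "z \<in> W" "norm (proj z) \<le> 1/2560" "proj z + nu z = of_real (x0 z + n0 z) * \<beta>"
    using gauss_map_covers by blast
  define k where "k = x0 z + n0 z"
  have sb: "x0 z \<le> 9/8" "\<bar>n0 z\<bar> \<le> 1/8" "\<bar>x3 z\<bar> \<le> 1/8" "7/8 \<le> n3 z" using small_bounds[of z] z(2) by auto
  have k: "0 < k" "k \<le> 2" using sb x0_ge[of z] unfolding k_def by auto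
  let ?a = "X z + N z"
  have a1: "mk ?a e1 = k * \<beta>1" "mk ?a e2 = k * \<beta>2"
    using arg_cong[OF z(3), of Re] arg_cong[OF z(3), of Im]
    by (simp_all add: proj_def nu_def \<beta>_def k_def mk_simps)
  have a0: "mk ?a (X q) = - k" by (simp add: k_def x0_def n0_def mk_simps)
  \<comment> \<open>The null condition determines this coordinate up to sign. The sign is positive
    because x3 + n3 is at least 7/8 - 1/8.\<close>
  have a3: "mk ?a (N q) = k * (b3 / b0)"
  proof (rule power2_eq_imp_eq)
    have "(mk ?a (N q))\<^sup>2 = k\<^sup>2 - k\<^sup>2 * (norm \<beta>)\<^sup>2"
      using frame_complete[of ?a ?a] normal_pair(1)[of z] unfolding a0 a1 \<beta>_def normsq
      by (simp add: power2_eq_square algebra_simps)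
    also have "\<dots> = (k * (b3 / b0))\<^sup>2" unfolding n\<beta> power_mult_distrib right_diff_distrib by simp
    finally show "(mk ?a (N q))\<^sup>2 = (k * (b3 / b0))\<^sup>2" .
    show "0 \<le> mk ?a (N q)" using sb unfolding mk_simps x3_def[symmetric] n3_def[symmetric] by linarith
    show "0 \<le> k * (b3 / b0)" using k b0 by simp
  qed
  have "b = (b0 / k) *\<^sub>R ?a"
  proof (rule frame_eqI)
    show "mk b e1 = mk ((b0 / k) *\<^sub>R ?a) e1" "mk b e2 = mk ((b0 / k) *\<^sub>R ?a) e2"
      unfolding mk.scaleR_left a1 \<beta>1_def \<beta>2_def using k b0 by simp_all
    show "mk b (X q) = mk ((b0 / k) *\<^sub>R ?a) (X q)" "mk b (N q) = mk ((b0 / k) *\<^sub>R ?a) (N q)"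
      unfolding mk.scaleR_left a0 a3 using k b0 by (simp_all add: b0_def b3_def)
  qed
  then have "- mk (X w) b = b0 / k * (- mk (X w) ?a)" by (simp only: mk.scaleR_right) simp
  moreover have "1 \<le> - mk (X w) ?a" by (rule horoball_plus)
  moreover have "b0 / 2 \<le> b0 / k" using k b0 by (intro divide_left_mono) auto
  moreover have "b0 / k * 1 \<le> b0 / k * (- mk (X w) ?a)"
    using k b0 \<open>1 \<le> - mk (X w) ?a\<close> by (intro mult_left_mono) auto
  ultimately show ?thesis by (simp add: b0_def)
qed

end

context minimal_disk
begin

text \<open>The auxiliary frame is eliminated by applying Gram-Schmidt to \<open>X' q 1\<close> and
  \<open>X' q \<i>\<close>.\<close>

theorem horoballs_near_umbilic_normal:
  assumes umb: "\<And>u v. mk (X2 q u v) (N q) = 0"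
    and b: "mk b b = 0" "0 < - mk b (X q)" "0 < mk b (N q)"
    and near: "(mk b (X q))\<^sup>2 - (mk b (N q))\<^sup>2 \<le> (mk b (X q) / 5120)\<^sup>2"
  shows "- mk b (X q) / 2 \<le> - mk (X w) b"
proof -
  define l where "l = sqrt (g q 1 1)"
  have g11: "g q 1 1 > 0" by (rule imm) simp
  have l: "l > 0" "l * l = g q 1 1" using g11 by (simp_all add: l_def)
  define e1 where "e1 = (1 / l) *\<^sub>R X' q 1"
  define c where "c = g q 1 \<i> / g q 1 1"
  define v where "v = X' q \<i> - c *\<^sub>R X' q 1"
  have vv: "mk v v = (g q 1 1 * g q \<i> \<i> - (g q 1 \<i>)\<^sup>2) / g q 1 1"
    using g11 unfolding v_def c_def by (simp add: mk_simps mk_commute[of "X' q \<i>" "X' q 1"] field_simps power2_eq_square)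
  then have v0: "mk v v > 0" using g11 gram_pos_std[of q] by simp
  define m where "m = sqrt (mk v v)"
  have m: "m > 0" "m * m = mk v v" using v0 by (simp_all add: m_def)
  define e2 where "e2 = (1 / m) *\<^sub>R v"
  have e1v: "mk (X' q 1) v = 0" using g11 unfolding v_def c_def by (simp add: mk_simps)
  have X: "mk (X q) (X' q u) = 0" "mk (N q) (X' q u) = 0" for u using X'X X'N mk_commute by metis+
  have Xv: "mk (X q) v = 0" "mk (N q) v = 0" by (simp_all add: v_def mk_simps X)
  have ee: "mk e1 e1 = 1" "mk e2 e2 = 1"
    unfolding e1_def e2_def mk.scaleR_left mk.scaleR_right l(2)[symmetric] m(2)[symmetric] using l(1) m(1) by simp_all
  interpret umbilic_point X N X' N' X2 q e1 e2
  proof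
    show "mk e1 e1 = 1" "mk e2 e2 = 1" by (rule ee)+
  qed (simp_all add: umb e1_def e2_def mk_simps X Xv e1v)
  show ?thesis by (rule horoballs_near_umbilic_normal[OF b near])
qed

end

section \<open>Endpoints of geodesic rays\<close>

definition ray_den :: "pt \<Rightarrow> real \<Rightarrow> real" where "ray_den n s = cosh s - snd n * sinh s"
text \<open>The unit-speed geodesic from q; n is its Euclidean unit direction, so the initial
  velocity \<open>snd q *\<^sub>R n\<close> has hyperbolic length 1.\<close>

definition geo_ray :: "pt \<Rightarrow> pt \<Rightarrow> real \<Rightarrow> pt" where
  "geo_ray q n s = (fst q + (snd q * sinh s / ray_den n s) *\<^sub>R fst n, snd q / ray_den n s)"

lemma unit_snd_le: "\<bar>snd n\<bar> \<le> 1" if "norm (n::pt) = 1"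
  using norm_snd_le[of "snd n" "fst n"] that by simp

lemma unit_fst_sq: "fst n \<bullet> fst n = 1 - (snd n)\<^sup>2" if "norm (n::pt) = 1"
proof -
  have "n \<bullet> n = 1" using that by (simp add: norm_eq_1)
  then show ?thesis by (simp add: inner_prod_def power2_eq_square)
qed

lemma ray_den_pos: "0 < ray_den n s" if "norm n = 1"
proof -
  have "\<bar>snd n * sinh s\<bar> \<le> 1 * \<bar>sinh s\<bar>"
    unfolding abs_mult using unit_snd_le[OF that] by (intro mult_right_mono) auto
  moreover have "\<bar>sinh s\<bar> < cosh s" using sinh_less_cosh_real[of "\<bar>s\<bar>"] by simp
  ultimately show ?thesis unfolding ray_den_def by linarith
qed

lemma ray_den_deriv: "(ray_den n has_real_derivative sinh s - snd n * cosh s) (at s)"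
  unfolding ray_den_def[abs_def] by (auto intro!: derivative_eq_intros)

lemma ray_den_deriv2: "((\<lambda>s. sinh s - snd n * cosh s) has_real_derivative ray_den n s) (at s)"
  unfolding ray_den_def by (auto intro!: derivative_eq_intros)

lemma cosh_sinh_sq: "cosh s * cosh s = 1 + sinh s * sinh (s::real)"
  using cosh_square_eq[of s] by (simp add: power2_eq_square)

lemma ray_num_deriv: "((\<lambda>s. r * sinh s / ray_den n s) has_real_derivative r / (ray_den n s)\<^sup>2) (at s)" if "norm n = 1"
proof -
  have nz: "ray_den n s \<noteq> 0" using ray_den_pos[OF that, of s] by simp
  have "((\<lambda>s. r * sinh s / ray_den n s) has_real_derivative
     (r * cosh s * ray_den n s - r * sinh s * (sinh s - snd n * cosh s)) / (ray_den n s * ray_den n s)) (at s)"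
    by (intro DERIV_divide ray_den_deriv nz) (auto intro!: derivative_eq_intros)
  moreover have "r * cosh s * ray_den n s - r * sinh s * (sinh s - snd n * cosh s) = r * (cosh s * cosh s - sinh s * sinh s)"
    by (simp add: ray_den_def algebra_simps)
  ultimately show ?thesis by (simp add: cosh_sinh_sq power2_eq_square)
qed

lemma geo_ray_geodesic:
  assumes q: "0 < snd q" and n: "norm n = 1"
  shows "hyp_geodesic (geo_ray q n)" "geo_ray q n 0 = q" "(geo_ray q n has_vector_derivative snd q *\<^sub>R n) (at 0)"
proof -
  let ?D = "ray_den n" and ?D' = "\<lambda>s. sinh s - snd n * cosh s"
  define c1 where "c1 s = ((snd q / (?D s)\<^sup>2) *\<^sub>R fst n, - (snd q * ?D' s / (?D s)\<^sup>2))" for s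
  define c2 where "c2 s = ((- 2 * snd q * ?D' s / (?D s) ^ 3) *\<^sub>R fst n, snd q * (2 * (?D' s)\<^sup>2 / (?D s) ^ 3 - 1 / ?D s))" for s
  have nz: "?D s \<noteq> 0" for s using ray_den_pos[OF n, of s] by simp
  have d1: "(geo_ray q n has_vector_derivative c1 s) (at s)" for s
    unfolding geo_ray_def[abs_def] c1_def
  proof (rule has_vector_derivative_Pair)
    have "((\<lambda>s. fst q + (snd q * sinh s / ?D s) *\<^sub>R fst n) has_vector_derivative 0 + ((snd q * sinh s / ?D s) *\<^sub>R 0 + (snd q / (?D s)\<^sup>2) *\<^sub>R fst n)) (at s)"
      by (intro has_vector_derivative_add has_vector_derivative_const has_vector_derivative_scaleR ray_num_deriv[OF n])
    then show "((\<lambda>s. fst q + (snd q * sinh s / ?D s) *\<^sub>R fst n) has_vector_derivative (snd q / (?D s)\<^sup>2) *\<^sub>R fst n) (at s)" by simp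
    show "((\<lambda>s. snd q / ?D s) has_vector_derivative - (snd q * ?D' s / (?D s)\<^sup>2)) (at s)"
      unfolding has_real_derivative_iff_has_vector_derivative[symmetric]
      using nz[of s] by (auto intro!: derivative_eq_intros ray_den_deriv simp: power2_eq_square)
  qed
  have d2: "(c1 has_vector_derivative c2 s) (at s)" for s
    unfolding c1_def[abs_def] c2_def
  proof (rule has_vector_derivative_Pair)
    have "((\<lambda>s. snd q / (?D s)\<^sup>2) has_real_derivative - 2 * snd q * ?D' s / (?D s) ^ 3) (at s)"
      using nz[of s] by (auto intro!: derivative_eq_intros ray_den_deriv simp: power2_eq_square power3_eq_cube field_simps)
    then have "((\<lambda>s. (snd q / (?D s)\<^sup>2) *\<^sub>R fst n) has_vector_derivative (snd q / (?D s)\<^sup>2) *\<^sub>R 0 + (- 2 * snd q * ?D' s / (?D s) ^ 3) *\<^sub>R fst n) (at s)"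
      by (intro has_vector_derivative_scaleR has_vector_derivative_const)
    then show "((\<lambda>s. (snd q / (?D s)\<^sup>2) *\<^sub>R fst n) has_vector_derivative (- 2 * snd q * ?D' s / (?D s) ^ 3) *\<^sub>R fst n) (at s)" by simp
    have "((\<lambda>s. - (snd q * ?D' s / (?D s)\<^sup>2)) has_real_derivative
       - ((snd q * ?D s * (?D s)\<^sup>2 - snd q * ?D' s * (2 * ?D s * ?D' s)) / ((?D s)\<^sup>2 * (?D s)\<^sup>2))) (at s)"
      using nz[of s] by (intro DERIV_minus DERIV_divide DERIV_cmult ray_den_deriv2) (auto intro!: derivative_eq_intros ray_den_deriv)
    moreover have "- ((snd q * ?D s * (?D s)\<^sup>2 - snd q * ?D' s * (2 * ?D s * ?D' s)) / ((?D s)\<^sup>2 * (?D s)\<^sup>2))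
       = snd q * (2 * (?D' s)\<^sup>2 / (?D s) ^ 3 - 1 / ?D s)"
    proof -
      have "x \<noteq> 0 \<Longrightarrow> - ((r * x * x\<^sup>2 - r * y * (2 * x * y)) / (x\<^sup>2 * x\<^sup>2)) = r * (2 * y\<^sup>2 / x ^ 3 - 1 / x)" for x y r :: real
        by (simp add: field_simps power2_eq_square power3_eq_cube)
      then show ?thesis using nz by blast
    qed
    ultimately show "((\<lambda>s. - (snd q * ?D' s / (?D s)\<^sup>2)) has_vector_derivative snd q * (2 * (?D' s)\<^sup>2 / (?D s) ^ 3 - 1 / ?D s)) (at s)"
      unfolding has_real_derivative_iff_has_vector_derivative[symmetric] by simp
  qed
  have sq: "fst n \<bullet> fst n + (?D' s)\<^sup>2 = (?D s)\<^sup>2" for s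
    unfolding unit_fst_sq[OF n] ray_den_def by (simp add: power2_eq_square algebra_simps cosh_sinh_sq)
  have cc: "c1 s \<bullet> c1 s = (snd q)\<^sup>2 / (?D s)\<^sup>2" for s
  proof -
    have "(r / x) * ((r / x) * a) + (r * y / x) * (r * y / x) = r\<^sup>2 * (a + y\<^sup>2) / (x * x)" for r x a y :: real
      by (simp add: distrib_left add_divide_distrib power2_eq_square mult_ac)
    moreover have "c1 s \<bullet> c1 s = (snd q / (?D s)\<^sup>2) * ((snd q / (?D s)\<^sup>2) * (fst n \<bullet> fst n)) + (snd q * ?D' s / (?D s)\<^sup>2) * (snd q * ?D' s / (?D s)\<^sup>2)"
      by (simp add: c1_def inner_prod_def)
    ultimately have "c1 s \<bullet> c1 s = (snd q)\<^sup>2 * (fst n \<bullet> fst n + (?D' s)\<^sup>2) / ((?D s)\<^sup>2 * (?D s)\<^sup>2)" by metis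
    then show ?thesis unfolding sq using nz[of s] by (simp add: power2_eq_square)
  qed
  have eq: "c2 s - (2 * snd (c1 s) / snd (geo_ray q n s)) *\<^sub>R c1 s + ((c1 s \<bullet> c1 s) / snd (geo_ray q n s)) *\<^sub>R (0, 1) = 0" for s
  proof -
    have a: "2 * snd (c1 s) / snd (geo_ray q n s) = - 2 * ?D' s / ?D s"
      using nz[of s] q by (simp add: c1_def geo_ray_def power2_eq_square field_simps)
    have b: "(c1 s \<bullet> c1 s) / snd (geo_ray q n s) = snd q / ?D s"
      unfolding cc using nz[of s] q by (simp add: geo_ray_def power2_eq_square)
    have k1: "x \<noteq> 0 \<Longrightarrow> - 2 * r * y / x ^ 3 - (- 2 * y / x) * (r / x\<^sup>2) = 0" for x y r :: real
      by (simp add: field_simps power2_eq_square power3_eq_cube)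
    have k2: "x \<noteq> 0 \<Longrightarrow> r * (2 * y\<^sup>2 / x ^ 3 - 1 / x) - (- 2 * y / x) * (- (r * y / x\<^sup>2)) + r / x = 0" for x y r :: real
      by (simp add: field_simps power2_eq_square power3_eq_cube)
    show ?thesis unfolding a b unfolding c1_def c2_def
      using k1[OF nz, of "snd q" "?D' s" s] k2[OF nz, of "snd q" "?D' s" s]
      by (simp add: prod_eq_iff scaleR_left_diff_distrib[symmetric])
  qed
  have pos: "0 < snd (geo_ray q n s)" for s unfolding geo_ray_def using q ray_den_pos[OF n] by simp
  show "hyp_geodesic (geo_ray q n)" unfolding hyp_geodesic_def using pos d1 d2 eq by blast
  show "geo_ray q n 0 = q" by (simp add: geo_ray_def ray_den_def)
  have "c1 0 = snd q *\<^sub>R n" by (simp add: c1_def ray_den_def prod_eq_iff)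
  then show "(geo_ray q n has_vector_derivative snd q *\<^sub>R n) (at 0)" using d1[of 0] by simp
qed

lemma second_order_exp_solution:
  fixes y :: "real \<Rightarrow> real"
  assumes y: "\<And>s. (y has_real_derivative y1 s) (at s)" and y1: "\<And>s. (y1 has_real_derivative y s) (at s)"
  shows "y s = y 0 * cosh s + y1 0 * sinh s"
proof -
  have "((\<lambda>s. (y s - y1 s) * exp s) has_real_derivative 0) (at s)" for s
    by (rule derivative_eq_intros y y1 refl)+ (simp add: algebra_simps)
  then have a: "(y s - y1 s) * exp s = (y 0 - y1 0) * exp 0" by (rule DERIV_isconst_all[OF allI])
  have "((\<lambda>s. (y s + y1 s) * exp (- s)) has_real_derivative 0) (at s)" for s
    by (rule derivative_eq_intros y y1 refl)+ (simp add: algebra_simps)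
  then have b: "(y s + y1 s) * exp (- s) = (y 0 + y1 0) * exp (- 0)" by (rule DERIV_isconst_all[OF allI])
  have "y s - y1 s = (y 0 - y1 0) * exp (- s)" "y s + y1 s = (y 0 + y1 0) * exp s"
    using a b by (simp_all add: exp_minus field_simps)
  then have "2 * y s = (y 0 - y1 0) * exp (- s) + (y 0 + y1 0) * exp s" by linarith
  then show ?thesis by (simp add: cosh_def sinh_def field_simps)
qed

text \<open>The definite description in \<open>geod_endpoint\<close> ranges over all geodesics, so
  uniqueness is required. The equation is integrated by hand: the hyperbolic speed is constant,
  hence the reciprocal height satisfies y'' = y, and the horizontal velocity divided by the squared
  height is constant.\<close>

lemma geodesic_unique:
  assumes c: "hyp_geodesic c" "c 0 = q" "(c has_vector_derivative snd q *\<^sub>R n) (at 0)" and n: "norm n = 1"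
  shows "c s = geo_ray q n s"
proof -
  obtain c1 c2 where pos: "\<And>s. snd (c s) > 0" and d1: "\<And>s. (c has_vector_derivative c1 s) (at s)"
    and d2: "\<And>s. (c1 has_vector_derivative c2 s) (at s)"
    and eq: "\<And>s. c2 s - (2 * snd (c1 s) / snd (c s)) *\<^sub>R c1 s + ((c1 s \<bullet> c1 s) / snd (c s)) *\<^sub>R (0, 1) = 0"
    using c(1) unfolding hyp_geodesic_def by metis
  have q: "snd q > 0" using pos[of 0] c(2) by simp
  have c10: "c1 0 = snd q *\<^sub>R n" using vector_derivative_unique_at[OF d1 c(3)] .
  define t where "t s = snd (c s)" for s
  define e where "e s = c1 s \<bullet> c1 s" for s
  have tp: "t s > 0" for s using pos by (simp add: t_def)
  then have tn: "t s \<noteq> 0" for s by (metis less_irrefl)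
  have c2: "c2 s = (2 * snd (c1 s) / t s) *\<^sub>R c1 s - (e s / t s) *\<^sub>R (0, 1)" for s
    using eq[of s] unfolding t_def e_def by (simp add: algebra_simps)
  have dt: "(t has_real_derivative snd (c1 s)) (at s)" for s
    unfolding has_real_derivative_iff_has_vector_derivative t_def[abs_def] has_vector_derivative_def
    using bounded_linear.has_derivative[OF bounded_linear_snd d1[of s, unfolded has_vector_derivative_def]] by simp
  have dt1: "((\<lambda>s. snd (c1 s)) has_real_derivative 2 * (snd (c1 s))\<^sup>2 / t s - e s / t s) (at s)" for s
  proof -
    have "((\<lambda>s. snd (c1 s)) has_real_derivative snd (c2 s)) (at s)"
      unfolding has_real_derivative_iff_has_vector_derivative has_vector_derivative_def
      using bounded_linear.has_derivative[OF bounded_linear_snd d2[of s, unfolded has_vector_derivative_def]] by simp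
    then show ?thesis unfolding c2 by (simp add: power2_eq_square mult.assoc)
  qed
  have de: "(e has_real_derivative 2 * (c1 s \<bullet> c2 s)) (at s)" for s
  proof -
    have "(e has_derivative (\<lambda>h. c1 s \<bullet> (h *\<^sub>R c2 s) + (h *\<^sub>R c2 s) \<bullet> c1 s)) (at s)"
      unfolding e_def[abs_def] by (intro has_derivative_inner d2[unfolded has_vector_derivative_def])
    then show ?thesis unfolding has_field_derivative_def
      by (rule has_derivative_eq_rhs) (auto simp: inner_commute)
  qed
  have cc: "c1 s \<bullet> c2 s = snd (c1 s) / t s * e s" for s
  proof -
    have "c1 s \<bullet> (0::complex, 1::real) = snd (c1 s)" by (simp add: inner_prod_def)
    then have "c1 s \<bullet> c2 s = 2 * snd (c1 s) / t s * e s - e s / t s * snd (c1 s)"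
      unfolding c2 inner_diff_right inner_scaleR_right e_def by simp
    then show ?thesis by simp
  qed
  have "((\<lambda>s. e s / (t s)\<^sup>2) has_real_derivative (2 * (c1 s \<bullet> c2 s) * (t s)\<^sup>2 - e s * (2 * t s * snd (c1 s))) / ((t s)\<^sup>2 * (t s)\<^sup>2)) (at s)" for s
    using tn[of s] by (intro DERIV_divide de) (auto intro!: derivative_eq_intros dt)
  moreover have "2 * (c1 s \<bullet> c2 s) * (t s)\<^sup>2 - e s * (2 * t s * snd (c1 s)) = 0" for s
    unfolding cc using tn[of s] by (simp add: power2_eq_square)
  ultimately have "((\<lambda>s. e s / (t s)\<^sup>2) has_real_derivative 0) (at s)" for s by simp
  then have "e s / (t s)\<^sup>2 = e 0 / (t 0)\<^sup>2" for s by (rule DERIV_isconst_all[OF allI])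
  moreover have "e 0 / (t 0)\<^sup>2 = 1"
  proof -
    have "e 0 = (snd q)\<^sup>2 * (n \<bullet> n)" by (simp add: e_def c10 power2_eq_square)
    moreover have "n \<bullet> n = 1" using n by (simp add: norm_eq_1)
    moreover have "t 0 = snd q" by (simp add: t_def c(2))
    ultimately show ?thesis using q by simp
  qed
  ultimately have E1: "e s / (t s)\<^sup>2 = 1" for s by metis
  have e: "e s = (t s)\<^sup>2" for s using E1[of s] by (simp only: divide_eq_1_iff)
  have y: "((\<lambda>s. 1 / t s) has_real_derivative - (snd (c1 s) / (t s)\<^sup>2)) (at s)" for s
    using tn[of s] by (auto intro!: derivative_eq_intros dt simp: power2_eq_square)
  have y1: "((\<lambda>s. - (snd (c1 s) / (t s)\<^sup>2)) has_real_derivative 1 / t s) (at s)" for s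
  proof -
    have "((\<lambda>s. - (snd (c1 s) / (t s)\<^sup>2)) has_real_derivative
       - (((2 * (snd (c1 s))\<^sup>2 / t s - e s / t s) * (t s)\<^sup>2 - snd (c1 s) * (2 * t s * snd (c1 s))) / ((t s)\<^sup>2 * (t s)\<^sup>2))) (at s)"
      using tn[of s] by (intro DERIV_minus DERIV_divide dt1) (auto intro!: derivative_eq_intros dt)
    moreover have "x \<noteq> 0 \<Longrightarrow> - (((2 * w\<^sup>2 / x - x\<^sup>2 / x) * x\<^sup>2 - w * (2 * x * w)) / (x\<^sup>2 * x\<^sup>2)) = 1 / x" for x w :: real
      by (simp add: field_simps power2_eq_square)
    note this[OF tn[of s], of "snd (c1 s)"]
    ultimately show ?thesis unfolding e by simp
  qed
  have "1 / t s = 1 / t 0 * cosh s + - (snd (c1 0) / (t 0)\<^sup>2) * sinh s" for s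
    by (rule second_order_exp_solution[OF y y1])
  then have ty: "1 / t s = ray_den n s / snd q" for s
    using q by (simp add: t_def[of 0] c(2) c10 ray_den_def power2_eq_square field_simps)
  have ts: "t s = snd q / ray_den n s" for s
    using arg_cong[OF ty[of s], of inverse] by simp
  define z1 where "z1 s = fst (c1 s)" for s
  have dz: "((\<lambda>s. fst (c s)) has_vector_derivative z1 s) (at s)" for s
    unfolding has_vector_derivative_def z1_def
    using bounded_linear.has_derivative[OF bounded_linear_fst d1[of s, unfolded has_vector_derivative_def]] by simp
  have dz1: "(z1 has_vector_derivative (2 * snd (c1 s) / t s) *\<^sub>R z1 s) (at s)" for s
  proof -
    have "(z1 has_vector_derivative fst (c2 s)) (at s)"
      unfolding has_vector_derivative_def z1_def[abs_def]
      using bounded_linear.has_derivative[OF bounded_linear_fst d2[of s, unfolded has_vector_derivative_def]] by simp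
    then show ?thesis unfolding c2 z1_def by simp
  qed
  have "((\<lambda>s. (1 / (t s)\<^sup>2) *\<^sub>R z1 s) has_vector_derivative 0) (at s within UNIV)" for s
  proof -
    have "((\<lambda>s. 1 / (t s)\<^sup>2) has_real_derivative - 2 * snd (c1 s) / (t s) ^ 3) (at s)"
      using tn[of s] by (auto intro!: derivative_eq_intros dt simp: power2_eq_square power3_eq_cube field_simps)
    from has_vector_derivative_scaleR[OF this dz1]
    have "((\<lambda>s. (1 / (t s)\<^sup>2) *\<^sub>R z1 s) has_vector_derivative (1 / (t s)\<^sup>2) *\<^sub>R ((2 * snd (c1 s) / t s) *\<^sub>R z1 s) + (- 2 * snd (c1 s) / (t s) ^ 3) *\<^sub>R z1 s) (at s)" .
    moreover have "1 / (t s)\<^sup>2 * (2 * snd (c1 s) / t s) + (- 2 * snd (c1 s) / (t s) ^ 3) = 0"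
      by (simp add: power2_eq_square power3_eq_cube)
    then have "(1 / (t s)\<^sup>2) *\<^sub>R ((2 * snd (c1 s) / t s) *\<^sub>R z1 s) + (- 2 * snd (c1 s) / (t s) ^ 3) *\<^sub>R z1 s = 0"
      by (metis scaleR_left_distrib scaleR_scaleR scaleR_zero_left)
    ultimately show ?thesis by (simp only:)
  qed
  then obtain k where k: "\<And>s. (1 / (t s)\<^sup>2) *\<^sub>R z1 s = k"
    using has_vector_derivative_zero_constant[of UNIV "\<lambda>s. (1 / (t s)\<^sup>2) *\<^sub>R z1 s"] by auto
  have k0: "k = (1 / snd q) *\<^sub>R fst n"
    using k[of 0] q by (simp add: z1_def c10 t_def c(2) power2_eq_square)
  have z1: "z1 s = (snd q / (ray_den n s)\<^sup>2) *\<^sub>R fst n" for s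
  proof -
    have "z1 s = (t s)\<^sup>2 *\<^sub>R ((1 / (t s)\<^sup>2) *\<^sub>R z1 s)" using tn[of s] by simp
    also have "\<dots> = ((t s)\<^sup>2 * (1 / snd q)) *\<^sub>R fst n" unfolding k k0 by simp
    also have "(t s)\<^sup>2 * (1 / snd q) = snd q / (ray_den n s)\<^sup>2" unfolding ts using q by (simp add: power2_eq_square)
    finally show ?thesis .
  qed
  have "((\<lambda>s. fst (c s) - (snd q * sinh s / ray_den n s) *\<^sub>R fst n) has_vector_derivative 0) (at s within UNIV)" for s
  proof -
    have "((\<lambda>s. (snd q * sinh s / ray_den n s) *\<^sub>R fst n) has_vector_derivative (snd q * sinh s / ray_den n s) *\<^sub>R 0 + (snd q / (ray_den n s)\<^sup>2) *\<^sub>R fst n) (at s)"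
      by (intro has_vector_derivative_scaleR ray_num_deriv[OF n] has_vector_derivative_const)
    from has_vector_derivative_diff[OF dz this] show ?thesis unfolding z1 by simp
  qed
  then obtain k' where k': "\<And>s. fst (c s) - (snd q * sinh s / ray_den n s) *\<^sub>R fst n = k'"
    using has_vector_derivative_zero_constant[of UNIV "\<lambda>s. fst (c s) - (snd q * sinh s / ray_den n s) *\<^sub>R fst n"] by auto
  have "k' = fst q" using k'[of 0] by (simp add: c(2))
  then have "fst (c s) = fst q + (snd q * sinh s / ray_den n s) *\<^sub>R fst n" using k'[of s] by (simp add: algebra_simps)
  then show ?thesis using ts[of s] by (simp add: geo_ray_def prod_eq_iff t_def)
qed

definition ray_end :: "pt \<Rightarrow> pt \<Rightarrow> bdry" where
  "ray_end q n = (if snd n = 1 then None else Some (fst q + (snd q / (1 - snd n)) *\<^sub>R fst n))"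

lemma geo_ray_tends:
  assumes q: "0 < snd q" and n: "norm n = 1"
  shows "tends_bdry (geo_ray q n) (ray_end q n) at_top"
proof (cases "snd n = 1")
  case True
  have "fst n = 0" using unit_fst_sq[OF n] True by simp
  then have g: "geo_ray q n s = (fst q, snd q * exp s)" for s
    by (simp add: geo_ray_def ray_den_def True cosh_minus_sinh exp_minus divide_inverse)
  have "filterlim (\<lambda>s. norm (geo_ray q n s)) at_top at_top"
  proof (rule filterlim_at_top_mono)
    show "filterlim (\<lambda>s. snd q * exp s) at_top at_top"
      by (intro filterlim_tendsto_pos_mult_at_top[OF tendsto_const q] exp_at_top)
    show "\<forall>\<^sub>F s in at_top. snd q * exp s \<le> norm (geo_ray q n s)"
    proof (rule always_eventually, rule allI)
      fix s show "snd q * exp s \<le> norm (geo_ray q n s)"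
        unfolding g using norm_snd_le[of "snd q * exp s" "fst q"] q by simp
    qed
  qed
  then show ?thesis by (simp add: tends_bdry_def ray_end_def True)
next
  case False
  then have n3: "1 - snd n > 0" using unit_snd_le[OF n] by simp
  have den: "ray_den n s = cosh s * (1 - snd n * tanh s)" for s
    by (simp add: ray_den_def tanh_def field_simps)
  have l1: "((\<lambda>s. 1 / (1 - snd n * tanh s)) \<longlongrightarrow> 1 / (1 - snd n * 1)) at_top"
    using n3 by (intro tendsto_intros tanh_real_at_top) auto
  have l2: "((\<lambda>s::real. 1 / cosh s) \<longlongrightarrow> 0) at_top"
    using tendsto_inverse_0_at_top[OF cosh_real_at_top] by (simp add: inverse_eq_divide)
  have "((\<lambda>s. snd q * tanh s * (1 / (1 - snd n * tanh s))) \<longlongrightarrow> snd q * 1 * (1 / (1 - snd n * 1))) at_top"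
    by (intro tendsto_mult tendsto_const tanh_real_at_top l1)
  moreover have "snd q * sinh s / ray_den n s = snd q * tanh s * (1 / (1 - snd n * tanh s))" for s
    unfolding den by (simp add: tanh_def)
  ultimately have a: "((\<lambda>s. snd q * sinh s / ray_den n s) \<longlongrightarrow> snd q / (1 - snd n)) at_top" by simp
  have "((\<lambda>s. snd q * (1 / cosh s) * (1 / (1 - snd n * tanh s))) \<longlongrightarrow> snd q * 0 * (1 / (1 - snd n * 1))) at_top"
    by (intro tendsto_mult tendsto_const l2 l1)
  then have b: "((\<lambda>s. snd q / ray_den n s) \<longlongrightarrow> 0) at_top" unfolding den by simp
  have "((\<lambda>s. fst q + (snd q * sinh s / ray_den n s) *\<^sub>R fst n) \<longlongrightarrow> fst q + (snd q / (1 - snd n)) *\<^sub>R fst n) at_top"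
    by (intro tendsto_intros a)
  then show ?thesis using b False by (simp add: tends_bdry_def ray_end_def geo_ray_def)
qed

lemma tends_bdry_unique:
  assumes F: "F \<noteq> bot" and c: "tends_bdry c \<xi> F" "tends_bdry c \<eta> F"
  shows "\<xi> = \<eta>"
proof -
  have no: False if s: "tends_bdry c (Some w) F" and i: "tends_bdry c None F" for w
  proof -
    have "((\<lambda>x. (fst (c x), snd (c x))) \<longlongrightarrow> (w, 0)) F"
      by (rule tendsto_Pair) (use s in \<open>simp_all add: tends_bdry_def\<close>)
    then have "((\<lambda>x. norm (c x)) \<longlongrightarrow> norm (w, 0::real)) F" using tendsto_norm by fastforce
    moreover have "filterlim (\<lambda>x. norm (c x)) at_top F" using i by (simp add: tends_bdry_def)
    then have "filterlim (\<lambda>x. norm (c x)) at_infinity F" by (rule filterlim_mono[OF _ at_top_le_at_infinity order_refl])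
    ultimately show False using not_tendsto_and_filterlim_at_infinity[OF F] by blast
  qed
  show ?thesis
  proof (cases \<xi>; cases \<eta>)
    fix v w assume "\<xi> = Some v" "\<eta> = Some w"
    then show ?thesis using c tendsto_unique[OF F] by (auto simp: tends_bdry_def)
  qed (use no c in auto)
qed

lemma geod_endpoint_eq:
  assumes q: "0 < snd q" and n: "norm n = 1"
  shows "geod_endpoint q (snd q *\<^sub>R n) = ray_end q n"
  unfolding geod_endpoint_def
proof (rule the_equality)
  show "\<exists>c. hyp_geodesic c \<and> c 0 = q \<and> (c has_vector_derivative snd q *\<^sub>R n) (at 0) \<and> tends_bdry c (ray_end q n) at_top"
    using geo_ray_geodesic[OF assms] geo_ray_tends[OF assms] by blast
  fix \<xi> assume "\<exists>c. hyp_geodesic c \<and> c 0 = q \<and> (c has_vector_derivative snd q *\<^sub>R n) (at 0) \<and> tends_bdry c \<xi> at_top"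
  then obtain c where c: "hyp_geodesic c" "c 0 = q" "(c has_vector_derivative snd q *\<^sub>R n) (at 0)" "tends_bdry c \<xi> at_top" by blast
  have "c = geo_ray q n" using geodesic_unique[OF c(1-3) n] by blast
  then show "\<xi> = ray_end q n"
    using tends_bdry_unique[OF _ c(4)] geo_ray_tends[OF assms] by auto
qed

section \<open>From the upper half-space to Minkowski space\<close>

text \<open>The mean value theorem is applied first to the v-increment of \<phi> along u, then to
  the u-derivative along v.\<close>

lemma second_difference:
  fixes \<phi> :: "'a::real_normed_vector \<Rightarrow> real"
  assumes d: "\<And>x. (\<phi> has_derivative \<phi>' x) (at x)"
    and d2: "\<And>x. ((\<lambda>x. \<phi>' x u) has_derivative \<phi>2 x) (at x)" and s: "0 < s"
  shows "\<exists>a b. 0 < a \<and> a < s \<and> 0 < b \<and> b < s \<and>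
    \<phi> (z + s *\<^sub>R u + s *\<^sub>R v) - \<phi> (z + s *\<^sub>R u) - \<phi> (z + s *\<^sub>R v) + \<phi> z = s * s * \<phi>2 (z + a *\<^sub>R u + b *\<^sub>R v) v"
proof -
  have line: "((\<lambda>r. f (y + r *\<^sub>R w)) has_real_derivative f' (y + r *\<^sub>R w) w) (at r)"
    if "\<And>x. (f has_derivative f' x) (at x)" for f :: "'a \<Rightarrow> real" and f' y w r
  proof -
    have "((\<lambda>r. f (y + r *\<^sub>R w)) has_derivative (\<lambda>h. f' (y + r *\<^sub>R w) (h *\<^sub>R w))) (at r)"
      by (rule has_derivative_compose[OF _ that]) (auto intro!: derivative_eq_intros)
    moreover have "linear (f' (y + r *\<^sub>R w))" using that has_derivative_linear by blast
    ultimately show ?thesis unfolding has_field_derivative_def by (simp add: linear_cmul mult.commute[of _ "f' _ _"])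
  qed
  have "\<exists>a. 0 < a \<and> a < s \<and> (\<phi> (z + s *\<^sub>R v + s *\<^sub>R u) - \<phi> (z + s *\<^sub>R u)) - (\<phi> (z + s *\<^sub>R v + 0 *\<^sub>R u) - \<phi> (z + 0 *\<^sub>R u))
     = (s - 0) * (\<phi>' (z + s *\<^sub>R v + a *\<^sub>R u) u - \<phi>' (z + a *\<^sub>R u) u)"
    by (rule MVT2[OF s]) (intro DERIV_diff line d)
  then obtain a where a: "0 < a" "a < s" "(\<phi> (z + s *\<^sub>R v + s *\<^sub>R u) - \<phi> (z + s *\<^sub>R u)) - (\<phi> (z + s *\<^sub>R v) - \<phi> z)
     = s * (\<phi>' (z + s *\<^sub>R v + a *\<^sub>R u) u - \<phi>' (z + a *\<^sub>R u) u)" by auto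
  have "\<exists>b. 0 < b \<and> b < s \<and> \<phi>' (z + a *\<^sub>R u + s *\<^sub>R v) u - \<phi>' (z + a *\<^sub>R u + 0 *\<^sub>R v) u = (s - 0) * \<phi>2 (z + a *\<^sub>R u + b *\<^sub>R v) v"
    by (rule MVT2[OF s]) (rule line[OF d2])
  then obtain b where b: "0 < b" "b < s" "\<phi>' (z + a *\<^sub>R u + s *\<^sub>R v) u - \<phi>' (z + a *\<^sub>R u) u = s * \<phi>2 (z + a *\<^sub>R u + b *\<^sub>R v) v" by auto
  have c: "z + s *\<^sub>R v + s *\<^sub>R u = z + s *\<^sub>R u + s *\<^sub>R v" "z + s *\<^sub>R v + a *\<^sub>R u = z + a *\<^sub>R u + s *\<^sub>R v"
    by (simp_all add: add_ac)
  have "\<phi> (z + s *\<^sub>R u + s *\<^sub>R v) - \<phi> (z + s *\<^sub>R u) - \<phi> (z + s *\<^sub>R v) + \<phi> z = s * s * \<phi>2 (z + a *\<^sub>R u + b *\<^sub>R v) v"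
    using a(3)[unfolded c b(3)] by simp
  then show ?thesis using a b by blast
qed

text \<open>The second difference is symmetric in u and v. Its two representations by second
  derivatives at nearby points agree, and continuity at z transfers the equality to the
  limit.\<close>

lemma second_derivative_symmetric:
  fixes \<phi> :: "'a::real_normed_vector \<Rightarrow> real"
  assumes d: "\<And>x. (\<phi> has_derivative \<phi>' x) (at x)"
    and d2: "\<And>x u. ((\<lambda>x. \<phi>' x u) has_derivative \<phi>2 x u) (at x)"
    and c: "\<And>u v. continuous_on UNIV (\<lambda>x. \<phi>2 x u v)"
  shows "\<phi>2 z u v = \<phi>2 z v u"
proof (rule ccontr)
  assume ne: "\<phi>2 z u v \<noteq> \<phi>2 z v u"
  define e where "e = \<bar>\<phi>2 z u v - \<phi>2 z v u\<bar> / 2"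
  have e: "e > 0" using ne by (simp add: e_def)
  have ex: "\<exists>r>0. \<forall>x. dist x z < r \<longrightarrow> dist (\<phi>2 x u v) (\<phi>2 z u v) < e" for u v
    using c[of u v] e unfolding continuous_on_iff by auto
  obtain r1 where r1: "r1 > 0" "\<And>x. dist x z < r1 \<Longrightarrow> dist (\<phi>2 x u v) (\<phi>2 z u v) < e" using ex by blast
  obtain r2 where r2: "r2 > 0" "\<And>x. dist x z < r2 \<Longrightarrow> dist (\<phi>2 x v u) (\<phi>2 z v u) < e" using ex by blast
  define k where "k = norm u + norm v + 1"
  define s where "s = min r1 r2 / k"
  have k: "k > 0" unfolding k_def by (simp add: add_nonneg_pos)
  have s: "s > 0" using r1 r2 k by (simp add: s_def)
  have close: "dist (z + a *\<^sub>R x + b *\<^sub>R y) z < min r1 r2"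
    if "0 < a" "a < s" "0 < b" "b < s" and xy: "norm x + norm y = norm u + norm v" for a b x y
  proof -
    have "dist (z + a *\<^sub>R x + b *\<^sub>R y) z \<le> norm (a *\<^sub>R x) + norm (b *\<^sub>R y)"
      unfolding dist_norm by (metis add.assoc add_diff_cancel_left' norm_triangle_ineq)
    also have "\<dots> \<le> s * norm x + s * norm y" using that by (intro add_mono) (auto intro!: mult_right_mono)
    also have "\<dots> = s * (norm u + norm v)" by (simp add: xy[symmetric] distrib_left)
    also have "\<dots> < s * k" using s by (intro mult_strict_left_mono) (auto simp: k_def)
    also have "\<dots> = min r1 r2" using k by (simp add: s_def)
    finally show ?thesis .
  qed
  obtain a b where ab: "0 < a" "a < s" "0 < b" "b < s"
    "\<phi> (z + s *\<^sub>R u + s *\<^sub>R v) - \<phi> (z + s *\<^sub>R u) - \<phi> (z + s *\<^sub>R v) + \<phi> z = s * s * \<phi>2 (z + a *\<^sub>R u + b *\<^sub>R v) u v"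
    using second_difference[OF d d2 s, of z u v] by blast
  obtain a' b' where ab': "0 < a'" "a' < s" "0 < b'" "b' < s"
    "\<phi> (z + s *\<^sub>R v + s *\<^sub>R u) - \<phi> (z + s *\<^sub>R v) - \<phi> (z + s *\<^sub>R u) + \<phi> z = s * s * \<phi>2 (z + a' *\<^sub>R v + b' *\<^sub>R u) v u"
    using second_difference[OF d d2 s, of z v u] by blast
  have "s * s * \<phi>2 (z + a *\<^sub>R u + b *\<^sub>R v) u v = s * s * \<phi>2 (z + a' *\<^sub>R v + b' *\<^sub>R u) v u"
    unfolding ab(5)[symmetric] ab'(5)[symmetric] by (simp add: add_ac)
  then have "\<phi>2 (z + a *\<^sub>R u + b *\<^sub>R v) u v = \<phi>2 (z + a' *\<^sub>R v + b' *\<^sub>R u) v u" using s by simp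
  moreover have "dist (\<phi>2 (z + a *\<^sub>R u + b *\<^sub>R v) u v) (\<phi>2 z u v) < e"
    by (rule r1(2)) (use close[OF ab(1-4), of u v] in simp)
  moreover have "dist (\<phi>2 (z + a' *\<^sub>R v + b' *\<^sub>R u) v u) (\<phi>2 z v u) < e"
    by (rule r2(2)) (use close[OF ab'(1-4), of v u] in simp)
  ultimately have "\<bar>\<phi>2 z u v - \<phi>2 z v u\<bar> < e + e" unfolding dist_real_def by linarith
  then show False by (simp add: e_def)
qed

text \<open>\<open>iota\<close> maps the upper half-space isometrically to the hyperboloid: \<open>Yv p\<close> has light-cone coordinates
  \<open>(1, z, |z|\<^sup>2 + t\<^sup>2)\<close>, and dividing by \<open>t\<close> normalizes it. \<open>diota\<close> and \<open>ddiota\<close> are its first two derivatives.\<close>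

definition Yv :: "pt \<Rightarrow> mink" where "Yv p = ((1 + p \<bullet> p) / 2, (fst p, (1 - p \<bullet> p) / 2))"
definition Yd :: "pt \<Rightarrow> pt \<Rightarrow> mink" where "Yd p a = (p \<bullet> a, (fst a, - (p \<bullet> a)))"
definition Ye :: mink where "Ye = (1, (0, -1))"

definition iota :: "pt \<Rightarrow> mink" where "iota p = (1 / snd p) *\<^sub>R Yv p"
definition diota :: "pt \<Rightarrow> pt \<Rightarrow> mink" where
  "diota p a = (1 / snd p) *\<^sub>R Yd p a - (snd a / (snd p)\<^sup>2) *\<^sub>R Yv p"
definition ddiota :: "pt \<Rightarrow> pt \<Rightarrow> pt \<Rightarrow> mink" where
  "ddiota p a b = ((a \<bullet> b) / snd p) *\<^sub>R Ye - (snd b / (snd p)\<^sup>2) *\<^sub>R Yd p a - (snd a / (snd p)\<^sup>2) *\<^sub>R Yd p b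
     + (2 * snd a * snd b / (snd p) ^ 3) *\<^sub>R Yv p"

lemma pt_inner: "a \<bullet> b = fst a \<bullet> fst b + snd a * snd b" for a b :: pt
  by (simp add: inner_prod_def)

lemma mk_Y:
  "mk (Yv p) (Yv p) = - (snd p)\<^sup>2" "mk (Yv p) (Yd p a) = - (snd p * snd a)" "mk (Yd p a) (Yv p) = - (snd p * snd a)"
  "mk (Yd p a) (Yd p b) = fst a \<bullet> fst b" "mk Ye (Yv p) = -1" "mk Ye (Yd p a) = 0"
proof -
  show "mk (Yv p) (Yv p) = - (snd p)\<^sup>2"
    unfolding mk_def Yv_def by (simp add: inner_prod_def power2_eq_square field_simps)
  show 1: "mk (Yv p) (Yd p a) = - (snd p * snd a)"
    unfolding mk_def Yv_def Yd_def by (simp add: inner_prod_def[where 'b = real] field_simps)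
  show "mk (Yd p a) (Yv p) = - (snd p * snd a)" using 1 by (simp add: mk_commute)
  show "mk (Yd p a) (Yd p b) = fst a \<bullet> fst b"
    unfolding mk_def Yd_def by (simp add: inner_prod_def algebra_simps)
  show "mk Ye (Yv p) = -1" "mk Ye (Yd p a) = 0"
    unfolding mk_def Yv_def Yd_def Ye_def by (simp_all add: inner_prod_def[where 'b = real] field_simps)
qed

text \<open>The last identity shows that the flat second derivative of the embedding reproduces the
  Christoffel terms of the upper half-space, so \<open>hH\<close> is the second fundamental form in
  Minkowski space.\<close>

lemma mk_iota:
  assumes t: "0 < snd p"
  shows "mk (iota p) (iota p) = -1" "mk (iota p) (diota p a) = 0"
    "mk (diota p a) (diota p b) = (a \<bullet> b) / (snd p)\<^sup>2"
    "mk (ddiota p a b) (diota p n) =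
      ((- (snd a / snd p) *\<^sub>R b - (snd b / snd p) *\<^sub>R a + ((a \<bullet> b) / snd p) *\<^sub>R (0, 1)) \<bullet> n) / (snd p)\<^sup>2"
proof -
  show "mk (iota p) (iota p) = -1" using t by (simp add: iota_def mk_simps mk_Y power2_eq_square)
  show "mk (iota p) (diota p a) = 0"
    using t by (simp add: iota_def diota_def mk_simps mk_Y power2_eq_square)
  show "mk (diota p a) (diota p b) = (a \<bullet> b) / (snd p)\<^sup>2"
    using t by (simp add: diota_def mk_simps mk_Y pt_inner power2_eq_square field_simps)
  define t where "t = snd p"
  have t: "t \<noteq> 0" using assms by (simp add: t_def)
  have "mk (ddiota p a b) (diota p n) = (a \<bullet> b) * snd n / t ^ 3 - (snd b * (fst a \<bullet> fst n) + snd b * snd a * snd n) / t ^ 3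
      - (snd a * (fst b \<bullet> fst n) + snd a * snd b * snd n) / t ^ 3"
    unfolding ddiota_def diota_def mk_simps mk_Y t_def[symmetric] using t
    by (simp add: field_simps power2_eq_square power3_eq_cube)
  also have "\<dots> = ((- (snd a / t) *\<^sub>R b - (snd b / t) *\<^sub>R a + ((a \<bullet> b) / t) *\<^sub>R (0, 1)) \<bullet> n) / t\<^sup>2"
    using t by (simp add: inner_add_left inner_diff_left pt_inner[of b n] pt_inner[of a n] pt_inner[of _ n] field_simps power2_eq_square power3_eq_cube)
  finally show "mk (ddiota p a b) (diota p n) =
      ((- (snd a / snd p) *\<^sub>R b - (snd b / snd p) *\<^sub>R a + ((a \<bullet> b) / snd p) *\<^sub>R (0, 1)) \<bullet> n) / (snd p)\<^sup>2"
    by (simp add: t_def)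
qed

lemma diota_scale: "diota p (r *\<^sub>R a) = r *\<^sub>R diota p a"
  unfolding diota_def Yd_def by (simp add: algebra_simps)

lemma diota_minus: "diota p (- a) = - diota p a"
  using diota_scale[of p "-1" a] by simp

lemma ddiota_commute: "ddiota p a b = ddiota p b a"
  by (simp add: ddiota_def inner_commute mult.commute mult.left_commute)

lemma iota_fst_pos: "0 < fst (iota p)" if "0 < snd p"
  using that by (simp add: iota_def Yv_def add_pos_nonneg)

lemma iota_inj: "p = p'" if eq: "iota p = iota p'" and "0 < snd p" "0 < snd p'"
proof -
  have A: "fst (iota r) + snd (snd (iota r)) = 1 / snd r" "fst (snd (iota r)) = (1 / snd r) *\<^sub>R fst r" for r
  proof -
    have "fst (iota r) + snd (snd (iota r)) = (1 / snd r) * ((1 + r \<bullet> r) / 2 + (1 - r \<bullet> r) / 2)"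
      by (simp add: iota_def Yv_def distrib_left)
    also have "(1 + r \<bullet> r) / 2 + (1 - r \<bullet> r) / 2 = 1" by (simp add: field_simps)
    finally show "fst (iota r) + snd (snd (iota r)) = 1 / snd r" by simp
  qed (simp add: iota_def Yv_def)
  have "1 / snd p = 1 / snd p'" using A(1)[of p] A(1)[of p'] eq by simp
  then have t: "snd p = snd p'" using that by simp
  have "(1 / snd p) *\<^sub>R fst p = (1 / snd p') *\<^sub>R fst p'" using A(2)[of p] A(2)[of p'] eq by simp
  then have "fst p = fst p'" using t that by simp
  then show ?thesis using t by (simp add: prod_eq_iff)
qed

lemma Yv_deriv:
  assumes "(P has_derivative P') (at (z::complex))"
  shows "((\<lambda>z. Yv (P z)) has_derivative (\<lambda>v. Yd (P z) (P' v))) (at z)"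
proof -
  have i: "((\<lambda>z. P z \<bullet> P z) has_derivative (\<lambda>v. P z \<bullet> P' v + P' v \<bullet> P z)) (at z)"
    by (rule has_derivative_inner[OF assms assms])
  have "((\<lambda>z. ((1 + P z \<bullet> P z) / 2, (fst (P z), (1 - P z \<bullet> P z) / 2))) has_derivative
     (\<lambda>v. ((0 + (P z \<bullet> P' v + P' v \<bullet> P z)) / 2, (fst (P' v), (0 - (P z \<bullet> P' v + P' v \<bullet> P z)) / 2)))) (at z)"
    by (intro has_derivative_Pair has_derivative_add has_derivative_diff has_derivative_const i
        bounded_linear.has_derivative[OF bounded_linear_fst assms] bounded_linear.has_derivative[OF bounded_linear_divide])
  then show ?thesis unfolding Yv_def Yd_def by (simp add: inner_commute)
qed

lemma Yd_deriv:
  assumes "(P has_derivative P') (at (z::complex))" "(Q has_derivative Q') (at z)"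
  shows "((\<lambda>z. Yd (P z) (Q z)) has_derivative (\<lambda>v. Yd (P z) (Q' v) + (P' v \<bullet> Q z) *\<^sub>R Ye)) (at z)"
proof -
  have i: "((\<lambda>z. P z \<bullet> Q z) has_derivative (\<lambda>v. P z \<bullet> Q' v + P' v \<bullet> Q z)) (at z)"
    by (rule has_derivative_inner[OF assms])
  have "((\<lambda>z. (P z \<bullet> Q z, (fst (Q z), - (P z \<bullet> Q z)))) has_derivative
     (\<lambda>v. (P z \<bullet> Q' v + P' v \<bullet> Q z, (fst (Q' v), - (P z \<bullet> Q' v + P' v \<bullet> Q z))))) (at z)"
    by (intro has_derivative_Pair has_derivative_minus i bounded_linear.has_derivative[OF bounded_linear_fst assms(2)])
  then show ?thesis unfolding Yd_def Ye_def by simp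
qed

lemma recip_deriv:
  assumes P: "(P has_derivative P') (at (z::complex))" and t: "snd (P z :: pt) \<noteq> 0"
  shows "((\<lambda>z. 1 / snd (P z)) has_derivative (\<lambda>v. - snd (P' v) / (snd (P z))\<^sup>2)) (at z)"
  using t by (auto intro!: derivative_eq_intros P simp: power2_eq_square)

lemma iota_deriv:
  assumes P: "(P has_derivative P') (at (z::complex))" and t: "snd (P z) \<noteq> 0"
  shows "((\<lambda>z. iota (P z)) has_derivative (\<lambda>v. diota (P z) (P' v))) (at z)"
proof -
  have "((\<lambda>z. iota (P z)) has_derivative (\<lambda>v. (1 / snd (P z)) *\<^sub>R Yd (P z) (P' v) + (- snd (P' v) / (snd (P z))\<^sup>2) *\<^sub>R Yv (P z))) (at z)"
    unfolding iota_def by (rule has_derivative_scaleR[OF recip_deriv[OF P t] Yv_deriv[OF P]])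
  then show ?thesis unfolding diota_def by simp
qed

lemma diota_deriv:
  assumes P: "(P has_derivative P') (at (z::complex))" and Q: "(Q has_derivative Q') (at z)" and t: "snd (P z) \<noteq> 0"
  shows "((\<lambda>z. diota (P z) (Q z)) has_derivative (\<lambda>v. ddiota (P z) (Q z) (P' v) + diota (P z) (Q' v))) (at z)"
proof -
  have s: "((\<lambda>z. snd (Q z) / (snd (P z))\<^sup>2) has_derivative (\<lambda>v. snd (Q' v) / (snd (P z))\<^sup>2 - 2 * snd (Q z) * snd (P' v) / (snd (P z)) ^ 3)) (at z)"
    using t by (auto intro!: derivative_eq_intros P Q simp: power2_eq_square power3_eq_cube field_simps)
  have "((\<lambda>z. diota (P z) (Q z)) has_derivative
     (\<lambda>v. ((1 / snd (P z)) *\<^sub>R (Yd (P z) (Q' v) + (P' v \<bullet> Q z) *\<^sub>R Ye) + (- snd (P' v) / (snd (P z))\<^sup>2) *\<^sub>R Yd (P z) (Q z))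
       - ((snd (Q z) / (snd (P z))\<^sup>2) *\<^sub>R Yd (P z) (P' v) + (snd (Q' v) / (snd (P z))\<^sup>2 - 2 * snd (Q z) * snd (P' v) / (snd (P z)) ^ 3) *\<^sub>R Yv (P z)))) (at z)"
    unfolding diota_def
    by (intro has_derivative_diff has_derivative_scaleR recip_deriv[OF P t] Yd_deriv[OF P Q] Yv_deriv[OF P] s)
  then show ?thesis unfolding diota_def ddiota_def
    by (rule has_derivative_eq_rhs) (simp add: fun_eq_iff algebra_simps inner_commute)
qed

lemma cross'_orth: "cross' a b \<bullet> a = 0" "cross' a b \<bullet> b = 0"
  unfolding cross'_def by (simp_all add: case_prod_beta inner_prod_def inner_complex_def algebra_simps)

lemma cross'_lagrange: "cross' a b \<bullet> cross' a b = (a \<bullet> a) * (b \<bullet> b) - (a \<bullet> b)\<^sup>2"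
  unfolding cross'_def by (simp add: case_prod_beta inner_prod_def inner_complex_def power2_eq_square algebra_simps)

lemma bounded_bilinear_cross': "bounded_bilinear cross'"
  unfolding bilinear_conv_bounded_bilinear[symmetric] bilinear_def
  by (auto intro!: linearI simp: cross'_def case_prod_beta prod_eq_iff complex_eq_iff algebra_simps)

text \<open>Eliminating h22 by the trace condition writes - g11^2 det h as (g11 h12 - g12 h11)^2 +
  det g h11^2. The determinant thus controls h11, and a vanishing determinant forces the whole form
  to vanish.\<close>

lemma traceless_form_bound:
  fixes g11 g12 g22 h11 h12 h22 :: real
  assumes tr: "g22 * h11 - 2 * g12 * h12 + g11 * h22 = 0" and D: "g11 * g22 - g12\<^sup>2 > 0" and g: "g11 > 0"
  shows "- (g11 * g22 - g12\<^sup>2) < h11 * h22 - h12\<^sup>2 \<Longrightarrow> \<bar>h11\<bar> < g11"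
    "h11 * h22 - h12\<^sup>2 = 0 \<Longrightarrow> h11 = 0 \<and> h12 = 0 \<and> h22 = 0"
proof -
  let ?D = "g11 * g22 - g12\<^sup>2"
  have e: "g11 * h22 = 2 * g12 * h12 - g22 * h11" using tr by simp
  have "g11\<^sup>2 * - (h11 * h22 - h12\<^sup>2) = g11\<^sup>2 * h12\<^sup>2 - g11 * h11 * (g11 * h22)" by (simp add: power2_eq_square algebra_simps)
  also have "\<dots> = (g11 * h12 - g12 * h11)\<^sup>2 + ?D * h11\<^sup>2" unfolding e by (simp add: power2_eq_square algebra_simps)
  finally have id: "g11\<^sup>2 * - (h11 * h22 - h12\<^sup>2) = (g11 * h12 - g12 * h11)\<^sup>2 + ?D * h11\<^sup>2" .
  {
    assume "- ?D < h11 * h22 - h12\<^sup>2"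
    then have "g11\<^sup>2 * - (h11 * h22 - h12\<^sup>2) < g11\<^sup>2 * ?D" using g by (intro mult_strict_left_mono) auto
    then have "?D * h11\<^sup>2 < g11\<^sup>2 * ?D" unfolding id using zero_le_power2[of "g11 * h12 - g12 * h11"] by linarith
    then have "?D * h11\<^sup>2 < ?D * g11\<^sup>2" by (simp only: mult.commute)
    then have "\<bar>h11\<bar>\<^sup>2 < g11\<^sup>2" using D by simp
    then show "\<bar>h11\<bar> < g11" by (rule power2_less_imp_less) (use g in simp)
  }
  assume "h11 * h22 - h12\<^sup>2 = 0"
  then have "(g11 * h12 - g12 * h11)\<^sup>2 + ?D * h11\<^sup>2 = 0" using id by simp
  moreover have "0 \<le> ?D * h11\<^sup>2" using D by simp
  ultimately have "(g11 * h12 - g12 * h11)\<^sup>2 = 0" "?D * h11\<^sup>2 = 0"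
    using zero_le_power2[of "g11 * h12 - g12 * h11"] by linarith+
  then have "h11 = 0" "g11 * h12 - g12 * h11 = 0" using D by auto
  then have "h11 = 0" "h12 = 0" using g by auto
  then show "h11 = 0 \<and> h12 = 0 \<and> h22 = 0" using e g by simp
qed

section \<open>Translating an almost-Fuchsian disk into the hyperboloid model\<close>

locale AF_map =
  fixes F :: "complex \<Rightarrow> pt"
  assumes C2: "C2_map F" and imm: "immersion F" and inj: "inj F" and H3: "range F \<subseteq> H3"
    and proper: "\<And>K. compact K \<Longrightarrow> K \<subseteq> H3 \<Longrightarrow> compact (F -` K)"
    and kap: "\<And>z. kappa1 F z = - kappa2 F z" and kap1: "\<And>z. (kappa1 F z)\<^sup>2 < 1"
begin

lemma t_pos: "0 < snd (F z)" using H3 by (auto simp: H3_def)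

lemma dF: "(F has_derivative D1 F z) (at z)"
  using C2 unfolding C2_map_def D1_def[abs_def] by (simp add: frechet_derivative_works)

lemma dD1: "((\<lambda>w. D1 F w u) has_derivative D2 F z u) (at z)"
  using C2 unfolding C2_map_def D1_def D2_def[abs_def] by (simp add: frechet_derivative_works)

lemma cD2: "continuous_on UNIV (\<lambda>w. D2 F w u v)" using C2 by (simp add: C2_map_def)

lemma linear_D1: "linear (D1 F z)" using dF has_derivative_linear by blast

lemma D1_split: "D1 F z u = Re u *\<^sub>R D1 F z 1 + Im u *\<^sub>R D1 F z \<i>"
  by (rule linear_complex_split[OF linear_D1])

lemma D2_sym: "D2 F z u v = D2 F z v u"
proof (rule euclidean_eqI)
  fix b :: pt
  show "D2 F z u v \<bullet> b = D2 F z v u \<bullet> b"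
    by (rule second_derivative_symmetric[where \<phi> = "\<lambda>z. F z \<bullet> b" and \<phi>' = "\<lambda>z u. D1 F z u \<bullet> b" and ?\<phi>2.0 = "\<lambda>z u v. D2 F z u v \<bullet> b"])
      (auto intro!: has_derivative_inner_left dF dD1 continuous_intros cD2)
qed

definition "cr z = cross' (D1 F z 1) (D1 F z \<i>)"

lemma cr_nz: "cr z \<noteq> 0" using imm by (simp add: immersion_def cr_def)

lemma nE_eq: "nE F z = (1 / norm (cr z)) *\<^sub>R cr z" by (simp add: nE_def cr_def Let_def)

lemma norm_nE: "norm (nE F z) = 1" using cr_nz[of z] by (simp add: nE_eq)

lemma nE_tangent: "D1 F z u \<bullet> nE F z = 0"
proof -
  have "D1 F z 1 \<bullet> cr z = 0" "D1 F z \<i> \<bullet> cr z = 0" unfolding cr_def using cross'_orth[of "D1 F z 1" "D1 F z \<i>"] by (simp_all add: inner_commute[of "D1 F z _"])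
  then show ?thesis unfolding nE_eq D1_split[of z u] by (simp add: inner_add_left)
qed

lemma NH_tangent: "D1 F z u \<bullet> NH F z = 0" using nE_tangent by (simp add: NH_def)

lemma NH_sq: "NH F z \<bullet> NH F z = (snd (F z))\<^sup>2"
proof -
  have "nE F z \<bullet> nE F z = 1" using norm_nE by (simp add: norm_eq_1)
  then show ?thesis by (simp add: NH_def power2_eq_square)
qed

lemma NH_differentiable: "\<exists>D. (NH F has_derivative D) (at z)"
proof -
  obtain c' where c': "(cr has_derivative c') (at z)"
    unfolding cr_def[abs_def] using bounded_bilinear.FDERIV[OF bounded_bilinear_cross' dD1 dD1] by blast
  have "((\<lambda>z. norm (cr z)) has_derivative (\<lambda>h. sgn (cr z) \<bullet> c' h)) (at z)"
    using has_derivative_compose[OF c' has_derivative_norm[OF cr_nz]] by (simp add: inner_commute)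
  then obtain n' where n': "((\<lambda>z. norm (cr z)) has_derivative n') (at z)" by blast
  have nz: "norm (cr z) \<noteq> 0" using cr_nz by simp
  obtain i' where i': "((\<lambda>z. 1 / norm (cr z)) has_derivative i') (at z)"
    using has_derivative_divide'[OF has_derivative_const n' nz] by blast
  have "((\<lambda>z. snd (F z) *\<^sub>R ((1 / norm (cr z)) *\<^sub>R cr z)) has_derivative
     (\<lambda>h. snd (F z) *\<^sub>R ((1 / norm (cr z)) *\<^sub>R c' h + i' h *\<^sub>R cr z) + snd (D1 F z h) *\<^sub>R ((1 / norm (cr z)) *\<^sub>R cr z))) (at z)"
    by (intro has_derivative_scaleR i' c' bounded_linear.has_derivative[OF bounded_linear_snd dF])
  then show ?thesis unfolding NH_def[abs_def] nE_eq by blast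
qed

definition "X z = iota (F z)"
definition "N z = diota (F z) (NH F z)"
definition "X' z u = diota (F z) (D1 F z u)"
definition "X2 z u v = ddiota (F z) (D1 F z u) (D1 F z v) + diota (F z) (D2 F z u v)"
definition "N' z = (SOME D. (N has_derivative D) (at z))"

lemma gH_eq: "gH F z u v = mk (X' z u) (X' z v)"
  unfolding gH_def X'_def mk_iota(3)[OF t_pos] ..

lemma hH_eq: "hH F z u v = mk (X2 z u v) (N z)"
proof -
  have "mk (X2 z u v) (N z) = ((- (snd (D1 F z u) / snd (F z)) *\<^sub>R D1 F z v - (snd (D1 F z v) / snd (F z)) *\<^sub>R D1 F z u
      + ((D1 F z u \<bullet> D1 F z v) / snd (F z)) *\<^sub>R (0, 1)) \<bullet> NH F z) / (snd (F z))\<^sup>2 + (D2 F z u v \<bullet> NH F z) / (snd (F z))\<^sup>2"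
    unfolding X2_def N_def mk.add_left mk_iota(3)[OF t_pos] mk_iota(4)[OF t_pos] ..
  also have "\<dots> = hH F z u v"
    unfolding hH_def Let_def by (simp add: inner_add_left inner_diff_left add_divide_distrib diff_divide_distrib)
  finally show ?thesis by simp
qed

lemma gram: "gH F z 1 1 * gH F z \<i> \<i> - (gH F z 1 \<i>)\<^sup>2 > 0"
proof -
  let ?a = "D1 F z 1" and ?b = "D1 F z \<i>"
  have "0 < cr z \<bullet> cr z" using cr_nz by simp
  then have "0 < ((?a \<bullet> ?a) * (?b \<bullet> ?b) - (?a \<bullet> ?b)\<^sup>2) / ((snd (F z))\<^sup>2 * (snd (F z))\<^sup>2)"
    unfolding cr_def cross'_lagrange using t_pos[of z] by simp
  also have "\<dots> = gH F z 1 1 * gH F z \<i> \<i> - (gH F z 1 \<i>)\<^sup>2"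
    unfolding gH_def by (simp add: diff_divide_distrib power2_eq_square)
  finally show ?thesis .
qed

lemma trS_0: "trS F z = 0"
  using kap[of z] by (simp add: kappa1_def kappa2_def)

lemma trace_0: "gH F z \<i> \<i> * hH F z 1 1 - 2 * gH F z 1 \<i> * hH F z 1 \<i> + gH F z 1 1 * hH F z \<i> \<i> = 0"
  using trS_0[of z] gram[of z] by (simp add: trS_def)

lemma kappa1_eq: "kappa1 F z = sqrt (- detS F z)" by (simp add: kappa1_def trS_0)

lemma det_bound: "- (gH F z 1 1 * gH F z \<i> \<i> - (gH F z 1 \<i>)\<^sup>2) < hH F z 1 1 * hH F z \<i> \<i> - (hH F z 1 \<i>)\<^sup>2"
proof -
  have "(sqrt (- detS F z))\<^sup>2 < 1" using kap1[of z] by (simp add: kappa1_eq)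
  \<comment> \<open>The real square root is odd here, so a positive \<open>detS\<close> yields a
    negative root; in that case the claim is immediate.\<close>
  then have "- detS F z < 1"
    by (cases "- detS F z \<ge> 0") (auto simp: real_sqrt_pow2)
  then show ?thesis unfolding detS_def using gram[of z] by (simp add: divide_less_eq minus_divide_left)
qed

lemma D1_nz: "D1 F z u \<noteq> 0" if "u \<noteq> 0"
proof
  assume 0: "D1 F z u = 0"
  interpret c: bounded_bilinear cross' by (rule bounded_bilinear_cross')
  have aa: "cross' a a = 0" for a :: pt
    using cross'_lagrange[of a a] by (simp add: power2_eq_square)
  have "Re u *\<^sub>R cr z = cross' (D1 F z u) (D1 F z \<i>)" "Im u *\<^sub>R cr z = cross' (D1 F z 1) (D1 F z u)"
    unfolding D1_split[of z u] cr_def by (simp_all add: c.add_left c.add_right c.scaleR_left c.scaleR_right aa)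
  then have "Re u *\<^sub>R cr z = 0" "Im u *\<^sub>R cr z = 0" unfolding 0 by (simp_all add: c.zero_left c.zero_right)
  then show False using cr_nz[of z] that by (auto simp: complex_eq_iff)
qed

lemma proper_X: "compact {z. fst (X z) \<le> c}"
proof (cases "c > 0")
  case True
  \<comment> \<open>The closed hyperbolic ball about \<open>p0\<close> with cosh of the radius equal
    to c, or the empty set for c < 1, in Euclidean coordinates; the inequality keeps it away from t
    = 0.\<close>
  let ?K = "{p :: pt. 1 + p \<bullet> p \<le> 2 * c * snd p}"
  have "?K \<subseteq> H3"
  proof
    fix p assume "p \<in> ?K"
    moreover have "0 < 1 + p \<bullet> p" by (simp add: add_pos_nonneg)
    ultimately have "0 < 2 * c * snd p" by (simp add: less_le_trans del: mult_less_0_iff)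
    then show "p \<in> H3" using True by (simp add: H3_def zero_less_mult_iff)
  qed
  moreover have "compact ?K"
    unfolding compact_eq_bounded_closed
  proof
    show "closed ?K" by (intro closed_Collect_le continuous_intros)
    have "norm p \<le> 2 * c" if "p \<in> ?K" for p :: pt
    proof -
      have "norm p * norm p \<le> 2 * c * snd p" using that by (simp add: norm_eq_sqrt_inner)
      also have "\<dots> \<le> 2 * c * norm p"
        using True norm_snd_le[of "snd p" "fst p"] by (intro mult_left_mono) auto
      finally show ?thesis using True by (cases "p = 0") auto
    qed
    then show "bounded ?K" unfolding bounded_iff by blast
  qed
  ultimately have "compact (F -` ?K)" using proper by blast
  moreover have "F -` ?K = {z. fst (X z) \<le> c}"
  proof -
    have "fst (X z) \<le> c \<longleftrightarrow> 1 + F z \<bullet> F z \<le> 2 * c * snd (F z)" for z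
    proof -
      have "fst (X z) = (1 + F z \<bullet> F z) / (2 * snd (F z))" by (simp add: X_def iota_def Yv_def)
      then show ?thesis using t_pos[of z] by (simp add: pos_divide_le_eq mult_ac)
    qed
    then show ?thesis by auto
  qed
  ultimately show ?thesis by simp
next
  case False
  have "c < fst (X z)" for z using False iota_fst_pos[OF t_pos[of z]] by (simp add: X_def)
  then have "{z. fst (X z) \<le> c} = {}" by (auto simp: not_le)
  then show ?thesis by simp
qed

lemma dX: "(X has_derivative X' z) (at z)"
  unfolding X_def[abs_def] X'_def[abs_def] by (rule iota_deriv[OF dF]) (use t_pos[of z] in simp)

lemma dX': "((\<lambda>z. X' z u) has_derivative X2 z u) (at z)"
  unfolding X'_def X2_def[abs_def] by (rule diota_deriv[OF dF dD1]) (use t_pos[of z] in simp)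

lemma dN: "(N has_derivative N' z) (at z)"
proof -
  obtain D where "(NH F has_derivative D) (at z)" using NH_differentiable by blast
  then have "\<exists>D. (N has_derivative D) (at z)"
    unfolding N_def[abs_def] using diota_deriv[OF dF, of "NH F" D z] t_pos[of z] by fastforce
  then show ?thesis unfolding N'_def by (rule someI_ex)
qed

lemma form_splits:
  "gH F z u v = (Re u * Re v) * gH F z 1 1 + (Re u * Im v + Im u * Re v) * gH F z 1 \<i> + (Im u * Im v) * gH F z \<i> \<i>"
  "hH F z u v = (Re u * Re v) * hH F z 1 1 + (Re u * Im v + Im u * Re v) * hH F z 1 \<i> + (Im u * Im v) * hH F z \<i> \<i>"
proof -
  have X2sym: "X2 z a b = X2 z b a" for a b unfolding X2_def using D2_sym ddiota_commute by metis
  have lX2: "linear (X2 z a)" for a using dX' has_derivative_linear by blast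
  have lX2': "linear (\<lambda>a. X2 z a b)" for b using lX2[of b] X2sym[of _ b] by simp
  have s1: "X' z a = Re a *\<^sub>R X' z 1 + Im a *\<^sub>R X' z \<i>" for a
    using dX has_derivative_linear linear_complex_split by blast
  have s2: "X2 z a b = Re b *\<^sub>R X2 z a 1 + Im b *\<^sub>R X2 z a \<i>" for a b by (rule linear_complex_split[OF lX2])
  have s3: "X2 z a b = Re a *\<^sub>R X2 z 1 b + Im a *\<^sub>R X2 z \<i> b" for a b by (rule linear_complex_split[OF lX2'])
  show "gH F z u v = (Re u * Re v) * gH F z 1 1 + (Re u * Im v + Im u * Re v) * gH F z 1 \<i> + (Im u * Im v) * gH F z \<i> \<i>"
    unfolding gH_eq s1[of u] s1[of v] by (simp add: mk_simps mk_commute[of "X' z \<i>" "X' z 1"] algebra_simps)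
  show "hH F z u v = (Re u * Re v) * hH F z 1 1 + (Re u * Im v + Im u * Re v) * hH F z 1 \<i> + (Im u * Im v) * hH F z \<i> \<i>"
    unfolding hH_eq s3[of u v] s2[of 1 v] s2[of \<i> v] X2sym[of \<i> 1] by (simp add: mk_simps algebra_simps)
qed

lemma gH_pos: "0 < gH F z u u" if "u \<noteq> 0"
  unfolding gH_def using D1_nz[OF that, of z] t_pos[of z] by simp

lemma small: "\<bar>hH F z u u\<bar> < gH F z u u" if "u \<noteq> 0"
proof (rule traceless_form_bound(1))
  \<comment> \<open>Any vector u is completed to a basis by i u; the determinant of the pair is
    |u|^2.\<close>
  let ?v = "\<i> * u" and ?k = "(Re u)\<^sup>2 + (Im u)\<^sup>2"
  have k: "?k > 0" using that by (simp add: complex_eq_iff sum_power2_gt_zero_iff)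
  note s = form_splits(1)[of z u u] form_splits(1)[of z u ?v] form_splits(1)[of z ?v ?v]
    form_splits(2)[of z u u] form_splits(2)[of z u ?v] form_splits(2)[of z ?v ?v]
  have "gH F z ?v ?v * hH F z u u - 2 * gH F z u ?v * hH F z u ?v + gH F z u u * hH F z ?v ?v
     = ?k\<^sup>2 * (gH F z \<i> \<i> * hH F z 1 1 - 2 * gH F z 1 \<i> * hH F z 1 \<i> + gH F z 1 1 * hH F z \<i> \<i>)"
    unfolding s by (simp add: power2_eq_square algebra_simps)
  then show "gH F z ?v ?v * hH F z u u - 2 * gH F z u ?v * hH F z u ?v + gH F z u u * hH F z ?v ?v = 0"
    unfolding trace_0 by simp
  have gg: "gH F z u u * gH F z ?v ?v - (gH F z u ?v)\<^sup>2 = ?k\<^sup>2 * (gH F z 1 1 * gH F z \<i> \<i> - (gH F z 1 \<i>)\<^sup>2)"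
    unfolding s by (simp add: power2_eq_square algebra_simps)
  have hh: "hH F z u u * hH F z ?v ?v - (hH F z u ?v)\<^sup>2 = ?k\<^sup>2 * (hH F z 1 1 * hH F z \<i> \<i> - (hH F z 1 \<i>)\<^sup>2)"
    unfolding s by (simp add: power2_eq_square algebra_simps)
  show "0 < gH F z u u * gH F z ?v ?v - (gH F z u ?v)\<^sup>2" unfolding gg using k gram[of z] by (intro mult_pos_pos zero_less_power)
  show "0 < gH F z u u" by (rule gH_pos[OF that])
  have "?k\<^sup>2 * - (gH F z 1 1 * gH F z \<i> \<i> - (gH F z 1 \<i>)\<^sup>2) < ?k\<^sup>2 * (hH F z 1 1 * hH F z \<i> \<i> - (hH F z 1 \<i>)\<^sup>2)"
    using det_bound[of z] k by (intro mult_strict_left_mono) auto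
  then show "- (gH F z u u * gH F z ?v ?v - (gH F z u ?v)\<^sup>2) < hH F z u u * hH F z ?v ?v - (hH F z u ?v)\<^sup>2"
    unfolding gg hh by (simp only: mult_minus_right)
qed

lemma umbilic: "mk (X2 z u v) (N z) = 0" if "hopf_norm F z = 0"
proof -
  have "sqrt (- detS F z) = 0" using that by (simp add: hopf_norm_def kappa1_eq)
  then have "detS F z = 0" by simp
  then have "hH F z 1 1 * hH F z \<i> \<i> - (hH F z 1 \<i>)\<^sup>2 = 0" unfolding detS_def using gram[of z] by simp
  then have "hH F z 1 1 = 0 \<and> hH F z 1 \<i> = 0 \<and> hH F z \<i> \<i> = 0"
    by (rule traceless_form_bound(2)[OF trace_0 gram gH_pos[of 1, simplified]])
  then show ?thesis using form_splits(2)[of z u v] by (simp add: hH_eq)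
qed

lemma continuous_diota:
  assumes "continuous_on UNIV Q" shows "continuous_on UNIV (\<lambda>z. diota (F z) (Q z))"
proof -
  have c: "continuous_on UNIV F" using dF by (meson continuous_at_imp_continuous_on has_derivative_continuous)
  show ?thesis unfolding diota_def Yd_def Yv_def
    by (intro continuous_intros c assms) (use t_pos in \<open>auto simp: less_imp_neq[symmetric]\<close>)
qed

lemma continuous_ddiota:
  assumes "continuous_on UNIV Q" "continuous_on UNIV R" shows "continuous_on UNIV (\<lambda>z. ddiota (F z) (Q z) (R z))"
proof -
  have c: "continuous_on UNIV F" using dF by (meson continuous_at_imp_continuous_on has_derivative_continuous)
  show ?thesis unfolding ddiota_def Yd_def Yv_def Ye_def
    by (intro continuous_intros c assms) (use t_pos in \<open>auto simp: less_imp_neq[symmetric]\<close>)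
qed

lemma minimal_disk: "minimal_disk X N X' N' X2"
proof
  show "(X has_derivative X' z) (at z)" "(N has_derivative N' z) (at z)" "((\<lambda>z. X' z u) has_derivative X2 z u) (at z)" for z u
    by (rule dX dN dX')+
  have cD1: "continuous_on UNIV (\<lambda>z. D1 F z u)" for u
    using dD1 by (meson continuous_at_imp_continuous_on has_derivative_continuous)
  show "continuous_on UNIV (\<lambda>z. X2 z u v)" for u v
    unfolding X2_def by (intro continuous_on_add continuous_ddiota continuous_diota cD1 cD2)
  show "X2 z u v = X2 z v u" for z u v unfolding X2_def using D2_sym ddiota_commute by metis
  show "mk (X z) (X z) = -1" "0 < fst (X z)" for z unfolding X_def by (rule mk_iota iota_fst_pos, rule t_pos)+
  show "mk (N z) (N z) = 1" for z unfolding N_def mk_iota(3)[OF t_pos] NH_sq using t_pos[of z] by simp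
  show "mk (X z) (N z) = 0" for z unfolding N_def X_def by (rule mk_iota(2)[OF t_pos])
  show "mk (X' z u) (N z) = 0" for z u unfolding N_def X'_def mk_iota(3)[OF t_pos] NH_tangent by simp
  show "0 < mk (X' z u) (X' z u)" if "u \<noteq> 0" for z u using gH_pos[OF that] by (simp add: gH_eq)
  show "mk (X' z \<i>) (X' z \<i>) * mk (X2 z 1 1) (N z) - 2 * mk (X' z 1) (X' z \<i>) * mk (X2 z 1 \<i>) (N z)
       + mk (X' z 1) (X' z 1) * mk (X2 z \<i> \<i>) (N z) = 0" for z
    using trace_0[of z] by (simp add: gH_eq hH_eq)
  show "\<bar>mk (X2 z u u) (N z)\<bar> < mk (X' z u) (X' z u)" if "u \<noteq> 0" for z u
    using small[OF that] by (simp add: gH_eq hH_eq)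
  show "compact {z. fst (X z) \<le> c}" for c by (rule proper_X)
  show "inj X"
  proof (rule injI)
    fix z w assume "X z = X w"
    then have "F z = F w" using iota_inj t_pos unfolding X_def by blast
    then show "z = w" using inj by (simp add: inj_eq)
  qed
qed

end

section \<open>The limit set\<close>

text \<open>Inverse stereographic projection onto the unit sphere of null directions; infinity goes
  to the direction of \<open>Ye\<close>.\<close>

definition sph :: "bdry \<Rightarrow> pt" where
  "sph \<xi> = (case \<xi> of None \<Rightarrow> (0, -1)
     | Some w \<Rightarrow> ((2 / (1 + (cmod w)\<^sup>2)) *\<^sub>R w, (1 - (cmod w)\<^sup>2) / (1 + (cmod w)\<^sup>2)))"

lemma one_plus_sq_pos: "0 < 1 + (cmod w)\<^sup>2" by (simp add: add_pos_nonneg)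

lemma sph_inner_Some:
  "sph (Some w) \<bullet> sph (Some w') = 1 - 2 * (cmod (w - w'))\<^sup>2 / ((1 + (cmod w)\<^sup>2) * (1 + (cmod w')\<^sup>2))"
proof -
  define a b where "a = (cmod w)\<^sup>2" and "b = (cmod w')\<^sup>2"
  have ab: "1 + a > 0" "1 + b > 0" unfolding a_def b_def by (rule one_plus_sq_pos)+
  have d: "(cmod (w - w'))\<^sup>2 = a + b - 2 * (w \<bullet> w')"
    unfolding a_def b_def by (simp add: power2_norm_eq_inner inner_diff_left inner_diff_right inner_commute)
  have "sph (Some w) \<bullet> sph (Some w') = (4 * (w \<bullet> w') + (1 - a) * (1 - b)) / ((1 + a) * (1 + b))"
    unfolding sph_def a_def[symmetric] b_def[symmetric]
    using ab by (simp add: inner_prod_def a_def[symmetric] b_def[symmetric] add_divide_distrib)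
  also have "\<dots> = 1 - 2 * (a + b - 2 * (w \<bullet> w')) / ((1 + a) * (1 + b))"
  proof -
    have e: "4 * (w \<bullet> w') + (1 - a) * (1 - b) = (1 + a) * (1 + b) - 2 * (a + b - 2 * (w \<bullet> w'))" by (simp add: algebra_simps)
    show ?thesis unfolding e by (subst diff_divide_distrib) (use ab in simp)
  qed
  finally show ?thesis unfolding d unfolding a_def b_def .
qed

lemma sph_inner_None: "sph (Some w) \<bullet> sph None = 1 - 2 / (1 + (cmod w)\<^sup>2)"
proof -
  have "1 + (cmod w)\<^sup>2 \<noteq> 0" using one_plus_sq_pos[of w] by simp
  then show ?thesis by (simp add: sph_def inner_prod_def field_simps)
qed

lemma norm_sph: "norm (sph \<xi>) = 1"
proof (cases \<xi>)
  case None
  then show ?thesis by (simp add: sph_def norm_prod_def)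
next
  case (Some w)
  then show ?thesis using sph_inner_Some[of w w] by (simp add: norm_eq_1)
qed

lemma unit_dist_sq: "(norm (a - b))\<^sup>2 = 2 - 2 * (a \<bullet> b)" if "norm a = 1" "norm b = 1" for a b :: "'a::real_inner"
proof -
  have "a \<bullet> a = 1" "b \<bullet> b = 1" using that by (simp_all add: norm_eq_1)
  then show ?thesis by (simp add: power2_norm_eq_inner inner_diff_left inner_diff_right inner_commute)
qed

text \<open>The spherical distance is half the angle on the unit sphere, so the chord is \<open>2 sin (sph_dist \<xi> \<eta>)\<close>.\<close>

lemma sph_dist_chord: "sph_dist \<xi> \<eta> = arcsin (norm (sph \<xi> - sph \<eta>) / 2)"
proof -
  have eq: "norm (sph \<xi> - sph \<eta>) / 2 = x" if "0 \<le> x" "sph \<xi> \<bullet> sph \<eta> = 1 - 2 * x\<^sup>2" for x \<xi> \<eta>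
  proof (rule power2_eq_imp_eq)
    show "(norm (sph \<xi> - sph \<eta>) / 2)\<^sup>2 = x\<^sup>2"
      unfolding power_divide unit_dist_sq[OF norm_sph norm_sph] that(2) by simp
  qed (use that in auto)
  show ?thesis
  proof (cases \<xi>; cases \<eta>)
    assume "\<xi> = None" "\<eta> = None"
    then show ?thesis by (simp add: sph_dist_def)
  next
    fix w assume w: "\<xi> = None" "\<eta> = Some w"
    have "norm (sph (Some w) - sph None) / 2 = 1 / sqrt (1 + (cmod w)\<^sup>2)"
      by (rule eq) (use one_plus_sq_pos[of w] in \<open>simp_all add: sph_inner_None power_divide\<close>)
    then show ?thesis using w by (simp add: sph_dist_def norm_minus_commute)
  next
    fix w assume w: "\<xi> = Some w" "\<eta> = None"
    have "norm (sph (Some w) - sph None) / 2 = 1 / sqrt (1 + (cmod w)\<^sup>2)"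
      by (rule eq) (use one_plus_sq_pos[of w] in \<open>simp_all add: sph_inner_None power_divide\<close>)
    then show ?thesis using w by (simp add: sph_dist_def)
  next
    fix w w' assume w: "\<xi> = Some w" "\<eta> = Some w'"
    have p: "0 < (1 + (cmod w)\<^sup>2) * (1 + (cmod w')\<^sup>2)" by (intro mult_pos_pos one_plus_sq_pos)
    have "norm (sph (Some w) - sph (Some w')) / 2 = cmod (w - w') / sqrt ((1 + (cmod w)\<^sup>2) * (1 + (cmod w')\<^sup>2))"
      by (rule eq) (use p in \<open>simp_all add: sph_inner_Some power_divide\<close>)
    then show ?thesis using w by (simp add: sph_dist_def)
  qed
qed

lemma chord_le_sph_dist: "norm (sph \<xi> - sph \<eta>) \<le> 2 * sph_dist \<xi> \<eta>"
proof -
  let ?x = "norm (sph \<xi> - sph \<eta>) / 2"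
  have "norm (sph \<xi> - sph \<eta>) \<le> norm (sph \<xi>) + norm (sph \<eta>)" by (rule norm_triangle_ineq4)
  then have x: "0 \<le> ?x" "?x \<le> 1" by (simp_all add: norm_sph)
  have "?x = sin (arcsin ?x)" using x by (intro sin_arcsin[symmetric]) linarith+
  also have "\<dots> \<le> arcsin ?x" by (rule sin_x_le_x) (use x arcsin_nonneg in auto)
  finally show ?thesis unfolding sph_dist_chord by simp
qed

lemma half_cancel: "x \<noteq> 0 \<Longrightarrow> k * (x / 2) * (y / x) = k * (y / 2)" for k x y :: real
  by simp

text \<open>The direction of \<open>iota p\<close> is given by the formula for \<open>sph\<close>
  with |w|^2 replaced by the squared Euclidean norm of p. Convergence to the boundary therefore
  becomes convergence of directions in the closed unit ball.\<close>

lemma iota_ratio: "snd (iota p) = fst (iota p) *\<^sub>R ((2 / (1 + p \<bullet> p)) *\<^sub>R fst p, (1 - p \<bullet> p) / (1 + p \<bullet> p))" if "0 < snd p"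
proof -
  have "1 + p \<bullet> p \<noteq> 0" using inner_ge_zero[of p] by (metis add_pos_nonneg less_irrefl zero_less_one)
  then have e: "1 / snd p * ((1 + p \<bullet> p) / 2) * (y / (1 + p \<bullet> p)) = 1 / snd p * (y / 2)" for y by (rule half_cancel)
  show ?thesis unfolding iota_def Yv_def
    by (simp only: scaleR_Pair fst_conv snd_conv scaleR_scaleR real_scaleR_def e) simp
qed

lemma tends_bdry_sph:
  assumes "tends_bdry c \<xi> F"
  shows "((\<lambda>x. ((2 / (1 + c x \<bullet> c x)) *\<^sub>R fst (c x), (1 - c x \<bullet> c x) / (1 + c x \<bullet> c x))) \<longlongrightarrow> sph \<xi>) F"
proof (cases \<xi>)
  case (Some w)
  have f: "((\<lambda>x. fst (c x)) \<longlongrightarrow> w) F" and s: "((\<lambda>x. snd (c x)) \<longlongrightarrow> 0) F"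
    using assms Some by (simp_all add: tends_bdry_def)
  have "((\<lambda>x. fst (c x) \<bullet> fst (c x) + snd (c x) * snd (c x)) \<longlongrightarrow> w \<bullet> w + 0 * 0) F"
    by (intro tendsto_intros f s)
  then have i: "((\<lambda>x. c x \<bullet> c x) \<longlongrightarrow> (cmod w)\<^sup>2) F" by (simp add: inner_prod_def power2_norm_eq_inner)
  have nz: "1 + (cmod w)\<^sup>2 \<noteq> 0" using one_plus_sq_pos[of w] by simp
  show ?thesis unfolding Some sph_def option.case
    by (intro tendsto_Pair tendsto_intros i f nz)
next
  case None
  have n: "filterlim (\<lambda>x. norm (c x)) at_top F" using assms None by (simp add: tends_bdry_def)
  have r: "((\<lambda>x. 1 / norm (c x)) \<longlongrightarrow> 0) F"
    using tendsto_inverse_0_at_top[OF n] by (simp add: inverse_eq_divide)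
  have "((\<lambda>x. 2 * (1 / norm (c x))) \<longlongrightarrow> 2 * 0) F" by (intro tendsto_intros r)
  then have r2: "((\<lambda>x. 2 * (1 / norm (c x))) \<longlongrightarrow> 0) F" by simp
  have pos: "\<forall>\<^sub>F x in F. norm (c x) > 0" using n unfolding filterlim_at_top_dense by blast
  have sq: "p \<bullet> p = norm p * norm p" for p :: pt by (metis power2_eq_square power2_norm_eq_inner)
  have a: "((\<lambda>x. (2 / (1 + c x \<bullet> c x)) *\<^sub>R fst (c x)) \<longlongrightarrow> 0) F"
  proof (rule Lim_null_comparison[OF _ r2])
    show "\<forall>\<^sub>F x in F. norm ((2 / (1 + c x \<bullet> c x)) *\<^sub>R fst (c x)) \<le> 2 * (1 / norm (c x))"
      using pos
    proof eventually_elim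
      case (elim x)
      define m where "m = norm (c x)"
      have m: "m > 0" using elim by (simp add: m_def)
      have "norm ((2 / (1 + c x \<bullet> c x)) *\<^sub>R fst (c x)) = 2 / (1 + m * m) * norm (fst (c x))"
        unfolding sq m_def[symmetric] using m by (simp add: abs_of_pos add_pos_pos)
      also have "\<dots> \<le> 2 / (1 + m * m) * m"
        using m norm_fst_le[of "fst (c x)" "snd (c x)"] by (intro mult_left_mono) (auto simp: m_def add_pos_pos less_imp_le)
      also have "\<dots> \<le> 2 / (m * m) * m" using m by (intro mult_right_mono divide_left_mono mult_pos_pos add_pos_pos) auto
      also have "\<dots> = 2 * (1 / m)" using m by simp
      finally show ?case by (simp add: m_def)
    qed
  qed
  have b: "((\<lambda>x. (1 - c x \<bullet> c x) / (1 + c x \<bullet> c x) - - 1) \<longlongrightarrow> 0) F"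
  proof (rule Lim_null_comparison)
    have "((\<lambda>x. 2 * ((1 / norm (c x)) * (1 / norm (c x)))) \<longlongrightarrow> 2 * (0 * 0)) F" by (intro tendsto_intros r)
    then show "((\<lambda>x. 2 * ((1 / norm (c x)) * (1 / norm (c x)))) \<longlongrightarrow> 0) F" by simp
    show "\<forall>\<^sub>F x in F. norm ((1 - c x \<bullet> c x) / (1 + c x \<bullet> c x) - - 1) \<le> 2 * ((1 / norm (c x)) * (1 / norm (c x)))"
      using pos
    proof eventually_elim
      case (elim x)
      define m where "m = norm (c x)"
      have m: "m * m > 0" using elim by (simp add: m_def)
      have "(1 - m * m) / (1 + m * m) - - 1 = 2 / (1 + m * m)" using m by (simp add: field_simps)
      moreover have "2 / (1 + m * m) \<le> 2 / (m * m)" using m by (intro divide_left_mono mult_pos_pos[of "1 + m * m"] add_pos_pos) auto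
      ultimately show ?case unfolding sq m_def[symmetric] using m by simp
    qed
  qed
  show ?thesis unfolding None sph_def option.case
    by (intro tendsto_Pair a) (use b LIM_zero_iff in blast)
qed

text \<open>This connects the hyperbolic Gauss map with X + N. Unless the ray goes straight up, the
  vector has light-cone coordinates k (1, w, |w|^2), where w is the endpoint and k = (1 -
  \<open>snd n\<close>) / t.\<close>

lemma null_direction:
  assumes q: "0 < snd q" and n: "norm n = 1"
  shows "\<exists>r. iota q + diota q (snd q *\<^sub>R n) = r *\<^sub>R (1, sph (ray_end q n))"
proof -
  define t where "t = snd q"
  have t: "t > 0" using q by (simp add: t_def)
  have e: "iota q + diota q (t *\<^sub>R n) = ((1 - snd n) / t) *\<^sub>R Yv q + Yd q n"
    unfolding iota_def diota_def t_def[symmetric] using t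
    by (simp add: Yd_def prod_eq_iff algebra_simps diff_divide_distrib power2_eq_square)
  show ?thesis
  proof (cases "snd n = 1")
    case True
    have "fst n = 0" using unit_fst_sq[OF n] True by simp
    then have "Yd q n = t *\<^sub>R (1, (0, -1))" using True by (simp add: Yd_def inner_prod_def t_def)
    then show ?thesis using e True by (auto simp: ray_end_def sph_def t_def intro!: exI[of _ "snd q"])
  next
    case False
    define k where "k = (1 - snd n) / t"
    have k: "k \<noteq> 0" using False t by (simp add: k_def)
    define w where "w = fst q + (t / (1 - snd n)) *\<^sub>R fst n"
    have kw: "k *\<^sub>R w = k *\<^sub>R fst q + fst n"
      unfolding w_def k_def using False t by (simp add: scaleR_right_distrib)
    have nn: "fst n \<bullet> fst n = (1 - snd n) * (1 + snd n)" using unit_fst_sq[OF n] by (simp add: power2_eq_square algebra_simps)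
    have kt: "k * t = 1 - snd n" using t by (simp add: k_def)
    have "k * (k * (w \<bullet> w)) = (k *\<^sub>R w) \<bullet> (k *\<^sub>R w)" by simp
    also have "\<dots> = k * (k * (fst q \<bullet> fst q)) + 2 * k * (fst q \<bullet> fst n) + (k * t) * (1 + snd n)"
      unfolding kw kt by (simp add: inner_add_left inner_add_right inner_commute nn)
    also have "\<dots> = k * (k * (q \<bullet> q) + 2 * (q \<bullet> n))"
    proof -
      have "k * (q \<bullet> q) + 2 * (q \<bullet> n) = k * (fst q \<bullet> fst q) + (k * t) * t + 2 * (fst q \<bullet> fst n) + 2 * (t * snd n)"
        by (simp add: inner_prod_def t_def algebra_simps)
      also have "\<dots> = k * (fst q \<bullet> fst q) + 2 * (fst q \<bullet> fst n) + t * (1 + snd n)"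
        unfolding kt by (simp add: algebra_simps)
      finally show ?thesis by (simp add: algebra_simps)
    qed
    finally have ww: "k * (w \<bullet> w) = k * (q \<bullet> q) + 2 * (q \<bullet> n)" using k by simp
    have cw: "(cmod w)\<^sup>2 = w \<bullet> w" by (rule power2_norm_eq_inner)
    have nz: "1 + w \<bullet> w \<noteq> 0" using one_plus_sq_pos[of w] unfolding cw by simp
    have "k *\<^sub>R Yv q + Yd q n = (k * ((1 + w \<bullet> w) / 2)) *\<^sub>R (1, sph (Some w))"
    proof -
      have f: "k * ((1 + q \<bullet> q) / 2) + q \<bullet> n = k * ((1 + w \<bullet> w) / 2)" "k * ((1 - q \<bullet> q) / 2) - q \<bullet> n = k * ((1 - w \<bullet> w) / 2)"
        using ww by (simp_all add: field_simps)
      have g: "k * ((1 + w \<bullet> w) / 2) * ((1 - w \<bullet> w) / (1 + w \<bullet> w)) = k * ((1 - w \<bullet> w) / 2)"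
        "k * ((1 + w \<bullet> w) / 2) * (2 / (1 + w \<bullet> w)) = k"
        using half_cancel[OF nz, of k "1 - w \<bullet> w"] half_cancel[OF nz, of k 2] by simp_all
      have s: "sph (Some w) = ((2 / (1 + w \<bullet> w)) *\<^sub>R w, (1 - w \<bullet> w) / (1 + w \<bullet> w))" by (simp add: sph_def cw)
      show ?thesis unfolding s Yv_def Yd_def
        by (simp only: scaleR_Pair add_Pair scaleR_scaleR real_scaleR_def g f kw add_uminus_conv_diff mult_1_right)
    qed
    then show ?thesis using e False unfolding ray_end_def w_def k_def t_def by auto
  qed
qed

section \<open>Endpoints of umbilic normals stay away from accumulation points of the disk\<close>

context minimal_disk
begin

text \<open>With b = (1, s), the difference b0 - b3 is r |s - s0|^2 / 2 with r \<le> 2 M, while b0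
  \<ge> 1 / (2 M). So |s - s0| \<le> 1 / (10240 M) gives b0 - b3 \<le> 2 b0 / 10240^2, and
  multiplying by b0 + b3 \<le> 2 b0 yields (b0 / 5120)^2.\<close>

lemma horoballs_near_umbilic_endpoint:
  assumes umb: "\<And>u v. mk (X2 q u v) (N q) = 0"
    and a: "X q + N q = r *\<^sub>R (1, s0)" and s0: "norm s0 = 1" and s: "norm s = 1"
    and M: "fst (X q) \<le> M" and near: "norm (s - s0) \<le> 1 / (10240 * M)"
  shows "1 / (4 * M) \<le> - mk (X w) (1, s)"
proof -
  define T where "T = fst (X q)"
  have T: "0 < T" "T \<le> M" using Xfut[of q] M by (simp_all add: T_def)
  define b :: mink where "b = (1, s)"
  define b0 b3 where "b0 = - mk b (X q)" and "b3 = mk b (N q)"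
  have bb: "mk b b = 0" using s by (simp add: b_def mk_def norm_eq_1)
  have r: "r = fst (X q + N q)" unfolding a by simp
  then have r0: "0 < r" "r \<le> 2 * T"
    using normal_pair(2,4)[of q] by (auto simp: T_def)
  \<comment> \<open>For a unit timelike vector with time part T and space part P, (T - |P|) (T +
    |P|) = 1, and the second factor is at most 2 M.\<close>
  have b0l: "1 / (2 * M) \<le> b0"
  proof -
    have sq: "(norm (snd (X q)))\<^sup>2 = T\<^sup>2 - 1" using XX[of q] by (simp add: mk_self T_def)
    have nP: "norm (snd (X q)) < T" using timelike_norm_less[of "X q"] XX Xfut by (simp add: T_def)
    have "(T - norm (snd (X q))) * (T + norm (snd (X q))) = 1" using sq by (simp add: power2_eq_square algebra_simps)
    moreover have "(T - norm (snd (X q))) * (T + norm (snd (X q))) \<le> (T - norm (snd (X q))) * (2 * M)"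
      using nP T by (intro mult_left_mono) auto
    ultimately have "1 / (2 * M) \<le> T - norm (snd (X q))" using T by (simp add: pos_divide_le_eq)
    also have "\<dots> \<le> b0"
      using norm_cauchy_schwarz[of s "snd (X q)"] s by (simp add: b0_def b_def mk_def T_def)
    finally show ?thesis .
  qed
  moreover have "0 < 1 / (2 * M)" using T by simp
  ultimately have b0: "b0 > 0" by linarith
  have diff: "b0 - b3 = r * (norm (s - s0))\<^sup>2 / 2"
  proof -
    have "b0 - b3 = - mk b (X q + N q)" by (simp add: b0_def b3_def mk_simps)
    also have "\<dots> = r * (1 - s \<bullet> s0)" unfolding a mk.scaleR_right by (simp add: b_def mk_def algebra_simps)
    finally show ?thesis unfolding unit_dist_sq[OF s s0] by simp
  qed
  have "b0 - b3 \<le> M * (1 / (10240 * M))\<^sup>2"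
  proof -
    have "r * (norm (s - s0))\<^sup>2 \<le> (2 * M) * (1 / (10240 * M))\<^sup>2"
      using r0 T near by (intro mult_mono power_mono) auto
    then show ?thesis unfolding diff by simp
  qed
  also have "\<dots> = (1 / (2 * M)) * (2 / 10240\<^sup>2)" using T by (simp add: power2_eq_square)
  also have "\<dots> \<le> b0 * (2 / 10240\<^sup>2)" using b0l by (intro mult_right_mono) auto
  finally have d: "b0 - b3 \<le> b0 * (2 / 10240\<^sup>2)" .
  have d0: "0 \<le> b0 - b3" unfolding diff using r0 by simp
  have "b0 * (2 / 10240\<^sup>2) < b0 * 1" using b0 by (intro mult_strict_left_mono) auto
  then have b3: "b3 > 0" using d by linarith
  have "- mk b (X q) / 2 \<le> - mk (X w) b"
  proof (rule horoballs_near_umbilic_normal[OF umb bb])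
    show "0 < - mk b (X q)" "0 < mk b (N q)" using b0 b3 by (simp_all add: b0_def b3_def)
    have "b0\<^sup>2 - b3\<^sup>2 = (b0 - b3) * (b0 + b3)" by (simp add: power2_eq_square algebra_simps)
    also have "\<dots> \<le> (b0 * (2 / 10240\<^sup>2)) * (2 * b0)" using d d0 b0 b3 by (intro mult_mono) auto
    also have "\<dots> = (b0 / 5120)\<^sup>2" by (simp add: power2_eq_square)
    finally show "(mk b (X q))\<^sup>2 - (mk b (N q))\<^sup>2 \<le> (mk b (X q) / 5120)\<^sup>2"
      by (simp add: b0_def b3_def power_divide)
  qed
  then have "b0 / 2 \<le> - mk (X w) b" by (simp add: b0_def)
  moreover have "1 / (4 * M) \<le> b0 / 2" using b0l by simp
  ultimately show ?thesis by (simp add: b_def)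
qed

text \<open>A point of the disk far out in direction s lies deep in every horoball centred at s,
  whereas for s close to s0 a horoball of definite size centred at s misses the disk. The centre is
  taken to be the direction of the far point itself.\<close>

lemma endpoint_ball_avoids_accumulation:
  assumes umb: "\<And>u v. mk (X2 q u v) (N q) = 0"
    and a: "X q + N q = r *\<^sub>R (1, s0)" and s0: "norm s0 = 1"
    and M: "fst (X q) \<le> M"
    and lim: "((\<lambda>n. (1 / fst (X (w n))) *\<^sub>R snd (X (w n))) \<longlongrightarrow> s1) sequentially" and s1: "norm s1 = 1"
  shows "1 / (20480 * M) < norm (s1 - s0)"
proof (rule ccontr)
  assume "\<not> 1 / (20480 * M) < norm (s1 - s0)"
  then have n10: "norm (s1 - s0) \<le> 1 / (20480 * M)" by simp
  have M0: "M > 0" using M Xfut[of q] by linarith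
  \<comment> \<open>The first bound keeps the normalized direction within 1 / (20480 M) of s1, the
    second keeps u away from 0, and the third forces (T - |P|)^2 \<le> 1 - |u| < 1 / (64 M^2),
    against T - |P| \<ge> 1 / (4 M).\<close>
  define \<eta> where "\<eta> = min (1 / (40960 * M)) (min (1/2) (1 / (64 * M\<^sup>2)))"
  have \<eta>: "\<eta> > 0" using M0 by (simp add: \<eta>_def)
  obtain n where n: "norm ((1 / fst (X (w n))) *\<^sub>R snd (X (w n)) - s1) < \<eta>"
    using lim \<eta> unfolding LIMSEQ_iff by blast
  define T P where "T = fst (X (w n))" and "P = snd (X (w n))"
  define u where "u = (1 / T) *\<^sub>R P"
  have T: "T > 0" using Xfut by (simp add: T_def)
  have un: "norm (u - s1) < \<eta>" using n by (simp add: u_def T_def P_def)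
  have u1: "1 - norm u \<le> norm (u - s1)" using norm_triangle_ineq2[of s1 u] s1 by (simp add: norm_minus_commute)
  have uh: "norm u > 1/2" using u1 un by (simp add: \<eta>_def)
  then have un0: "norm u > 0" by linarith
  have PT: "(norm P)\<^sup>2 = T\<^sup>2 - 1" using XX[of "w n"] by (simp add: mk_self T_def P_def)
  have nP: "norm P = norm u * T" using T by (simp add: u_def)
  define s where "s = (1 / norm u) *\<^sub>R u"
  have s: "norm s = 1" using un0 by (simp add: s_def)
  have ult: "norm u < 1"
  proof -
    have "(norm P)\<^sup>2 < T\<^sup>2" using PT by simp
    then have "norm P < T" by (rule power2_less_imp_less) (use T in simp)
    then show ?thesis using T unfolding nP by simp
  qed
  have "norm (s - u) = 1 - norm u"
  proof -
    have "s - u = (1 / norm u - 1) *\<^sub>R u" by (simp add: s_def algebra_simps)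
    then have "norm (s - u) = \<bar>1 / norm u - 1\<bar> * norm u" by (simp only: norm_scaleR)
    also have "\<bar>1 / norm u - 1\<bar> = 1 / norm u - 1" using ult un0 by simp
    also have "\<dots> * norm u = 1 - norm u" using un0 by (simp add: left_diff_distrib)
    finally show ?thesis .
  qed
  then have "norm (s - s1) \<le> 2 * \<eta>"
    using u1 un norm_triangle_ineq[of "s - u" "u - s1"] by simp
  also have "\<dots> \<le> 1 / (20480 * M)" using M0 by (simp add: \<eta>_def min_def field_simps)
  finally have "norm (s - s1) \<le> 1 / (20480 * M)" .
  then have "norm (s - s0) \<le> 1 / (20480 * M) + 1 / (20480 * M)"
    using n10 norm_triangle_ineq[of "s - s1" "s1 - s0"] by simp
  also have "\<dots> = 1 / (10240 * M)" by simp
  finally have "1 / (4 * M) \<le> - mk (X (w n)) (1, s)"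
    by (rule horoballs_near_umbilic_endpoint[OF umb a s0 s M])
  also have "- mk (X (w n)) (1, s) = T - P \<bullet> s" by (simp add: mk_def T_def P_def)
  also have "P \<bullet> s = norm P"
  proof -
    have "P = (norm u * T) *\<^sub>R s" using T un0 by (simp add: s_def u_def)
    then have "P \<bullet> s = (norm u * T) * (s \<bullet> s)" by (metis inner_scaleR_left)
    then show ?thesis using s unfolding nP by (simp add: norm_eq_1)
  qed
  finally have low: "1 / (4 * M) \<le> T - norm P" .
  have one: "(T - norm P) * (T + norm P) = 1" using PT by (simp add: power2_eq_square algebra_simps)
  have "0 < 1 / (4 * M)" using M0 by simp
  then have "T - norm P > 0" using low by linarith
  then have "(T - norm P) * T \<le> (T - norm P) * (T + norm P)" by (intro mult_left_mono) auto
  then have le1: "(T - norm P) * T \<le> 1" unfolding one .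
  have "T - norm P = T * (1 - norm u)" unfolding nP by (simp add: algebra_simps)
  then have "(T - norm P) * (T - norm P) = (T - norm P) * T * (1 - norm u)" by (metis mult.assoc)
  also have "\<dots> \<le> 1 * (1 - norm u)" using le1 ult by (intro mult_right_mono) auto
  also have "\<dots> < 1 / (64 * M\<^sup>2)" using u1 un by (simp add: \<eta>_def)
  finally have "(T - norm P)\<^sup>2 < (1 / (8 * M))\<^sup>2" by (simp add: power2_eq_square)
  then have "T - norm P < 1 / (8 * M)" by (rule power2_less_imp_less) (use M0 in simp)
  moreover have "1 / (8 * M) < 1 / (4 * M)" using M0 by (simp add: field_simps)
  ultimately show False using low by linarith
qed

end

text \<open>The constant doubles from 20480 to 40960 because the chord is at most twice the
  spherical distance. The negative Gauss map is the positive one of the flipped disk.\<close>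

lemma (in AF_map) sph_ball_disjoint_limit:
  assumes umb: "hopf_norm F z = 0" and M: "fst (iota (F z)) \<le> M"
    and c: "\<And>n. c n \<in> range F" "tends_bdry c \<xi> sequentially"
  shows "\<xi> \<notin> sph_ball (gauss_plus F z) (1 / (40960 * M))" "\<xi> \<notin> sph_ball (gauss_minus F z) (1 / (40960 * M))"
proof -
  have "\<forall>n. \<exists>w. c n = F w" using c(1) by blast
  then obtain w where w: "\<And>n. c n = F (w n)" by metis
  have "((\<lambda>n. (1 / fst (X (w n))) *\<^sub>R snd (X (w n))) \<longlongrightarrow> sph \<xi>) sequentially"
  proof -
    have "(1 / fst (X (w n))) *\<^sub>R snd (X (w n)) = ((2 / (1 + c n \<bullet> c n)) *\<^sub>R fst (c n), (1 - c n \<bullet> c n) / (1 + c n \<bullet> c n))" for n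
      unfolding X_def w iota_ratio[OF t_pos] using iota_fst_pos[OF t_pos[of "w n"]] by simp
    then show ?thesis using tends_bdry_sph[OF c(2)] by simp
  qed
  note lim = this
  have u: "mk (X2 z a b) (N z) = 0" for a b by (rule umbilic[OF umb])
  have gp: "gauss_plus F z = ray_end (F z) (nE F z)"
    unfolding gauss_plus_def NH_def by (rule geod_endpoint_eq[OF t_pos norm_nE])
  have gm: "gauss_minus F z = ray_end (F z) (- nE F z)"
    unfolding gauss_minus_def NH_def using geod_endpoint_eq[OF t_pos, of "- nE F z"] norm_nE by simp
  obtain r where r: "X z + N z = r *\<^sub>R (1, sph (gauss_plus F z))"
    using null_direction[OF t_pos norm_nE, of z z] unfolding gp X_def N_def NH_def by blast
  have "norm (- nE F z) = 1" using norm_nE by simp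
  from null_direction[OF t_pos this, of z]
  obtain r' where r': "X z + - N z = r' *\<^sub>R (1, sph (gauss_minus F z))"
    unfolding gm X_def N_def NH_def by (auto simp: diota_minus)
  have "1 / (20480 * M) < norm (sph \<xi> - sph (gauss_plus F z))"
    by (rule minimal_disk.endpoint_ball_avoids_accumulation[OF minimal_disk u r norm_sph _ lim norm_sph])
      (use M in \<open>simp add: X_def\<close>)
  then show "\<xi> \<notin> sph_ball (gauss_plus F z) (1 / (40960 * M))"
    using chord_le_sph_dist[of "gauss_plus F z" \<xi>] by (auto simp: sph_ball_def norm_minus_commute)
  have u': "mk (X2 z a b) (- N z) = 0" for a b using u by (simp add: mk_simps)
  have "1 / (20480 * M) < norm (sph \<xi> - sph (gauss_minus F z))"
    by (rule minimal_disk.endpoint_ball_avoids_accumulation[OF minimal_disk.flip[OF minimal_disk] u' r' norm_sph _ lim norm_sph])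
      (use M in \<open>simp add: X_def\<close>)
  then show "\<xi> \<notin> sph_ball (gauss_minus F z) (1 / (40960 * M))"
    using chord_le_sph_dist[of "gauss_minus F z" \<xi>] by (auto simp: sph_ball_def norm_minus_commute)
qed

theorem mainTheorem7:
  fixes G0 :: "mat2 set set" and E :: "pt set"
  assumes "surface_group_model G0" and "compact E" and "E \<subseteq> H3" and "p0 \<in> E"
  shows "\<exists>R'>0. \<forall>G F. almost_fuchsian G0 G F \<and> normalized F \<longrightarrow>
           (\<forall>P. P \<subseteq> E \<inter> range F \<and> (\<forall>q\<in>P. \<forall>z. F z = q \<longrightarrow> hopf_norm F z = 0) \<longrightarrow>
              (\<Union>q\<in>P. \<Union>z\<in>F -` {q}. sph_ball (gauss_plus F z) R') \<subseteq> Omega G \<and>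
              (\<Union>q\<in>P. \<Union>z\<in>F -` {q}. sph_ball (gauss_minus F z) R') \<subseteq> Omega G)"
proof -
  \<comment> \<open>The time coordinate of \<open>iota p\<close> is cosh of the distance from
    \<open>p0\<close> to p, so M depends on the farthest point of E.\<close>
  have "continuous_on E (\<lambda>p. fst (iota p))"
    unfolding iota_def Yv_def using assms(3) by (auto intro!: continuous_intros simp: H3_def)
  then obtain pm where "pm \<in> E" and pm: "\<And>p. p \<in> E \<Longrightarrow> fst (iota p) \<le> fst (iota pm)"
    using continuous_attains_sup[OF assms(2)] assms(4) by (metis empty_iff)
  define M where "M = fst (iota pm)"
  have M: "M > 0" unfolding M_def using iota_fst_pos[of pm] \<open>pm \<in> E\<close> assms(3) by (auto simp: H3_def)
  show ?thesis
  proof (intro exI[of _ "1 / (40960 * M)"] conjI allI impI)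
    fix G F P
    assume af: "almost_fuchsian G0 G F \<and> normalized F"
      and P: "P \<subseteq> E \<inter> range F \<and> (\<forall>q\<in>P. \<forall>z. F z = q \<longrightarrow> hopf_norm F z = 0)"
    then have disk: "AF_disk G F" by (simp add: almost_fuchsian_def)
    interpret AF_map F by unfold_locales (use disk in \<open>auto simp: AF_disk_def\<close>)
    have p0: "p0 \<in> range F" using af by (metis normalized_def rangeI)
    \<comment> \<open>The orbit defining the limit set starts at \<open>p0\<close>, which
      normalization places on the disk, so invariance keeps the whole orbit on it.\<close>
    have inv: "act_H A p0 \<in> range F" if "A \<in> G" for A
      using disk that p0 unfolding AF_disk_def by (metis imageI)
    have *: "\<xi> \<in> Omega G" if q: "q \<in> P" "F z = q"
      and \<xi>: "\<xi> \<in> sph_ball (gauss_plus F z) (1 / (40960 * M)) \<or> \<xi> \<in> sph_ball (gauss_minus F z) (1 / (40960 * M))" for q z \<xi>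
    proof (rule ccontr)
      assume "\<xi> \<notin> Omega G"
      then obtain \<gamma> where \<gamma>: "\<And>n. \<gamma> n \<in> G" "tends_bdry (\<lambda>n. act_H (\<gamma> n) p0) \<xi> sequentially"
        unfolding Omega_def limit_set_def by auto
      have "F z \<in> E" "hopf_norm F z = 0" using P q by blast+
      then have "hopf_norm F z = 0" "fst (iota (F z)) \<le> M" using pm[of "F z"] unfolding M_def by auto
      from sph_ball_disjoint_limit[OF this inv[OF \<gamma>(1)] \<gamma>(2)] show False using \<xi> by blast
    qed
    show "(\<Union>q\<in>P. \<Union>z\<in>F -` {q}. sph_ball (gauss_plus F z) (1 / (40960 * M))) \<subseteq> Omega G"
      "(\<Union>q\<in>P. \<Union>z\<in>F -` {q}. sph_ball (gauss_minus F z) (1 / (40960 * M))) \<subseteq> Omega G"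
      using * by auto
  qed (use M in simp)
qed

end
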